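(* Assume that $R\subseteq\mathbb{C}$ is an $L$-good subring and that property $\widetilde{\mathbf{P15}}$ holds (see the context for all notation). Then there is a unique unital $A$-algebra homomorphism $\phi\colon\mathbf{H}\to\tilde{\mathbf{J}}_A$ such that, for any $h\in\mathbf{H}$ and $w\in W$, the difference $\phi(h)t_w-h.t_w$ is an $A$-linear combination of terms $t_y$ where $y\leq_{\mathcal{LR}}w$ and $y\not\sim_{\mathcal{LR}}w$. Explicitly, $\phi$ is given by $$\phi(\mathbf{C}_w)=\sum_{\substack{z\in W,\ d\in\tilde{\mathcal{D}}\\ z\sim_{\mathcal{LR}}d}}h_{w,d,z}\,\tilde n_d\,t_z\qquad(w\in W).$$
   Context: Basic setting. $(W,S)$ is a Coxeter system with $W$ finite and length function $l$. $\Gamma$ is an abelian group (written additively) with a fixed monomial order, i.e. a total order $\leq$ such that $g\le g'$ implies $g+h\le g'+h$. $L\colon W\to\Gamma$ is a weight function, i.e. $L(ww')=L(w)+L(w')$ whenever $l(ww')=l(w)+l(w')$; assume $L(s)>0$ for all $s\in S$. Let $\mathbb{Z}_W=\mathbb{Z}[2\cos(2\pi/m_{st})\mid s,t\in S]$, $m_{st}$ the order of $st$. $R\subseteq\mathbb{C}$ is a subring containing $\mathbb{Z}_W$, with field of fractions $F$. $A=R[\Gamma]$ is the group ring with $R$-basis $\{\varepsilon^g\mid g\in\Gamma\}$, $\varepsilon^g\varepsilon^{g'}=\varepsilon^{g+g'}$; it is an integral domain with field of fractions $K$. $\mathbf{H}$ is the Iwahori--Hecke algebra: the associative $A$-algebra,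 free with basis $\{T_w\mid w\in W\}$ and identity $T_1$, such that for $s\in S$, $w\in W$: $T_sT_w=T_{sw}$ if $l(sw)>l(w)$ and $T_sT_w=T_{sw}+(v_s-v_s^{-1})T_w$ if $l(sw)<l(w)$, where $v_s=\varepsilon^{L(s)}$. Put $\mathbf{H}_K=K\otimes_A\mathbf{H}$. Representations. $F$ is a splitting field for $W$; $\{E^\lambda\mid\lambda\in\Lambda\}$ are the irreducible $F[W]$-modules up to isomorphism, $d_\lambda=\dim E^\lambda$. $\mathbf{H}_K$ is split semisimple and its irreducible modules up to isomorphism are $E^\lambda_\varepsilon$ ($\lambda\in\Lambda$), determined by $\mathrm{trace}(w,E^\lambda)=\theta_1(\mathrm{trace}(T_w,E^\lambda_\varepsilon))$ for all $w\in W$, where $\theta_1\colon A\to R$ is the $R$-linear ring homomorphism with $\theta_1(\varepsilon^g)=1$ for all $g$. Define $0\ne\mathbf{c}_\lambda\in A$ by $\sum_{w}\mathrm{trace}(T_w,E^\lambda_\varepsilon)\,\mathrm{trace}(T_{w^{-1}},E^\lambda_\varepsilon)=d_\lambda\mathbf{c}_\lambda$; one can write $\mathbf{c}_\lambda=f_\lambda\varepsilon^{-2\mathbf{a}_\lambda}+$ (combination of $\varepsilon^g$ with $g>-2\mathbf{a}_\lambda$), where $\mathbf{a}_\lambda\in\Gamma$, $\mathbf{a}_\lambda\ge0$, and $f_\lambda$ is a positive real number. $R$ is called $L$-good if $\mathbb{Z}_W\subseteq R$ and every $f_\lambda$ lies in $R$ and is invertible in $R$. Balanced representations. Let $F[\Gamma_{>0}]$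 be the set of $F$-linear combinations of $\varepsilon^g$ with $g>0$. Each $0\ne x\in K$ can be written $x=r_x\varepsilon^{g_x}\frac{1+p}{1+q}$ with $p,q\in F[\Gamma_{>0}]$ and unique $0\neq r_x\in F$, $g_x\in\Gamma$; set $g_0=+\infty$. $\mathcal{O}=\{x\in K\mid g_x\ge0\}$ is a valuation ring with maximal ideal $\mathfrak{p}=\{x\mid g_x>0\}$ and residue field $F$; the constant term of $x\in\mathcal{O}$ is its image in $F$ ($r_x$ if $g_x=0$, and $0$ if $x\in\mathfrak{p}$). A matrix representation $\rho^\lambda\colon\mathbf{H}_K\to M_{d_\lambda}(K)$ afforded by $E^\lambda_\varepsilon$ is balanced if $\varepsilon^{\mathbf{a}_\lambda}\rho^\lambda_{ij}(T_w)\in\mathcal{O}$ for all $w,i,j$; its leading matrix coefficient $c^{ij}_{w,\lambda}\in F$ is the constant term of $(-1)^{l(w)}\varepsilon^{\mathbf{a}_\lambda}\rho^\lambda_{ij}(T_w)$. For each $\lambda$ fix a balanced representation (these exist). The ring $\tilde{\mathbf{J}}$. For $x,y,z,w\in W$ put $$\tilde\gamma_{x,y,z}=\sum_{\lambda\in\Lambda}\sum_{1\le i,j,k\le d_\lambda}f_\lambda^{-1}c^{ij}_{x,\lambda}c^{jk}_{y,\lambda}c^{ki}_{z,\lambda},\qquad \tilde n_w=\sum_{\lambda\in\Lambda}\sum_{1\le i\le d_\lambda}f_\lambda^{-1}c^{ii}_{w^{-1},\lambda},$$ and $\tilde{\mathcal{D}}=\{w\in W\mid\tilde n_w\ne0\}$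 (these do not depend on the choice of balanced representations). $\tilde{\mathbf{J}}$ is the $F$-vector space with basis $\{t_w\mid w\in W\}$ and product $t_xt_y=\sum_z\tilde\gamma_{x,y,z^{-1}}t_z$; it is an associative algebra with identity $\sum_{w\in\tilde{\mathcal{D}}}\tilde n_wt_w$. If $R$ is $L$-good, all $\tilde\gamma_{x,y,z}$ lie in $R$, so the $R$-span $\tilde{\mathbf{J}}_R$ of the $t_w$ is an $R$-algebra; put $\tilde{\mathbf{J}}_A=A\otimes_R\tilde{\mathbf{J}}_R$. Kazhdan--Lusztig basis. Let $a\mapsto\bar a$ be the $R$-linear ring involution of $A$ with $\overline{\varepsilon^g}=\varepsilon^{-g}$, extended to the ring involution of $\mathbf{H}$ given by $\overline{\sum a_wT_w}=\sum\bar a_wT_{w^{-1}}^{-1}$. For $w\in W$, $\mathbf{C}_w$ is the unique element with $\overline{\mathbf{C}_w}=\mathbf{C}_w$ and $\mathbf{C}_w\in(-1)^{l(w)}T_w+\sum_{y\in W}\mathbb{Z}[\Gamma_{>0}]T_y$, where $\mathbb{Z}[\Gamma_{>0}]$ is the set of integral combinations of $\varepsilon^g$, $g>0$. These form an $A$-basis of $\mathbf{H}$; write $\mathbf{C}_x\mathbf{C}_y=\sum_zh_{x,y,z}\mathbf{C}_z$. The preorder $\leq_{\mathcal{LR}}$ on $W$ is the reflexive and transitive closure of the relation "$\mathbf{C}_y$ occurs with non-zero coefficient in $\mathbf{C}_x\mathbf{C}_w$ or $\mathbf{C}_w\mathbf{C}_x$ for some $x\in W$" (then $y\leq_{\mathcal{LR}}w$);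 $\sim_{\mathcal{LR}}$ is the associated equivalence relation, whose classes are the two-sided cells. The action $h.t_w$. $\tilde{\mathbf{J}}_A$ is a left $\mathbf{H}$-module via $\mathbf{C}_x.t_y=\sum_{z\in W}h_{x,y,z}t_z$ (left multiplication in $\mathbf{H}$ transported along $\mathbf{C}_w\leftrightarrow t_w$). Property $\widetilde{\mathbf{P15}}$: if $x,x',y,w\in W$ satisfy $w\sim_{\mathcal{LR}}y$, then $\sum_{u\in W}\tilde\gamma_{w,x',u^{-1}}h_{x,u,y}=\sum_{u\in W}h_{x,w,u}\tilde\gamma_{u,x',y^{-1}}$. Known fact: if for some $\lambda\in\Lambda$ the matrices $(c^{ij}_{x,\lambda})_{i,j}$ and $(c^{ij}_{y,\lambda})_{i,j}$ are both non-zero, then $x\sim_{\mathcal{LR}}y$. *)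

theory Defs
  imports
    Complex_Main
    "HOL-Library.Poly_Mapping"
    "HOL-Library.FuncSet"
    "HOL-Computational_Algebra.Polynomial_Factorial"
    "HOL-Algebra.Multiplicative_Group"
    "HOL-Algebra.Generated_Groups"
    "HOL-Algebra.Generated_Rings"
    "HOL-Algebra.Algebraic_Closure_Type"
    "Jordan_Normal_Form.Matrix"
begin

section \<open>Coxeter systems\<close>

definition word_prod :: "'w monoid \<Rightarrow> 'w list \<Rightarrow> 'w" where
  "word_prod G ws = foldr (\<lambda>s w. s \<otimes>\<^bsub>G\<^esub> w) ws \<one>\<^bsub>G\<^esub>"

text \<open>The congruence on words over \<open>S\<close> generated by the Coxeter relations \<open>(s t)^{m_st} = 1\<close>.
  As \<open>m_ss = 1\<close> this contains \<open>s s = 1\<close>, so that words (without formal inverses) suffice and the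
  quotient is the group presented by \<open>S\<close> and the Coxeter relations. If \<open>s t\<close> has infinite
  order then \<open>ord\<close> is \<open>0\<close> and the relation is void.\<close>

inductive coxeter_cong :: "'w monoid \<Rightarrow> 'w set \<Rightarrow> 'w list \<Rightarrow> 'w list \<Rightarrow> bool"
  for G :: "'w monoid" and S :: "'w set" where
  refl: "ws \<in> lists S \<Longrightarrow> coxeter_cong G S ws ws"
| sym: "coxeter_cong G S us vs \<Longrightarrow> coxeter_cong G S vs us"
| trans: "coxeter_cong G S us vs \<Longrightarrow> coxeter_cong G S vs ws \<Longrightarrow> coxeter_cong G S us ws"
| rel: "us \<in> lists S \<Longrightarrow> vs \<in> lists S \<Longrightarrow> s \<in> S \<Longrightarrow> t \<in> S \<Longrightarrow>
    coxeter_cong G S (us @ concat (replicate (group.ord G (s \<otimes>\<^bsub>G\<^esub> t)) [s, t]) @ vs) (us @ vs)"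

definition coxeter_system :: "'w monoid \<Rightarrow> 'w set \<Rightarrow> bool" where
  "coxeter_system G S \<longleftrightarrow>
     group G \<and> S \<subseteq> carrier G \<and> generate G S = carrier G \<and>
     (\<forall>s\<in>S. group.ord G s = 2) \<and>
     (\<forall>us\<in>lists S. \<forall>vs\<in>lists S. word_prod G us = word_prod G vs \<longrightarrow> coxeter_cong G S us vs)"

definition cox_length :: "'w monoid \<Rightarrow> 'w set \<Rightarrow> 'w \<Rightarrow> nat" where
  "cox_length G S w = (LEAST n. \<exists>ws\<in>lists S. length ws = n \<and> word_prod G ws = w)"

text \<open>The ring \<open>Z_W\<close>.\<close>

definition cos_ring :: "'w monoid \<Rightarrow> 'w set \<Rightarrow> complex set" where
  "cos_ring G S = generate_ring ring_of_type_algebra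
     {complex_of_real (2 * cos (2 * pi / real (group.ord G (s \<otimes>\<^bsub>G\<^esub> t)))) | s t. s \<in> S \<and> t \<in> S}"

section \<open>Algebras with a distinguished basis and their matrix representations\<close>

text \<open>The free module over a subring \<open>k\<close> (of the ring \<open>'a\<close>) with basis \<open>B\<close>; elements are coordinate
  functions vanishing outside \<open>B\<close>, and \<open>m x y z\<close> is the coefficient of \<open>z\<close> in the product of
  the basis elements \<open>x\<close> and \<open>y\<close>. Scalar extension keeps the structure constants and enlarges \<open>k\<close>.\<close>

definition basis_algebra ::
  "'w set \<Rightarrow> 'a::comm_ring_1 set \<Rightarrow> ('w \<Rightarrow> 'w \<Rightarrow> 'w \<Rightarrow> 'a) \<Rightarrow> ('w \<Rightarrow> 'a) \<Rightarrow> ('a, 'w \<Rightarrow> 'a) module" where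
  "basis_algebra B k m e =
     \<lparr> carrier = {f. (\<forall>b\<in>B. f b \<in> k) \<and> (\<forall>b. b \<notin> B \<longrightarrow> f b = 0)},
       monoid.mult = (\<lambda>f g z. if z \<in> B then \<Sum>x\<in>B. \<Sum>y\<in>B. f x * g y * m x y z else 0),
       monoid.one = e,
       ring.zero = (\<lambda>_. 0),
       ring.add = (\<lambda>f g z. f z + g z),
       module.smult = (\<lambda>a f z. a * f z) \<rparr>"

definition bas :: "'w \<Rightarrow> 'w \<Rightarrow> 'a::zero_neq_one" where
  "bas w = (\<lambda>x. if x = w then 1 else 0)"

definition fractions :: "'a::field set \<Rightarrow> 'a set" where
  "fractions B = {a / b | a b. a \<in> B \<and> b \<in> B \<and> b \<noteq> 0}"

definition mats_over :: "'a set \<Rightarrow> nat \<Rightarrow> 'a mat set" where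
  "mats_over k d = {N \<in> carrier_mat d d. elements_mat N \<subseteq> k}"

definition vecs_over :: "'a set \<Rightarrow> nat \<Rightarrow> 'a vec set" where
  "vecs_over k d = {v \<in> carrier_vec d. \<forall>i<d. v $ i \<in> k}"

definition mat_trace :: "'a::comm_monoid_add mat \<Rightarrow> 'a" where
  "mat_trace N = (\<Sum>i<dim_row N. N $$ (i, i))"

text \<open>In the following, \<open>k\<close> is a subfield of the ambient field \<open>'a\<close>, and \<open>M\<close> is a finite-dimensional
  \<open>k\<close>-algebra; finite-dimensional \<open>M\<close>-modules are given by matrix representations over \<open>k\<close>, and
  isomorphism of modules is equivalence of matrix representations.\<close>

definition matrix_rep :: "'a::field set \<Rightarrow> ('a, 'm) module \<Rightarrow> nat \<Rightarrow> ('m \<Rightarrow> 'a mat) \<Rightarrow> bool" where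
  "matrix_rep k M d \<rho> \<longleftrightarrow>
     (\<forall>h\<in>carrier M. \<rho> h \<in> mats_over k d) \<and>
     \<rho> \<one>\<^bsub>M\<^esub> = 1\<^sub>m d \<and>
     (\<forall>h\<in>carrier M. \<forall>h'\<in>carrier M.
        \<rho> (h \<otimes>\<^bsub>M\<^esub> h') = \<rho> h * \<rho> h' \<and> \<rho> (h \<oplus>\<^bsub>M\<^esub> h') = \<rho> h + \<rho> h') \<and>
     (\<forall>a\<in>k. \<forall>h\<in>carrier M. \<rho> (a \<odot>\<^bsub>M\<^esub> h) = a \<cdot>\<^sub>m \<rho> h)"

definition irreducible_rep :: "'a::field set \<Rightarrow> ('a, 'm) module \<Rightarrow> nat \<Rightarrow> ('m \<Rightarrow> 'a mat) \<Rightarrow> bool" where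
  "irreducible_rep k M d \<rho> \<longleftrightarrow>
     matrix_rep k M d \<rho> \<and> d > 0 \<and>
     (\<forall>U \<subseteq> vecs_over k d.
        0\<^sub>v d \<in> U \<and> (\<forall>u\<in>U. \<forall>v\<in>U. u + v \<in> U) \<and> (\<forall>a\<in>k. \<forall>u\<in>U. a \<cdot>\<^sub>v u \<in> U) \<and>
        (\<forall>h\<in>carrier M. \<forall>u\<in>U. \<rho> h *\<^sub>v u \<in> U) \<longrightarrow>
        U = {0\<^sub>v d} \<or> U = vecs_over k d)"

definition equivalent_reps ::
  "'a::field set \<Rightarrow> ('a, 'm) module \<Rightarrow> nat \<Rightarrow> ('m \<Rightarrow> 'a mat) \<Rightarrow> nat \<Rightarrow> ('m \<Rightarrow> 'a mat) \<Rightarrow> bool" where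
  "equivalent_reps k M d \<rho> d' \<rho>' \<longleftrightarrow>
     d = d' \<and>
     (\<exists>P\<in>mats_over k d. \<exists>Q\<in>mats_over k d. P * Q = 1\<^sub>m d \<and> Q * P = 1\<^sub>m d \<and>
        (\<forall>h\<in>carrier M. \<rho>' h = P * \<rho> h * Q))"

text \<open>The family \<open>(\<rho> i)\<close>, \<open>i \<in> I\<close>, represents each isomorphism class of irreducible modules
  exactly once.\<close>

definition complete_irreps ::
  "'a::field set \<Rightarrow> ('a, 'm) module \<Rightarrow> 'i set \<Rightarrow> ('i \<Rightarrow> nat) \<Rightarrow> ('i \<Rightarrow> 'm \<Rightarrow> 'a mat) \<Rightarrow> bool" where
  "complete_irreps k M I d \<rho> \<longleftrightarrow>
     (\<forall>i\<in>I. irreducible_rep k M (d i) (\<rho> i)) \<and>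
     (\<forall>i\<in>I. \<forall>j\<in>I. equivalent_reps k M (d i) (\<rho> i) (d j) (\<rho> j) \<longrightarrow> i = j) \<and>
     (\<forall>n \<tau>. irreducible_rep k M n \<tau> \<longrightarrow> (\<exists>i\<in>I. equivalent_reps k M (d i) (\<rho> i) n \<tau>))"

text \<open>Split: the endomorphism algebra of every irreducible module is \<open>k\<close>.\<close>

definition split_algebra :: "'a::field set \<Rightarrow> ('a, 'm) module \<Rightarrow> bool" where
  "split_algebra k M \<longleftrightarrow>
     (\<forall>d \<rho>. irreducible_rep k M d \<rho> \<longrightarrow>
        (\<forall>N\<in>mats_over k d. (\<forall>h\<in>carrier M. N * \<rho> h = \<rho> h * N) \<longrightarrow> (\<exists>a\<in>k. N = a \<cdot>\<^sub>m 1\<^sub>m d)))"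

text \<open>Semisimple: the Jacobson radical, i.e. the common annihilator of all irreducible modules,
  is zero.\<close>

definition semisimple_algebra :: "'a::field set \<Rightarrow> ('a, 'm) module \<Rightarrow> bool" where
  "semisimple_algebra k M \<longleftrightarrow>
     (\<forall>h\<in>carrier M. (\<forall>d \<rho>. irreducible_rep k M d \<rho> \<longrightarrow> \<rho> h = 0\<^sub>m d d) \<longrightarrow> h = \<zero>\<^bsub>M\<^esub>)"

section \<open>Group rings of the ordered group\<close>

text \<open>All coefficient rings live in \<open>\<complex>[\<Gamma>]\<close> (finitely supported functions with convolution) and in its
  field of fractions; \<open>\<Gamma>\<close> is a type \<open>'g\<close>, and the monomial order is its class order.\<close>

type_synonym 'g cgr = "'g \<Rightarrow>\<^sub>0 complex"
type_synonym 'g cgrf = "('g \<Rightarrow>\<^sub>0 complex) fract"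

definition eps :: "'g \<Rightarrow> 'g cgr" where
  "eps g = Poly_Mapping.single g 1"

definition const_gr :: "complex \<Rightarrow> 'g::zero cgr" where
  "const_gr r = Poly_Mapping.single 0 r"

definition group_ring :: "complex set \<Rightarrow> 'g cgr set" where
  "group_ring R = {p. \<forall>g. Poly_Mapping.lookup p g \<in> R}"

definition group_ring_pos :: "complex set \<Rightarrow> 'g::linordered_ab_group_add cgr set" where
  "group_ring_pos R = {p \<in> group_ring R. \<forall>g\<in>Poly_Mapping.keys p. g > 0}"

definition bar_gr :: "'g::group_add cgr \<Rightarrow> 'g cgr" where
  "bar_gr p = Poly_Mapping.map_key uminus p"

definition theta1 :: "'g cgr \<Rightarrow> complex" where
  "theta1 p = (\<Sum>g\<in>Poly_Mapping.keys p. Poly_Mapping.lookup p g)"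

section \<open>The data\<close>

text \<open>
  \<open>cgrp\<close>, \<open>cgen\<close>, \<open>weight\<close>, \<open>base\<close>: the group \<open>W\<close>, the set \<open>S\<close>, the weight function \<open>L\<close> and the ring \<open>R\<close>.
  \<open>hsc x y z\<close>: the coefficient of \<open>T_z\<close> in \<open>T_x T_y\<close>.
  \<open>idx\<close>, \<open>dm\<close>, \<open>irrW\<close>: the set \<open>\<Lambda>\<close>, the dimensions, and the modules \<open>E^\<lambda>\<close> of \<open>F[W]\<close>.
  \<open>irrH\<close>: the chosen balanced matrix representations \<open>\<rho>^\<lambda>\<close> of \<open>H_K\<close>.
  \<open>aval\<close>, \<open>fval\<close>: the invariants \<open>a_\<lambda>\<close> and \<open>f_\<lambda>\<close>.
  The conditions on these data are collected in \<open>hecke_setting\<close> below. Elements of \<open>\<Lambda>\<close> are written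
  \<open>\<mu>\<close>, the symbol \<open>\<lambda>\<close> being reserved for abstraction; matrix indices start at \<open>0\<close>.\<close>

record (overloaded) ('w, 'g::linordered_ab_group_add, 'i) hecke_datum =
  cgrp :: "'w monoid"
  cgen :: "'w set"
  weight :: "'w \<Rightarrow> 'g"
  base :: "complex set"
  hsc :: "'w \<Rightarrow> 'w \<Rightarrow> 'w \<Rightarrow> ('g \<Rightarrow>\<^sub>0 complex)"
  idx :: "'i set"
  dm :: "'i \<Rightarrow> nat"
  irrW :: "'i \<Rightarrow> ('w \<Rightarrow> complex) \<Rightarrow> complex mat"
  irrH :: "'i \<Rightarrow> ('w \<Rightarrow> ('g \<Rightarrow>\<^sub>0 complex) fract) \<Rightarrow> ('g \<Rightarrow>\<^sub>0 complex) fract mat"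
  aval :: "'i \<Rightarrow> 'g"
  fval :: "'i \<Rightarrow> real"

definition elts :: "('w, 'g::linordered_ab_group_add, 'i) hecke_datum \<Rightarrow> 'w set" where
  "elts D = carrier (cgrp D)"

definition len :: "('w, 'g::linordered_ab_group_add, 'i) hecke_datum \<Rightarrow> 'w \<Rightarrow> nat" where
  "len D = cox_length (cgrp D) (cgen D)"

definition ringA :: "('w, 'g::linordered_ab_group_add, 'i) hecke_datum \<Rightarrow> 'g cgr set" where
  "ringA D = group_ring (base D)"

definition fieldF :: "('w, 'g::linordered_ab_group_add, 'i) hecke_datum \<Rightarrow> complex set" where
  "fieldF D = fractions (base D)"

definition fieldK :: "('w, 'g::linordered_ab_group_add, 'i) hecke_datum \<Rightarrow> 'g cgrf set" where
  "fieldK D = fractions (to_fract ` ringA D)"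

section \<open>The Iwahori-Hecke algebra and its Kazhdan-Lusztig basis\<close>

definition hecke :: "('w, 'g::linordered_ab_group_add, 'i) hecke_datum \<Rightarrow> ('g cgr, 'w \<Rightarrow> 'g cgr) module" where
  "hecke D = basis_algebra (elts D) (ringA D) (hsc D) (bas \<one>\<^bsub>cgrp D\<^esub>)"

definition hecke_K :: "('w, 'g::linordered_ab_group_add, 'i) hecke_datum \<Rightarrow> ('g cgrf, 'w \<Rightarrow> 'g cgrf) module" where
  "hecke_K D = basis_algebra (elts D) (fieldK D) (\<lambda>x y z. to_fract (hsc D x y z)) (bas \<one>\<^bsub>cgrp D\<^esub>)"

definition group_algebra_F :: "('w, 'g::linordered_ab_group_add, 'i) hecke_datum \<Rightarrow> (complex, 'w \<Rightarrow> complex) module" where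
  "group_algebra_F D =
     basis_algebra (elts D) (fieldF D) (\<lambda>x y z. if x \<otimes>\<^bsub>cgrp D\<^esub> y = z then 1 else 0) (bas \<one>\<^bsub>cgrp D\<^esub>)"

text \<open>In \<open>hecke D\<close> and \<open>hecke_K D\<close>, \<open>bas w\<close> is \<open>T_w\<close>. The structure constants \<open>hsc D\<close> are those of
  the Iwahori-Hecke algebra if \<open>hecke D\<close> is an associative ring with identity \<open>T_1\<close> satisfying the
  defining relations; this determines \<open>hsc D\<close> on \<open>W\<close>.\<close>

definition is_iwahori_hecke :: "('w, 'g::linordered_ab_group_add, 'i) hecke_datum \<Rightarrow> bool" where
  "is_iwahori_hecke D \<longleftrightarrow>
     ring (hecke D) \<and>
     (\<forall>s\<in>cgen D. \<forall>w\<in>elts D. let sw = s \<otimes>\<^bsub>cgrp D\<^esub> w in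
        (len D sw > len D w \<longrightarrow> bas s \<otimes>\<^bsub>hecke D\<^esub> bas w = bas sw) \<and>
        (len D sw < len D w \<longrightarrow>
           bas s \<otimes>\<^bsub>hecke D\<^esub> bas w =
             bas sw \<oplus>\<^bsub>hecke D\<^esub> (eps (weight D s) - eps (- weight D s)) \<odot>\<^bsub>hecke D\<^esub> bas w))"

definition bar_H :: "('w, 'g::linordered_ab_group_add, 'i) hecke_datum \<Rightarrow> ('w \<Rightarrow> 'g cgr) \<Rightarrow> 'w \<Rightarrow> 'g cgr" where
  "bar_H D h =
     (\<lambda>z. \<Sum>w\<in>elts D. bar_gr (h w) * (inv\<^bsub>hecke D\<^esub> (bas (inv\<^bsub>cgrp D\<^esub> w))) z)"

definition KL :: "('w, 'g::linordered_ab_group_add, 'i) hecke_datum \<Rightarrow> 'w \<Rightarrow> 'w \<Rightarrow> 'g cgr" where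
  "KL D w = (THE C. C \<in> carrier (hecke D) \<and> bar_H D C = C \<and>
     (\<exists>q. (\<forall>y\<in>elts D. q y \<in> group_ring_pos \<int>) \<and>
          (\<forall>y\<in>elts D. C y = (-1) ^ len D w * bas w y + q y)))"

text \<open>Coordinates with respect to the Kazhdan-Lusztig basis; coordinate functions have values in \<open>A\<close>
  and vanish outside \<open>W\<close>, i.e. they lie in the carrier set of \<open>hecke D\<close>.\<close>

definition KL_coords :: "('w, 'g::linordered_ab_group_add, 'i) hecke_datum \<Rightarrow> ('w \<Rightarrow> 'g cgr) \<Rightarrow> 'w \<Rightarrow> 'g cgr" where
  "KL_coords D h = (THE c. c \<in> carrier (hecke D) \<and> h = (\<lambda>u. \<Sum>z\<in>elts D. c z * KL D z u))"

definition hcoef :: "('w, 'g::linordered_ab_group_add, 'i) hecke_datum \<Rightarrow> 'w \<Rightarrow> 'w \<Rightarrow> 'w \<Rightarrow> 'g cgr" where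
  "hcoef D x y z = KL_coords D (KL D x \<otimes>\<^bsub>hecke D\<^esub> KL D y) z"

definition le_LR :: "('w, 'g::linordered_ab_group_add, 'i) hecke_datum \<Rightarrow> 'w \<Rightarrow> 'w \<Rightarrow> bool" where
  "le_LR D y w \<longleftrightarrow>
     (y, w) \<in> {(y, w). y \<in> elts D \<and> w \<in> elts D \<and>
                (\<exists>x\<in>elts D. hcoef D x w y \<noteq> 0 \<or> hcoef D w x y \<noteq> 0)}\<^sup>*"

definition sim_LR :: "('w, 'g::linordered_ab_group_add, 'i) hecke_datum \<Rightarrow> 'w \<Rightarrow> 'w \<Rightarrow> bool" where
  "sim_LR D y w \<longleftrightarrow> le_LR D y w \<and> le_LR D w y"

section \<open>The valuation ring of \<open>K\<close> and leading matrix coefficients\<close>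

definition has_leading_form ::
  "('w, 'g::linordered_ab_group_add, 'i) hecke_datum \<Rightarrow> 'g cgrf \<Rightarrow> complex \<Rightarrow> 'g \<Rightarrow> bool" where
  "has_leading_form D x r g \<longleftrightarrow> r \<in> fieldF D \<and> r \<noteq> 0 \<and>
     (\<exists>p\<in>group_ring_pos (fieldF D). \<exists>q\<in>group_ring_pos (fieldF D).
        x = to_fract (const_gr r * eps g) * (to_fract (1 + p) / to_fract (1 + q)))"

definition lead_r :: "('w, 'g::linordered_ab_group_add, 'i) hecke_datum \<Rightarrow> 'g cgrf \<Rightarrow> complex" where
  "lead_r D x = (THE r. \<exists>g. has_leading_form D x r g)"

definition lead_g :: "('w, 'g::linordered_ab_group_add, 'i) hecke_datum \<Rightarrow> 'g cgrf \<Rightarrow> 'g" where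
  "lead_g D x = (THE g. \<exists>r. has_leading_form D x r g)"

definition val_ring :: "('w, 'g::linordered_ab_group_add, 'i) hecke_datum \<Rightarrow> 'g cgrf set" where
  "val_ring D = {x \<in> fieldK D. x = 0 \<or> lead_g D x \<ge> 0}"

definition const_term :: "('w, 'g::linordered_ab_group_add, 'i) hecke_datum \<Rightarrow> 'g cgrf \<Rightarrow> complex" where
  "const_term D x = (if x \<noteq> 0 \<and> lead_g D x = 0 then lead_r D x else 0)"

definition balanced :: "('w, 'g::linordered_ab_group_add, 'i) hecke_datum \<Rightarrow> 'i \<Rightarrow> bool" where
  "balanced D \<mu> \<longleftrightarrow>
     (\<forall>w\<in>elts D. \<forall>i<dm D \<mu>. \<forall>j<dm D \<mu>.
        to_fract (eps (aval D \<mu>)) * irrH D \<mu> (bas w) $$ (i, j) \<in> val_ring D)"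

definition lead_coef :: "('w, 'g::linordered_ab_group_add, 'i) hecke_datum \<Rightarrow> 'i \<Rightarrow> 'w \<Rightarrow> nat \<Rightarrow> nat \<Rightarrow> complex" where
  "lead_coef D \<mu> w i j =
     const_term D ((-1) ^ len D w * to_fract (eps (aval D \<mu>)) * irrH D \<mu> (bas w) $$ (i, j))"

section \<open>The standing assumptions\<close>

definition is_weight_function :: "('w, 'g::linordered_ab_group_add, 'i) hecke_datum \<Rightarrow> bool" where
  "is_weight_function D \<longleftrightarrow>
     (\<forall>w\<in>elts D. \<forall>w'\<in>elts D. len D (w \<otimes>\<^bsub>cgrp D\<^esub> w') = len D w + len D w' \<longrightarrow>
        weight D (w \<otimes>\<^bsub>cgrp D\<^esub> w') = weight D w + weight D w')"

text \<open>\<open>E^\<lambda>_\<epsilon>\<close> corresponds to \<open>E^\<lambda>\<close> under the specialisation \<open>\<theta>_1\<close>; in particular the character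
  values \<open>trace (T_w, E^\<lambda>_\<epsilon>)\<close> lie in \<open>A\<close>.\<close>

definition specialises :: "('w, 'g::linordered_ab_group_add, 'i) hecke_datum \<Rightarrow> 'i \<Rightarrow> bool" where
  "specialises D \<mu> \<longleftrightarrow>
     (\<forall>w\<in>elts D. \<exists>\<chi>\<in>ringA D.
        mat_trace (irrH D \<mu> (bas w)) = to_fract \<chi> \<and> mat_trace (irrW D \<mu> (bas w)) = theta1 \<chi>)"

text \<open>The defining equation of \<open>c_\<lambda>\<close> and the shape of its lowest term, which determine \<open>a_\<lambda>\<close> and
  \<open>f_\<lambda>\<close>.\<close>

definition has_invariants :: "('w, 'g::linordered_ab_group_add, 'i) hecke_datum \<Rightarrow> 'i \<Rightarrow> bool" where
  "has_invariants D \<mu> \<longleftrightarrow> aval D \<mu> \<ge> 0 \<and> fval D \<mu> > 0 \<and>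
     (\<exists>c\<in>ringA D. \<exists>p\<in>ringA D.
        (\<Sum>w\<in>elts D. mat_trace (irrH D \<mu> (bas w)) * mat_trace (irrH D \<mu> (bas (inv\<^bsub>cgrp D\<^esub> w))))
          = of_nat (dm D \<mu>) * to_fract c \<and>
        c = const_gr (complex_of_real (fval D \<mu>)) * eps (- (aval D \<mu> + aval D \<mu>)) + p \<and>
        (\<forall>g\<in>Poly_Mapping.keys p. g > - (aval D \<mu> + aval D \<mu>)))"

definition hecke_setting :: "('w, 'g::linordered_ab_group_add, 'i) hecke_datum \<Rightarrow> bool" where
  "hecke_setting D \<longleftrightarrow>
     coxeter_system (cgrp D) (cgen D) \<and> finite (elts D) \<and>
     is_weight_function D \<and> (\<forall>s\<in>cgen D. weight D s > 0) \<and>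
     subring (base D) ring_of_type_algebra \<and> cos_ring (cgrp D) (cgen D) \<subseteq> base D \<and>
     is_iwahori_hecke D \<and>
     finite (idx D) \<and>
     split_algebra (fieldF D) (group_algebra_F D) \<and>
     complete_irreps (fieldF D) (group_algebra_F D) (idx D) (dm D) (irrW D) \<and>
     split_algebra (fieldK D) (hecke_K D) \<and> semisimple_algebra (fieldK D) (hecke_K D) \<and>
     complete_irreps (fieldK D) (hecke_K D) (idx D) (dm D) (irrH D) \<and>
     (\<forall>\<mu>\<in>idx D. specialises D \<mu> \<and> has_invariants D \<mu> \<and> balanced D \<mu>)"

definition L_good :: "('w, 'g::linordered_ab_group_add, 'i) hecke_datum \<Rightarrow> bool" where
  "L_good D \<longleftrightarrow>
     cos_ring (cgrp D) (cgen D) \<subseteq> base D \<and>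
     (\<forall>\<mu>\<in>idx D. complex_of_real (fval D \<mu>) \<in> base D \<and> inverse (complex_of_real (fval D \<mu>)) \<in> base D)"

section \<open>The ring \<open>J\<close> and the action of \<open>H\<close> on it\<close>

definition gamma_t :: "('w, 'g::linordered_ab_group_add, 'i) hecke_datum \<Rightarrow> 'w \<Rightarrow> 'w \<Rightarrow> 'w \<Rightarrow> complex" where
  "gamma_t D x y z =
     (\<Sum>\<mu>\<in>idx D. \<Sum>i<dm D \<mu>. \<Sum>j<dm D \<mu>. \<Sum>k<dm D \<mu>.
        inverse (complex_of_real (fval D \<mu>)) *
        lead_coef D \<mu> x i j * lead_coef D \<mu> y j k * lead_coef D \<mu> z k i)"

definition n_t :: "('w, 'g::linordered_ab_group_add, 'i) hecke_datum \<Rightarrow> 'w \<Rightarrow> complex" where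
  "n_t D w =
     (\<Sum>\<mu>\<in>idx D. \<Sum>i<dm D \<mu>.
        inverse (complex_of_real (fval D \<mu>)) * lead_coef D \<mu> (inv\<^bsub>cgrp D\<^esub> w) i i)"

definition D_t :: "('w, 'g::linordered_ab_group_add, 'i) hecke_datum \<Rightarrow> 'w set" where
  "D_t D = {w \<in> elts D. n_t D w \<noteq> 0}"

definition J_A :: "('w, 'g::linordered_ab_group_add, 'i) hecke_datum \<Rightarrow> ('g cgr, 'w \<Rightarrow> 'g cgr) module" where
  "J_A D = basis_algebra (elts D) (ringA D)
     (\<lambda>x y z. const_gr (gamma_t D x y (inv\<^bsub>cgrp D\<^esub> z)))
     (\<lambda>u. \<Sum>w\<in>D_t D. const_gr (n_t D w) * bas w u)"

text \<open>The bilinear extension of \<open>C_x . t_y = \<Sum>_z h_{x,y,z} t_z\<close>; here \<open>bas w\<close> is \<open>t_w\<close>.\<close>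

definition act :: "('w, 'g::linordered_ab_group_add, 'i) hecke_datum \<Rightarrow> ('w \<Rightarrow> 'g cgr) \<Rightarrow> ('w \<Rightarrow> 'g cgr) \<Rightarrow> 'w \<Rightarrow> 'g cgr" where
  "act D h j = (\<lambda>z. \<Sum>x\<in>elts D. \<Sum>y\<in>elts D. KL_coords D h x * j y * hcoef D x y z)"

definition P15_tilde :: "('w, 'g::linordered_ab_group_add, 'i) hecke_datum \<Rightarrow> bool" where
  "P15_tilde D \<longleftrightarrow>
     (\<forall>x\<in>elts D. \<forall>x'\<in>elts D. \<forall>y\<in>elts D. \<forall>w\<in>elts D. sim_LR D w y \<longrightarrow>
        (\<Sum>u\<in>elts D. const_gr (gamma_t D w x' (inv\<^bsub>cgrp D\<^esub> u)) * hcoef D x u y) =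
        (\<Sum>u\<in>elts D. hcoef D x w u * const_gr (gamma_t D u x' (inv\<^bsub>cgrp D\<^esub> y))))"

definition unital_A_alg_hom ::
  "('w, 'g::linordered_ab_group_add, 'i) hecke_datum \<Rightarrow> (('w \<Rightarrow> 'g cgr) \<Rightarrow> 'w \<Rightarrow> 'g cgr) \<Rightarrow> bool" where
  "unital_A_alg_hom D \<phi> \<longleftrightarrow>
     \<phi> \<in> Ring.ring_hom (hecke D) (J_A D) \<and>
     (\<forall>a\<in>ringA D. \<forall>h\<in>carrier (hecke D). \<phi> (a \<odot>\<^bsub>hecke D\<^esub> h) = a \<odot>\<^bsub>J_A D\<^esub> \<phi> h)"

definition agrees_with_action_mod_lower ::
  "('w, 'g::linordered_ab_group_add, 'i) hecke_datum \<Rightarrow> (('w \<Rightarrow> 'g cgr) \<Rightarrow> 'w \<Rightarrow> 'g cgr) \<Rightarrow> bool" where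
  "agrees_with_action_mod_lower D \<phi> \<longleftrightarrow>
     (\<forall>h\<in>carrier (hecke D). \<forall>w\<in>elts D. \<exists>c. (\<forall>y. c y \<in> ringA D) \<and>
        (\<forall>u. (\<phi> h \<otimes>\<^bsub>J_A D\<^esub> bas w) u - act D h (bas w) u =
             (\<Sum>y\<in>{y \<in> elts D. le_LR D y w \<and> \<not> sim_LR D y w}. c y * bas y u)))"

end

theory Submission
  imports Defs
begin

text \<open>
  Let \<open>*\<close> be the action of \<open>H\<close> on the graded module of the filtration by two-sided cells, that is,
  \<open>C_x * t_w\<close> is the part of \<open>C_x.t_w\<close> supported on the two-sided cell of \<open>w\<close>. The product of
  \<open>J\<close> is homogeneous for the decomposition into two-sided cells, so P15 says exactly that \<open>*\<close>
  commutes with right multiplication in \<open>J\<close>. Hence \<open>\<phi>(h) = h * 1\<close> is a homomorphism with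
  \<open>\<phi>(h) t_w = h * t_w\<close>; conversely homogeneity forces \<open>\<phi>(h) t_w = h * t_w\<close>, and therefore
  \<open>\<phi>(h) = \<phi>(h) 1 = h * 1\<close>.

  The Schur relations of the split semisimple symmetric algebra \<open>H_K\<close> specialise to orthogonality
  relations for the rows and for the columns of the leading matrix coefficients; the former give the
  identity of \<open>J\<close>. Homogeneity is obtained from the dual basis of \<open>C_w\<close>: it has the same leading
  coefficients as \<open>T_w\<close> and spans an opposite filtration, so that \<open>c_{x,\<lambda>}\<close> and \<open>c_{y,\<lambda>}\<close> can both be
  nonzero only if \<open>y^{-1} \<le> x\<close>, while the column relations show that some \<open>c_{w,\<lambda>}\<close> is nonzero for
  each \<open>w\<close>, whence \<open>w\<close> and \<open>w^{-1}\<close> lie in the same cell.\<close>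

section \<open>Subrings of fields and fractions\<close>

text \<open>The obstacle between the Schur relations over K and their specialisation is that
  \<open>const_term\<close> is a definite description about a normal form, from which neither
  additivity nor multiplicativity can be read off. The relation \<open>has_const\<close> takes its
  place: its compatibility with sums, products and inverses of units is a short computation, its
  uniqueness is proved afterwards, and only then is it compared with \<open>const_term\<close>.
  L-goodness is what puts the identity of J, and with it the candidate h * 1, into the A-form of J:
  single leading coefficients are only known to lie in F, but the numbers \<open>n_t\<close> are
  sums of leading terms of character values divided by f_lambda. The Kazhdan-Lusztig basis is
  available only through definite descriptions, so its existence and uniqueness are derived here,
  with the length function in the place of the Bruhat order. Maps of the logic are total, so
  uniqueness of phi can only mean uniqueness on the carrier of H; hence the extensional
  maps.\<close>

lemma sum_mult_bas:
  fixes f :: "'w \<Rightarrow> 'a::comm_ring_1"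
  assumes "finite B"
  shows "(\<Sum>w\<in>B. f w * bas w x) = (if x \<in> B then f x else 0)"
    and "(\<Sum>w\<in>B. f w * bas x w) = (if x \<in> B then f x else 0)"
    and "(\<Sum>w\<in>B. bas w x * f w) = (if x \<in> B then f x else 0)"
    and "(\<Sum>w\<in>B. bas x w * f w) = (if x \<in> B then f x else 0)"
  using assms
  by (simp_all add: bas_def if_distrib[of "\<lambda>c. _ * c"] if_distrib[of "\<lambda>c. c * _"] sum.delta sum.delta'
      cong: if_cong)

text \<open>A subring is a mere set inside a fixed ambient type, so one locale serves R, A, the
  integral group ring and, with inverses, the fields F and K.\<close>

locale closed_ring =
  fixes B :: "'a::comm_ring_1 set"
  assumes zero_closed [simp, intro]: "0 \<in> B"
    and one_closed [simp, intro]: "1 \<in> B"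
    and add_closed [simp, intro]: "x \<in> B \<Longrightarrow> y \<in> B \<Longrightarrow> x + y \<in> B"
    and mult_closed [simp, intro]: "x \<in> B \<Longrightarrow> y \<in> B \<Longrightarrow> x * y \<in> B"
    and uminus_closed [simp, intro]: "x \<in> B \<Longrightarrow> - x \<in> B"
begin

lemma diff_closed [simp, intro]: "x \<in> B \<Longrightarrow> y \<in> B \<Longrightarrow> x - y \<in> B"
  using add_closed[of x "- y"] by simp

lemma sum_closed [intro]: "(\<And>x. x \<in> I \<Longrightarrow> f x \<in> B) \<Longrightarrow> (\<Sum>x\<in>I. f x) \<in> B"
  by (induction I rule: infinite_finite_induct) auto

lemma power_closed [simp, intro]: "x \<in> B \<Longrightarrow> x ^ n \<in> B"
  by (induction n) auto

lemma of_nat_closed [simp, intro]: "of_nat n \<in> B"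
  by (induction n) auto

lemma of_int_closed [simp, intro]: "of_int n \<in> B"
  by (cases n rule: int_cases2) auto

end

locale closed_field = closed_ring B for B :: "'a::field set" +
  assumes inverse_closed [simp, intro]: "x \<in> B \<Longrightarrow> inverse x \<in> B"

lemma closed_ring_of_subring:
  assumes "subring B (ring_of_type_algebra :: 'a::comm_ring_1 ring)"
  shows "closed_ring B"
proof -
  interpret T: ring "ring_of_type_algebra :: 'a ring"
    by (rule ring_from_type_algebra)
  have m: "\<ominus>\<^bsub>ring_of_type_algebra\<^esub> x = - x" for x :: 'a
    by (rule T.minus_equality) (auto simp: ring_of_type_algebra_def)
  show ?thesis
    using subringE[OF assms] m by unfold_locales (auto simp: ring_of_type_algebra_def)
qed

lemma closed_field_fractions:
  assumes "closed_ring (B :: 'a::field set)"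
  shows "closed_field (fractions B)"
proof -
  interpret closed_ring B by fact
  have incl: "x \<in> fractions B" if "x \<in> B" for x
    unfolding fractions_def using that by (intro CollectI exI[of _ x] exI[of _ 1]) auto
  show ?thesis
  proof
    fix x y assume "x \<in> fractions B" "y \<in> fractions B"
    then obtain a b c d where x: "x = a / b" "a \<in> B" "b \<in> B" "b \<noteq> 0"
      and y: "y = c / d" "c \<in> B" "d \<in> B" "d \<noteq> 0"
      by (auto simp: fractions_def)
    have "x + y = (a * d + c * b) / (b * d)" using x y by (simp add: field_simps)
    then show "x + y \<in> fractions B"
      unfolding fractions_def using x y by (intro CollectI exI[of _ "a * d + c * b"] exI[of _ "b * d"]) auto
    have "x * y = (a * c) / (b * d)" using x y by simp
    then show "x * y \<in> fractions B"
      unfolding fractions_def using x y by (intro CollectI exI[of _ "a * c"] exI[of _ "b * d"]) auto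
  next
    fix x assume "x \<in> fractions B"
    then obtain a b where x: "x = a / b" "a \<in> B" "b \<in> B" "b \<noteq> 0"
      by (auto simp: fractions_def)
    then show "- x \<in> fractions B"
      unfolding fractions_def by (intro CollectI exI[of _ "- a"] exI[of _ b]) auto
    show "inverse x \<in> fractions B"
    \<comment> \<open>Numerator and denominator cannot be exchanged at zero; there
      \<open>inverse 0 = 0\<close> gives closure.\<close>
    proof (cases "a = 0")
      case True
      then show ?thesis using x incl[of 0] by simp
    next
      case False
      then show ?thesis
        unfolding fractions_def using x by (intro CollectI exI[of _ b] exI[of _ a]) auto
    qed
  qed (auto intro: incl)
qed

lemma fractions_incl: "closed_ring (B :: 'a::field set) \<Longrightarrow> x \<in> B \<Longrightarrow> x \<in> fractions B"
  unfolding fractions_def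
  by (intro CollectI exI[of _ x] exI[of _ 1]) (auto dest: closed_ring.one_closed)

section \<open>Length and parity in Coxeter groups\<close>

locale coxeter =
  fixes G :: "'w monoid" (structure) and S :: "'w set"
  assumes cox: "coxeter_system G S"
begin

sublocale group G
  using cox by (simp add: coxeter_system_def)

lemma gens_closed: "S \<subseteq> carrier G"
  using cox by (simp add: coxeter_system_def)

lemma gen_closed [simp, intro]: "s \<in> S \<Longrightarrow> s \<in> carrier G"
  using gens_closed by blast

lemma gen_square: assumes "s \<in> S" shows "s \<otimes> s = \<one>"
proof -
  have "ord s = 2" using cox assms by (simp add: coxeter_system_def)
  then have "s [^] (2::nat) = \<one>" using assms pow_ord_eq_1[of s] gen_closed by metis
  then show ?thesis using assms by (simp add: numeral_2_eq_2)
qed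

lemma gen_inv [simp]: "s \<in> S \<Longrightarrow> inv s = s"
  using gen_square by (simp add: inv_equality)

lemma gen_cancel [simp]: "s \<in> S \<Longrightarrow> w \<in> carrier G \<Longrightarrow> s \<otimes> (s \<otimes> w) = w"
  using gen_square by (simp flip: m_assoc)

lemma gen_cancel_right [simp]: "s \<in> S \<Longrightarrow> w \<in> carrier G \<Longrightarrow> w \<otimes> s \<otimes> s = w"
  using gen_square by (simp add: m_assoc)

lemma word_prod_simps [simp]:
  "word_prod G [] = \<one>" "word_prod G (s # ws) = s \<otimes> word_prod G ws"
  by (simp_all add: word_prod_def)

lemma word_prod_closed [simp, intro]: "ws \<in> lists S \<Longrightarrow> word_prod G ws \<in> carrier G"
  by (induction ws) auto

lemma word_prod_append:
  "us \<in> lists S \<Longrightarrow> vs \<in> lists S \<Longrightarrow> word_prod G (us @ vs) = word_prod G us \<otimes> word_prod G vs"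
  by (induction us) (auto simp: m_assoc)

lemma rev_in_lists [simp]: "rev ws \<in> lists S \<longleftrightarrow> ws \<in> lists S"
  by (simp add: in_lists_conv_set)

lemma word_prod_rev: "ws \<in> lists S \<Longrightarrow> word_prod G (rev ws) = inv (word_prod G ws)"
  by (induction ws) (simp_all add: word_prod_append inv_mult_group)

lemma ex_word: assumes "w \<in> carrier G" shows "\<exists>ws\<in>lists S. word_prod G ws = w"
proof -
  have "w \<in> generate G S" using assms cox by (simp add: coxeter_system_def)
  then show ?thesis
  proof induction
    case one
    show ?case by (intro bexI[of _ "[]"]) auto
  next
    case (incl h)
    then show ?case by (intro bexI[of _ "[h]"]) auto
  next
    case (inv h)
    then show ?case by (intro bexI[of _ "[h]"]) auto
  next
    case (eng h1 h2)
    then obtain us vs where "us \<in> lists S" "word_prod G us = h1" "vs \<in> lists S" "word_prod G vs = h2"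
      by blast
    then show ?case by (intro bexI[of _ "us @ vs"]) (auto simp: word_prod_append)
  qed
qed

abbreviation len where "len \<equiv> cox_length G S"

lemma reduced_word:
  assumes "w \<in> carrier G"
  obtains ws where "ws \<in> lists S" "word_prod G ws = w" "length ws = len w"
proof -
  have "\<exists>n. \<exists>ws\<in>lists S. length ws = n \<and> word_prod G ws = w" using ex_word[OF assms] by blast
  from LeastI_ex[OF this] show ?thesis using that unfolding cox_length_def by blast
qed

lemma len_le: "ws \<in> lists S \<Longrightarrow> len (word_prod G ws) \<le> length ws"
  unfolding cox_length_def by (rule Least_le) blast

text \<open>Every relator has even length 2 m_st, so the parity of a word survives the congruence.
  This is the sign character, and it is what the presentation of the group contributes.\<close>

lemma cong_parity: "coxeter_cong G S us vs \<Longrightarrow> even (length us) \<longleftrightarrow> even (length vs)"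
proof (induction rule: coxeter_cong.induct)
  case (rel us vs s t)
  have "even (length (concat (replicate n [s, t])))" for n
    by (induction n) auto
  then show ?case by simp
qed auto

lemma word_parity:
  assumes "us \<in> lists S" "vs \<in> lists S" "word_prod G us = word_prod G vs"
  shows "even (length us) \<longleftrightarrow> even (length vs)"
  using cox assms cong_parity unfolding coxeter_system_def by blast

lemma len_one [simp]: "len \<one> = 0"
  using len_le[of "[]"] by simp

lemma len_inv [simp]: assumes "w \<in> carrier G" shows "len (inv w) = len w"
proof -
  have le: "len (inv w) \<le> len w" if "w \<in> carrier G" for w
  proof -
    obtain ws where "ws \<in> lists S" "word_prod G ws = w" "length ws = len w"
      using reduced_word[OF \<open>w \<in> carrier G\<close>] .
    then show ?thesis using len_le[of "rev ws"] by (simp add: word_prod_rev)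
  qed
  show ?thesis using le[of w] le[of "inv w"] assms by simp
qed

text \<open>Prepending a letter changes the length by at most one, in either direction because
  \<open>s\<close> is an involution; parity rules out equal lengths.\<close>

lemma len_gen_mult:
  assumes "s \<in> S" "w \<in> carrier G"
  shows "len (s \<otimes> w) = Suc (len w) \<or> len w = Suc (len (s \<otimes> w))"
proof -
  have le: "len (s \<otimes> w) \<le> Suc (len w)" if "w \<in> carrier G" for w
  proof -
    obtain ws where "ws \<in> lists S" "word_prod G ws = w" "length ws = len w"
      using reduced_word[OF \<open>w \<in> carrier G\<close>] .
    then show ?thesis using len_le[of "s # ws"] assms by auto
  qed
  have "len (s \<otimes> w) \<noteq> len w"
  proof -
    obtain us where us: "us \<in> lists S" "word_prod G us = w" "length us = len w"
      using reduced_word[OF assms(2)] .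
    obtain vs where vs: "vs \<in> lists S" "word_prod G vs = s \<otimes> w" "length vs = len (s \<otimes> w)"
      using reduced_word[of "s \<otimes> w"] assms by blast
    show ?thesis using word_parity[of "s # us" vs] us vs assms by auto
  qed
  with le[of w] le[of "s \<otimes> w"] assms show ?thesis by auto
qed

lemma len_0_iff: assumes "w \<in> carrier G" shows "len w = 0 \<longleftrightarrow> w = \<one>"
  by (rule reduced_word[OF assms]) auto

lemma len_SucE:
  assumes "w \<in> carrier G" "w \<noteq> \<one>"
  obtains s w' where "s \<in> S" "w' \<in> carrier G" "w = s \<otimes> w'" "len w = Suc (len w')"
proof -
  obtain ws where ws: "ws \<in> lists S" "word_prod G ws = w" "length ws = len w"
    using reduced_word[OF assms(1)] .
  then obtain s us where us: "ws = s # us" using assms by (cases ws) auto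
  have "len (word_prod G us) \<le> length us" using len_le[of us] ws us by auto
  moreover have "len w = Suc (len (word_prod G us)) \<or> len (word_prod G us) = Suc (len w)"
    using len_gen_mult[of s "word_prod G us"] ws us by auto
  ultimately show ?thesis using that[of s "word_prod G us"] ws us by auto
qed

lemma length_induct [consumes 1, case_names one step]:
  assumes "w \<in> carrier G" "P \<one>"
    and "\<And>s w. s \<in> S \<Longrightarrow> w \<in> carrier G \<Longrightarrow> len (s \<otimes> w) = Suc (len w) \<Longrightarrow> P w \<Longrightarrow> P (s \<otimes> w)"
  shows "P w"
  using assms(1)
proof (induction "len w" arbitrary: w)
  case 0
  then show ?case using len_0_iff assms(2) by auto
next
  case (Suc n)
  then have "w \<noteq> \<one>" by auto
  then obtain s w' where "s \<in> S" "w' \<in> carrier G" "w = s \<otimes> w'" "len w = Suc (len w')"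
    using len_SucE Suc.prems by blast
  then show ?case using Suc assms(3)[of s w'] by auto
qed

text \<open>Inversion preserves length and reverses words, so this is left induction applied to the
  predicate \<open>P (inv v)\<close>.\<close>

lemma length_induct_right [consumes 1, case_names one step]:
  assumes "w \<in> carrier G" "P \<one>"
    and "\<And>s w. s \<in> S \<Longrightarrow> w \<in> carrier G \<Longrightarrow> len (w \<otimes> s) = Suc (len w) \<Longrightarrow> P w \<Longrightarrow> P (w \<otimes> s)"
  shows "P w"
proof -
  have "P (inv v)" if "v \<in> carrier G" for v
    using that
  proof (induction rule: length_induct)
    case (step s v)
    have "len (inv v \<otimes> s) = len (s \<otimes> v)"
      using len_inv[of "s \<otimes> v"] step by (simp add: inv_mult_group)
    then show ?case using assms(3)[of s "inv v"] step by (simp add: inv_mult_group)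
  qed (use assms(2) in simp)
  from this[of "inv w"] show ?thesis using assms(1) by simp
qed

lemma len_mult_le:
  assumes "x \<in> carrier G" "y \<in> carrier G" shows "len (x \<otimes> y) \<le> len x + len y"
  using assms(1)
proof (induction rule: length_induct)
  case (step s w)
  then show ?case using len_gen_mult[of s "w \<otimes> y"] assms(2) by (auto simp: m_assoc)
qed (use assms(2) in simp)

end

section \<open>The valuation on the field of fractions\<close>

abbreviation coeff_at :: "('g \<Rightarrow>\<^sub>0 complex) \<Rightarrow> 'g \<Rightarrow> complex" where
  "coeff_at \<equiv> Poly_Mapping.lookup"

abbreviation supp :: "('g \<Rightarrow>\<^sub>0 complex) \<Rightarrow> 'g set" where
  "supp \<equiv> Poly_Mapping.keys"

text \<open>In a group the second exponent is determined as k - a, so the convolution collapses to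
  one finite sum.\<close>

lemma coeff_at_mult:
  fixes p q :: "'g::ab_group_add \<Rightarrow>\<^sub>0 complex"
  shows "coeff_at (p * q) k = (\<Sum>a\<in>supp p. coeff_at p a * coeff_at q (k - a))"
proof -
  have "(\<Sum>b. coeff_at q b when k = a + b) = coeff_at q (k - a)" for a
  proof -
    have "(\<Sum>b. coeff_at q b when k = a + b) = (\<Sum>b. coeff_at q b when b = k - a)"
      by (rule Sum_any.cong) (auto simp: when_def algebra_simps)
    then show ?thesis by simp
  qed
  then have "coeff_at (p * q) k = (\<Sum>a. coeff_at p a * coeff_at q (k - a))"
    by (simp add: lookup_mult)
  also have "\<dots> = (\<Sum>a\<in>supp p. coeff_at p a * coeff_at q (k - a))"
    by (rule Sum_any.expand_superset) (auto simp: in_keys_iff)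
  finally show ?thesis .
qed

lemma coeff_at_const_eps:
  fixes g :: "'g::ab_group_add"
  shows "const_gr r * eps g = Poly_Mapping.single g r"
    and "coeff_at (Poly_Mapping.single g r * p) k = r * coeff_at p (k - g)"
  by (simp_all add: const_gr_def eps_def mult_single coeff_at_mult when_def in_keys_iff)

lemma const_gr_simps [simp]:
  "const_gr 0 = 0" "const_gr 1 = (1 :: 'g::ab_group_add cgr)"
  "const_gr (a + b) = const_gr a + (const_gr b :: 'g cgr)"
  "const_gr (a * b) = const_gr a * (const_gr b :: 'g cgr)"
  by (simp_all add: const_gr_def single_add mult_single)

lemma const_gr_sum: "const_gr (\<Sum>i\<in>I. f i) = (\<Sum>i\<in>I. const_gr (f i) :: 'g::ab_group_add cgr)"
  by (induction I rule: infinite_finite_induct) auto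

lemma const_gr_eq_iff [simp]: "const_gr a = const_gr b \<longleftrightarrow> a = b"
  by (auto simp: const_gr_def dest: injD[OF inj_single])

lemma eps_0 [simp]: "eps 0 = 1"
  by (simp add: eps_def)

lemma eps_add: "eps (g + h) = eps g * eps (h :: 'g::ab_group_add)"
  by (simp add: eps_def mult_single)

lemma eps_nonzero [simp]: "eps g \<noteq> 0"
  by (metis eps_def lookup_single_eq lookup_zero zero_neq_one)

lemma closed_ring_group_ring:
  assumes "closed_ring B" shows "closed_ring (group_ring B :: 'g::ab_group_add cgr set)"
proof -
  interpret closed_ring B by fact
  show ?thesis
    by unfold_locales
      (auto simp: group_ring_def lookup_add lookup_one coeff_at_mult when_def intro!: sum_closed)
qed

lemma const_gr_in_group_ring: "closed_ring B \<Longrightarrow> r \<in> B \<Longrightarrow> const_gr r \<in> group_ring B"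
  by (auto simp: group_ring_def const_gr_def lookup_single when_def closed_ring.zero_closed)

lemma eps_in_group_ring: "closed_ring B \<Longrightarrow> eps g \<in> group_ring B"
  by (auto simp: group_ring_def eps_def lookup_single when_def
      closed_ring.zero_closed closed_ring.one_closed)

text \<open>Exponents at least a and at least b add up to a + b only if both bounds are attained.
  The bounds themselves need not lie in the supports, so the coefficients may be zero.\<close>

lemma coeff_at_mult_lowest:
  fixes p q :: "'g::linordered_ab_group_add \<Rightarrow>\<^sub>0 complex"
  assumes p: "\<forall>g\<in>supp p. g \<ge> a" and q: "\<forall>g\<in>supp q. g \<ge> b"
  shows "coeff_at (p * q) (a + b) = coeff_at p a * coeff_at q b"
    and "\<forall>g\<in>supp (p * q). g \<ge> a + b"
proof -
  have "coeff_at (p * q) (a + b) = (\<Sum>g\<in>supp p. if g = a then coeff_at p a * coeff_at q b else 0)"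
    unfolding coeff_at_mult
  proof (rule sum.cong[OF HOL.refl])
    fix g assume g: "g \<in> supp p"
    show "coeff_at p g * coeff_at q (a + b - g) = (if g = a then coeff_at p a * coeff_at q b else 0)"
    proof (cases "g = a")
      case False
      with p g have "a < g" by force
      then have "\<not> b \<le> a + b - g" by (simp add: not_le algebra_simps)
      then have "a + b - g \<notin> supp q" using q by blast
      then show ?thesis using False by (simp add: in_keys_iff)
    qed simp
  qed
  then show "coeff_at (p * q) (a + b) = coeff_at p a * coeff_at q b"
    by (auto simp: in_keys_iff)
  show "\<forall>g\<in>supp (p * q). g \<ge> a + b"
  proof
    fix g assume "g \<in> supp (p * q)"
    then obtain x y where "x \<in> supp p" "y \<in> supp q" "g = x + y" using keys_mult[of p q] by blast
    then show "g \<ge> a + b" using p q by (simp add: add_mono)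
  qed
qed

lemma supp_mult_pos:
  fixes p q :: "'g::linordered_ab_group_add \<Rightarrow>\<^sub>0 complex"
  assumes "\<forall>g\<in>supp p. g \<ge> 0" "\<forall>g\<in>supp q. g > 0"
  shows "\<forall>g\<in>supp (p * q). g > 0"
proof
  fix g assume "g \<in> supp (p * q)"
  then obtain x y where "x \<in> supp p" "y \<in> supp q" "g = x + y" using keys_mult[of p q] by blast
  then show "g > 0" using assms by (simp add: add_nonneg_pos)
qed

lemma supp_addD: "g \<in> supp (p + q) \<Longrightarrow> g \<in> supp p \<or> g \<in> supp q"
  using keys_add by fast

lemma supp_diffD: "g \<in> supp (p - q) \<Longrightarrow> g \<in> supp p \<or> g \<in> supp q"
  by (auto simp: in_keys_iff lookup_minus)

lemma supp_uminus [simp]: "supp (- p) = supp p"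
  by (auto simp: in_keys_iff)

lemma coeff_at_0_pos: "\<forall>g\<in>supp p. g > (0::'g::linordered_ab_group_add) \<Longrightarrow> coeff_at p 0 = 0"
  by (meson in_keys_iff less_irrefl)

lemma supp_one_plus:
  assumes "\<forall>g\<in>supp p. g > (0::'g::linordered_ab_group_add)"
  shows "\<forall>g\<in>supp (1 + p). g \<ge> 0" "coeff_at (1 + p) 0 = 1" "1 + p \<noteq> 0"
proof -
  show "\<forall>g\<in>supp (1 + p). g \<ge> 0" using assms by (auto dest!: supp_addD simp: less_imp_le)
  show c: "coeff_at (1 + p) 0 = 1" using coeff_at_0_pos[OF assms] by (simp add: lookup_add lookup_one)
  then show "1 + p \<noteq> 0" by auto
qed

text \<open>The residue map of the valuation ring as a relation. Arbitrary complex coefficients are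
  allowed, so membership in F need not be tracked, and the denominator is multiplied across so that
  no division occurs.\<close>

definition has_const :: "'g::linordered_ab_group_add cgrf \<Rightarrow> complex \<Rightarrow> bool" where
  "has_const x c \<longleftrightarrow> (\<exists>p q. (\<forall>g\<in>supp p. g \<ge> 0) \<and> (\<forall>g\<in>supp q. g > 0) \<and>
      x * to_fract (1 + q) = to_fract p \<and> coeff_at p 0 = c)"

lemma has_const_to_fract: "\<forall>g\<in>supp p. g \<ge> 0 \<Longrightarrow> has_const (to_fract p) (coeff_at p 0)"
  unfolding has_const_def by (intro exI[of _ p] exI[of _ 0]) auto

lemma one_plus_mult:
  fixes p q :: "'g::linordered_ab_group_add cgr"
  assumes "\<forall>g\<in>supp p. g > 0" "\<forall>g\<in>supp q. g > 0"
  obtains r where "\<forall>g\<in>supp r. g > 0" "(1 + p) * (1 + q) = 1 + r"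
proof
  show "(1 + p) * (1 + q) = 1 + (p + (1 + p) * q)" by (simp add: algebra_simps)
  show "\<forall>g\<in>supp (p + (1 + p) * q). g > 0"
    using assms supp_mult_pos[OF supp_one_plus(1)[OF assms(1)] assms(2)] by (auto dest!: supp_addD)
qed

lemma has_const_add:
  assumes "has_const x c" "has_const y d" shows "has_const (x + y) (c + d)"
proof -
  obtain p q where x: "\<forall>g\<in>supp p. g \<ge> 0" "\<forall>g\<in>supp q. g > 0"
      "x * to_fract (1 + q) = to_fract p" "coeff_at p 0 = c"
    using assms(1) unfolding has_const_def by blast
  obtain p' q' where y: "\<forall>g\<in>supp p'. g \<ge> 0" "\<forall>g\<in>supp q'. g > 0"
      "y * to_fract (1 + q') = to_fract p'" "coeff_at p' 0 = d"
    using assms(2) unfolding has_const_def by blast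
  obtain r where r: "\<forall>g\<in>supp r. g > 0" "(1 + q) * (1 + q') = 1 + r"
    using one_plus_mult[OF x(2) y(2)] .
  note l1 = coeff_at_mult_lowest[OF x(1) supp_one_plus(1)[OF y(2)]]
  note l2 = coeff_at_mult_lowest[OF y(1) supp_one_plus(1)[OF x(2)]]
  have "(x + y) * to_fract (1 + r) =
      (x * to_fract (1 + q)) * to_fract (1 + q') + (y * to_fract (1 + q')) * to_fract (1 + q)"
    unfolding r(2)[symmetric] to_fract_mult by (simp add: algebra_simps)
  also have "\<dots> = to_fract (p * (1 + q') + p' * (1 + q))"
    unfolding x(3) y(3) by simp
  finally show ?thesis
    unfolding has_const_def using l1 l2 x y r supp_one_plus(2)[OF x(2)] supp_one_plus(2)[OF y(2)]
    by (intro exI[of _ "p * (1 + q') + p' * (1 + q)"] exI[of _ r])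
      (auto dest!: supp_addD simp: lookup_add[of "p * (1 + q')"])
qed

lemma has_const_mult:
  assumes "has_const x c" "has_const y d" shows "has_const (x * y) (c * d)"
proof -
  obtain p q where x: "\<forall>g\<in>supp p. g \<ge> 0" "\<forall>g\<in>supp q. g > 0"
      "x * to_fract (1 + q) = to_fract p" "coeff_at p 0 = c"
    using assms(1) unfolding has_const_def by blast
  obtain p' q' where y: "\<forall>g\<in>supp p'. g \<ge> 0" "\<forall>g\<in>supp q'. g > 0"
      "y * to_fract (1 + q') = to_fract p'" "coeff_at p' 0 = d"
    using assms(2) unfolding has_const_def by blast
  obtain r where r: "\<forall>g\<in>supp r. g > 0" "(1 + q) * (1 + q') = 1 + r"
    using one_plus_mult[OF x(2) y(2)] .
  note l1 = coeff_at_mult_lowest[OF x(1) y(1)]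
  have "(x * y) * to_fract (1 + r) = (x * to_fract (1 + q)) * (y * to_fract (1 + q'))"
    unfolding r(2)[symmetric] to_fract_mult by (simp add: algebra_simps)
  also have "\<dots> = to_fract (p * p')"
    unfolding x(3) y(3) by simp
  finally show ?thesis
    unfolding has_const_def using l1 x y r by (intro exI[of _ "p * p'"] exI[of _ r]) auto
qed

lemma has_const_const: "has_const (to_fract (const_gr c) :: 'g::linordered_ab_group_add cgrf) c"
proof -
  have "\<forall>g\<in>supp (const_gr c). g \<ge> (0::'g)" by (simp add: const_gr_def)
  from has_const_to_fract[OF this] show ?thesis by (simp add: const_gr_def)
qed

lemma has_const_0 [simp]: "has_const 0 0" and has_const_1 [simp]: "has_const 1 1"
  using has_const_const[of 0] has_const_const[of 1] by simp_all

lemma has_const_uminus: "has_const x c \<Longrightarrow> has_const (- x) (- c)"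
  using has_const_mult[OF has_const_const[of "-1"], of x c]
  by (simp add: const_gr_def single_uminus)

lemma has_const_neg_one_power: "has_const ((- 1) ^ n) ((- 1) ^ n)"
  by (induction n) (auto dest: has_const_uminus)

lemma has_const_sum:
  "(\<And>i. i \<in> I \<Longrightarrow> has_const (x i) (c i)) \<Longrightarrow> has_const (\<Sum>i\<in>I. x i) (\<Sum>i\<in>I. c i)"
  by (induction I rule: infinite_finite_induct) (auto intro: has_const_add)

lemma has_const_inverse:
  assumes "has_const x c" "c \<noteq> 0" shows "has_const (inverse x) (inverse c)"
proof -
  obtain p q where x: "\<forall>g\<in>supp p. g \<ge> 0" "\<forall>g\<in>supp q. g > 0"
      "x * to_fract (1 + q) = to_fract p" "coeff_at p 0 = c"
    using assms(1) unfolding has_const_def by blast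
  \<comment> \<open>Scaling by \<open>inverse c\<close> turns the numerator into 1 plus terms of
    positive exponent, which may then serve as the denominator of the inverse. The trivial factor
    \<open>eps 0\<close> gives the shape of \<open>coeff_at_const_eps\<close>.\<close>
  define k where "k = const_gr (inverse c) * eps (0::'a)"
  have k: "supp k \<subseteq> {0}" "coeff_at k 0 = inverse c" "coeff_at (k * r) g = inverse c * coeff_at r g" for r g
    by (auto simp: k_def coeff_at_const_eps in_keys_iff lookup_single when_def simp del: eps_0)
  have pos: "\<forall>g\<in>supp (k * p - 1). g > 0"
  proof
    fix g assume g: "g \<in> supp (k * p - 1)"
    then have "g \<noteq> 0" using assms(2) x(4) by (auto simp: in_keys_iff lookup_minus k(3) lookup_one)
    moreover have "g \<ge> 0"
      using g x(1) \<open>g \<noteq> 0\<close> by (auto simp: in_keys_iff lookup_minus k(3) lookup_one when_def)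
    ultimately show "g > 0" by simp
  qed
  have "x \<noteq> 0" using x(3,4) assms(2) by auto
  have "inverse x * to_fract (1 + (k * p - 1)) = to_fract k * (inverse x * to_fract p)" by simp
  also have "\<dots> = to_fract (k * (1 + q))"
    unfolding x(3)[symmetric] using \<open>x \<noteq> 0\<close> by simp
  finally have eq: "inverse x * to_fract (1 + (k * p - 1)) = to_fract (k * (1 + q))" .
  have "\<forall>g\<in>supp (k * (1 + q)). g \<ge> 0"
    using coeff_at_mult_lowest(2)[of k 0 "1 + q" 0] k(1) supp_one_plus(1)[OF x(2)] by auto
  moreover have "coeff_at (k * (1 + q)) 0 = inverse c"
    using k(3) supp_one_plus(2)[OF x(2)] by simp
  ultimately show ?thesis unfolding has_const_def using eq pos by blast
qed

text \<open>A factor 1 + q with positive exponents in q cannot cancel the lowest term of p, so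
  bounds on the product descend to p.\<close>

lemma supp_of_one_plus_mult:
  fixes p :: "'g::linordered_ab_group_add cgr"
  assumes q: "\<forall>g\<in>supp q. g > 0" and pq: "\<forall>g\<in>supp (p * (1 + q)). g \<ge> m"
  shows "\<forall>g\<in>supp p. g \<ge> m" "coeff_at (p * (1 + q)) m = coeff_at p m"
proof -
  show *: "\<forall>g\<in>supp p. g \<ge> m"
  proof (cases "p = 0")
    case False
    define a where "a = Min (supp p)"
    have a: "a \<in> supp p" "\<forall>g\<in>supp p. g \<ge> a"
      using False by (auto simp: a_def)
    have "coeff_at (p * (1 + q)) a = coeff_at p a"
      using coeff_at_mult_lowest(1)[OF a(2) supp_one_plus(1)[OF q]] supp_one_plus(2)[OF q] by simp
    then have "a \<in> supp (p * (1 + q))" using a(1) by (simp add: in_keys_iff)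
    then show ?thesis using a pq by force
  qed simp
  show "coeff_at (p * (1 + q)) m = coeff_at p m"
    using coeff_at_mult_lowest(1)[OF * supp_one_plus(1)[OF q]] supp_one_plus(2)[OF q] by simp
qed

lemma has_const_to_fractD: "has_const (to_fract p) c \<Longrightarrow> c = coeff_at p 0"
  unfolding has_const_def using supp_of_one_plus_mult(2)
  by (metis to_fract_eq_iff to_fract_mult)

text \<open>The difference of two constant terms of x is a constant term of 0, and for an element of
  the group ring the constant term is its coefficient at 0.\<close>

lemma has_const_unique:
  fixes x :: "'g::linordered_ab_group_add cgrf"
  assumes "has_const x c" "has_const x d" shows "c = d"
proof -
  have "has_const (to_fract 0 :: 'g cgrf) (c + - d)"
    using has_const_add[OF assms(1) has_const_uminus[OF assms(2)]] by (simp only: right_minus to_fract_0)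
  from has_const_to_fractD[OF this] show ?thesis by simp
qed

section \<open>Leading forms and the valuation ring of K\<close>

lemma has_const_of_leading:
  assumes "has_leading_form D x r g" "g \<ge> 0"
  shows "has_const x (if g = 0 then r else 0)"
proof -
  obtain p q where pq: "p \<in> group_ring_pos (fieldF D)" "q \<in> group_ring_pos (fieldF D)"
    and x: "x = to_fract (const_gr r * eps g) * (to_fract (1 + p) / to_fract (1 + q))"
    using assms(1) unfolding has_leading_form_def by blast
  have p: "\<forall>g\<in>supp p. g > 0" and q: "\<forall>g\<in>supp q. g > 0"
    using pq by (auto simp: group_ring_pos_def)
  have "to_fract (1 + q) \<noteq> 0" using supp_one_plus(3)[OF q] by (simp del: to_fract_add)
  then have "x * to_fract (1 + q) = to_fract (const_gr r * eps g * (1 + p))"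
    unfolding x by (simp del: to_fract_add)
  moreover have "\<forall>h\<in>supp (const_gr r * eps g). h \<ge> g"
    by (auto simp: coeff_at_const_eps split: if_splits)
  note coeff_at_mult_lowest[OF this supp_one_plus(1)[OF p]]
  moreover have "coeff_at (const_gr r * eps g) g = r" by (simp add: coeff_at_const_eps)
  moreover have "coeff_at (const_gr r * eps g * (1 + p)) 0 = (if g = 0 then r else 0)"
  proof (cases "g = 0")
    case False
    then have "0 \<notin> supp (const_gr r * eps g * (1 + p))" using calculation(3) \<open>g \<ge> 0\<close> by force
    then show ?thesis using False by (simp add: in_keys_iff)
  qed (use calculation supp_one_plus(2)[OF p] in simp)
  ultimately show ?thesis
    unfolding has_const_def using q \<open>g \<ge> 0\<close>
    by (intro exI[of _ "const_gr r * eps g * (1 + p)"] exI[of _ q]) auto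
qed

lemma has_leading_form_eps_mult:
  assumes "has_leading_form D x r g"
  shows "has_leading_form D (to_fract (eps h) * x) r (h + g)"
proof -
  obtain p q where r: "r \<in> fieldF D" "r \<noteq> 0"
    and pq: "p \<in> group_ring_pos (fieldF D)" "q \<in> group_ring_pos (fieldF D)"
    and x: "x = to_fract (const_gr r * eps g) * (to_fract (1 + p) / to_fract (1 + q))"
    using assms unfolding has_leading_form_def by blast
  have "to_fract (eps h) * x = to_fract (const_gr r * eps (h + g)) * (to_fract (1 + p) / to_fract (1 + q))"
    unfolding x eps_add to_fract_mult by (simp only: mult_ac times_divide_eq_right)
  then show ?thesis unfolding has_leading_form_def using r pq by blast
qed

text \<open>After multiplication by epsilon^(-g) the first form has the nonzero constant term r,
  whereas the second would have constant term 0 if h were larger than g. By symmetry the exponents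
  agree, and then so do the constants.\<close>

lemma has_leading_form_unique:
  assumes "has_leading_form D x r g" "has_leading_form D x s h"
  shows "r = s \<and> g = h"
proof -
  have le: "h \<le> g" if "has_leading_form D x r g" "has_leading_form D x s h" for r s g h
  proof (rule ccontr)
    assume "\<not> h \<le> g"
    have "has_leading_form D (to_fract (eps (- g)) * x) r 0"
      "has_leading_form D (to_fract (eps (- g)) * x) s (- g + h)"
      using has_leading_form_eps_mult[OF that(1), of "- g"] has_leading_form_eps_mult[OF that(2), of "- g"]
      by simp_all
    from has_const_of_leading[OF this(1)] has_const_of_leading[OF this(2)] \<open>\<not> h \<le> g\<close>
    have "r = 0" using has_const_unique[of "to_fract (eps (- g)) * x" r 0] by (auto simp: not_le less_imp_le split: if_splits)
    then show False using that(1) by (simp add: has_leading_form_def)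
  qed
  have "g = h" using le[OF assms] le[OF assms(2,1)] by simp
  have "has_leading_form D (to_fract (eps (- g)) * x) r 0" "has_leading_form D (to_fract (eps (- g)) * x) s 0"
    using has_leading_form_eps_mult[OF assms(1), of "- g"] has_leading_form_eps_mult[OF assms(2), of "- g"]
      \<open>g = h\<close> by simp_all
  from has_const_of_leading[OF this(1)] has_const_of_leading[OF this(2)]
  show ?thesis using \<open>g = h\<close> by (auto dest: has_const_unique)
qed

lemma lead_eqI:
  assumes "has_leading_form D x r g" shows "lead_r D x = r" "lead_g D x = g"
  unfolding lead_r_def lead_g_def using assms has_leading_form_unique by blast+

lemma group_ring_leading:
  assumes "closed_field F" "p \<in> group_ring F" "p \<noteq> (0::'g::linordered_ab_group_add cgr)"
  obtains r g u where "r \<in> F" "r \<noteq> 0" "u \<in> group_ring_pos F" "p = const_gr r * eps g * (1 + u)"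
proof -
  interpret closed_field F by fact
  define g where "g = Min (supp p)"
  have g: "g \<in> supp p" "\<forall>h\<in>supp p. h \<ge> g"
    using assms(3) by (auto simp: g_def)
  define r where "r = coeff_at p g"
  have r: "r \<noteq> 0" "r \<in> F" using g(1) assms(2) by (auto simp: r_def in_keys_iff group_ring_def)
  \<comment> \<open>Division by the lowest term r epsilon^g leaves 1 plus terms of positive
    exponent.\<close>
  define u where "u = const_gr (inverse r) * eps (- g) * p - 1"
  have cu: "coeff_at u h = inverse r * coeff_at p (h + g) - (if h = 0 then 1 else 0)" for h
    by (simp add: u_def lookup_minus coeff_at_const_eps lookup_one when_def)
  have "u \<in> group_ring_pos F"
    unfolding group_ring_pos_def
  proof (intro CollectI conjI ballI)
    show "u \<in> group_ring F" using assms(2) r by (auto simp: group_ring_def cu)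
    fix h assume "h \<in> supp u"
    then have "coeff_at u h \<noteq> 0" by (simp add: in_keys_iff)
    then have "h \<noteq> 0" using r by (auto simp: cu r_def)
    then have "h + g \<in> supp p" using \<open>coeff_at u h \<noteq> 0\<close> by (auto simp: cu in_keys_iff)
    then have "h \<ge> 0" using g by fastforce
    then show "h > 0" using \<open>h \<noteq> 0\<close> by simp
  qed
  moreover have "p = const_gr r * eps g * (1 + u)"
  proof -
    have "const_gr r * eps g * (1 + u) = const_gr (r * inverse r) * eps (g + - g) * p"
      unfolding u_def eps_add by (simp add: algebra_simps)
    then show ?thesis using r by simp
  qed
  ultimately show ?thesis using that r by blast
qed

lemma ex_leading_form:
  assumes R: "closed_ring (base D)" and x: "x \<in> fieldK D" "x \<noteq> 0"
  shows "\<exists>r g. has_leading_form D x r g"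
proof -
  interpret F: closed_field "fieldF D" unfolding fieldF_def by (rule closed_field_fractions[OF R])
  obtain a b where x': "x = to_fract a / to_fract b" "a \<in> ringA D" "b \<in> ringA D" "b \<noteq> 0"
    using x(1) by (auto simp: fieldK_def fractions_def)
  have "a \<noteq> 0" using x x' by auto
  have AF: "c \<in> group_ring (fieldF D)" if "c \<in> ringA D" for c
    using that fractions_incl[OF R] by (auto simp: ringA_def group_ring_def fieldF_def)
  obtain r g u where a: "r \<in> fieldF D" "r \<noteq> 0" "u \<in> group_ring_pos (fieldF D)" "a = const_gr r * eps g * (1 + u)"
    using group_ring_leading[OF F.closed_field_axioms AF[OF x'(2)] \<open>a \<noteq> 0\<close>] .
  obtain s h v where b: "s \<in> fieldF D" "s \<noteq> 0" "v \<in> group_ring_pos (fieldF D)" "b = const_gr s * eps h * (1 + v)"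
    using group_ring_leading[OF F.closed_field_axioms AF[OF x'(3)] \<open>b \<noteq> 0\<close>] .
  have e: "const_gr r * eps g = const_gr (r * inverse s) * eps (g - h) * (const_gr s * eps h)"
    using b(2) by (simp add: coeff_at_const_eps mult_single mult.assoc del: const_gr_simps)
  have nz: "to_fract (const_gr s * eps h) \<noteq> 0"
    using \<open>b \<noteq> 0\<close> b(4) by (simp del: to_fract_mult)
  have "x = to_fract (const_gr (r * inverse s) * eps (g - h)) * (to_fract (1 + u) / to_fract (1 + v))"
    unfolding x'(1) a(4) b(4) e using nz by (simp del: const_gr_simps to_fract_add)
  then show ?thesis unfolding has_leading_form_def using a b by (intro exI[of _ "r * inverse s"] exI) auto
qed

lemma const_term_eqI:
  assumes R: "closed_ring (base D)" and x: "x \<in> fieldK D" and c: "has_const x c"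
  shows "const_term D x = c"
proof (cases "x = 0")
  case True
  then show ?thesis using has_const_unique[OF c] by (simp add: const_term_def)
next
  case False
  then obtain r g where rg: "has_leading_form D x r g" using ex_leading_form[OF R x] by blast
  note l = lead_eqI[OF rg]
  show ?thesis
  proof (cases "g \<ge> 0")
    case True
    then show ?thesis using has_const_unique[OF c has_const_of_leading[OF rg True]] False l
      by (simp add: const_term_def)
  next
    \<comment> \<open>A negative exponent is incompatible with having a constant term: epsilon^(-g)
      has constant term 0, hence so would epsilon^(-g) x, whose constant term is r.\<close>
    case False
    have "has_leading_form D (to_fract (eps (- g)) * x) r 0"
      using has_leading_form_eps_mult[OF rg, of "- g"] by simp
    then have "has_const (to_fract (eps (- g)) * x) r" using has_const_of_leading by fastforce
    moreover have "has_const (to_fract (eps (- g))) 0"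
      using has_const_to_fract[of "eps (- g)"] False by (auto simp: eps_def lookup_single when_def not_le less_imp_le split: if_splits)
    then have "has_const (to_fract (eps (- g)) * x) (0 * c)" using has_const_mult c by blast
    ultimately have "r = 0" using has_const_unique by fastforce
    then show ?thesis using rg by (simp add: has_leading_form_def)
  qed
qed

lemma val_ring_has_const:
  assumes R: "closed_ring (base D)" and x: "x \<in> val_ring D"
  shows "has_const x (const_term D x)"
proof (cases "x = 0")
  case False
  then have "x \<in> fieldK D" "lead_g D x \<ge> 0" using x by (auto simp: val_ring_def)
  then obtain r g where rg: "has_leading_form D x r g" using ex_leading_form[OF R _ False] by blast
  note l = lead_eqI[OF rg]
  show ?thesis using has_const_of_leading[OF rg] l \<open>lead_g D x \<ge> 0\<close> False
    by (auto simp: const_term_def)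
qed (simp add: const_term_def)

section \<open>The Iwahori-Hecke algebra\<close>

lemma coeff_at_bar [simp]: "coeff_at (bar_gr p) g = coeff_at p (- g)"
  by (simp add: bar_gr_def map_key.rep_eq)

lemma bar_gr_simps [simp]:
  fixes p q :: "'g::ab_group_add cgr"
  shows "bar_gr (bar_gr p) = p" "bar_gr 0 = (0 :: 'g cgr)" "bar_gr 1 = (1 :: 'g cgr)"
    "bar_gr (p + q) = bar_gr p + bar_gr q" "bar_gr (p - q) = bar_gr p - bar_gr q"
    "bar_gr (- p) = - bar_gr p" "bar_gr (eps g) = eps (- g)"
  by (rule poly_mapping_eqI;
      auto simp: lookup_add lookup_minus lookup_one eps_def lookup_single when_def)+

lemma bar_gr_mult [simp]:
  fixes p q :: "'g::ab_group_add cgr"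
  shows "bar_gr (p * q) = bar_gr p * bar_gr q"
proof (rule poly_mapping_eqI)
  fix k
  have s: "supp (bar_gr p) = uminus ` supp p"
  proof (intro equalityI subsetI)
    fix x assume "x \<in> supp (bar_gr p)"
    then show "x \<in> uminus ` supp p" by (intro image_eqI[of _ _ "- x"]) (auto simp: in_keys_iff)
  qed (auto simp: in_keys_iff)
  have "coeff_at (bar_gr p * bar_gr q) k =
      (\<Sum>a\<in>supp p. coeff_at p a * coeff_at q (- k - a))"
    unfolding coeff_at_mult[of "bar_gr p"] s by (subst sum.reindex) (auto simp: minus_diff_commute)
  then show "coeff_at (bar_gr (p * q)) k = coeff_at (bar_gr p * bar_gr q) k"
    by (simp add: coeff_at_mult)
qed

lemma bar_gr_sum: "bar_gr (\<Sum>i\<in>I. f i) = (\<Sum>i\<in>I. bar_gr (f i :: 'g::ab_group_add cgr))"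
  by (induction I rule: infinite_finite_induct) auto

lemma bar_gr_in_group_ring: "p \<in> group_ring B \<Longrightarrow> bar_gr p \<in> group_ring B"
  by (simp add: group_ring_def)

lemma closed_ring_Ints: "closed_ring (\<int> :: 'a::comm_ring_1 set)"
  by unfold_locales auto

abbreviation int_gr :: "'g cgr set" where
  "int_gr \<equiv> group_ring \<int>"

locale hecke_ctx =
  fixes D :: "('w, 'g::linordered_ab_group_add, 'i) hecke_datum"
  assumes setting: "hecke_setting D"
begin

sublocale cx: coxeter "cgrp D" "cgen D"
  rewrites "carrier (cgrp D) = elts D" and "cox_length (cgrp D) (cgen D) = len D"
  using setting by (unfold_locales) (auto simp: hecke_setting_def elts_def len_def)

sublocale R: closed_ring "base D"
  using setting by (intro closed_ring_of_subring) (simp add: hecke_setting_def)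

sublocale A: closed_ring "ringA D"
  unfolding ringA_def by (rule closed_ring_group_ring[OF R.closed_ring_axioms])

sublocale Z: closed_ring "int_gr :: 'g cgr set"
  by (rule closed_ring_group_ring[OF closed_ring_Ints])

sublocale H: ring "hecke D"
  using setting by (auto simp: hecke_setting_def is_iwahori_hecke_def)

lemma int_gr_A: "p \<in> int_gr \<Longrightarrow> p \<in> ringA D"
proof -
  have "x \<in> base D" if "x \<in> \<int>" for x :: complex using that by (rule Ints_cases) simp
  then show "p \<in> int_gr \<Longrightarrow> p \<in> ringA D" by (simp add: group_ring_def ringA_def)
qed

abbreviation W where "W \<equiv> elts D"
abbreviation gm (infixl "\<star>" 70) where "x \<star> y \<equiv> x \<otimes>\<^bsub>cgrp D\<^esub> y"
abbreviation iv where "iv x \<equiv> inv\<^bsub>cgrp D\<^esub> x"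
abbreviation e where "e \<equiv> \<one>\<^bsub>cgrp D\<^esub>"
abbreviation cH where "cH \<equiv> carrier (hecke D)"
abbreviation hm (infixl "\<bullet>" 70) where "f \<bullet> g \<equiv> f \<otimes>\<^bsub>hecke D\<^esub> g"
abbreviation T :: "'w \<Rightarrow> 'w \<Rightarrow> 'g cgr" where "T \<equiv> bas"
abbreviation m where "m \<equiv> hsc D"

lemma finW [simp, intro]: "finite W"
  using setting by (simp add: hecke_setting_def)

section \<open>Coordinates, products and relations in H\<close>

lemma cH_iff: "f \<in> cH \<longleftrightarrow> (\<forall>w\<in>W. f w \<in> ringA D) \<and> (\<forall>w. w \<notin> W \<longrightarrow> f w = 0)"
  by (simp add: hecke_def basis_algebra_def)

lemma hm_eq: "(f \<bullet> g) z = (if z \<in> W then \<Sum>x\<in>W. \<Sum>y\<in>W. f x * g y * m x y z else 0)"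
  by (simp add: hecke_def basis_algebra_def)

lemma hecke_one: "\<one>\<^bsub>hecke D\<^esub> = T e"
  by (simp add: hecke_def basis_algebra_def)

lemma hecke_add: "f \<oplus>\<^bsub>hecke D\<^esub> g = (\<lambda>z. f z + g z)"
  by (simp add: hecke_def basis_algebra_def)

lemma hecke_smult: "a \<odot>\<^bsub>hecke D\<^esub> g = (\<lambda>z. a * g z)"
  by (simp add: hecke_def basis_algebra_def)

lemma e_W [simp, intro]: "e \<in> W" using cx.one_closed .

lemma T_cH [simp, intro]: "w \<in> W \<Longrightarrow> T w \<in> cH"
  by (auto simp: cH_iff bas_def)

lemma hm_closed [simp, intro]: "f \<in> cH \<Longrightarrow> g \<in> cH \<Longrightarrow> f \<bullet> g \<in> cH"
  by (rule H.m_closed)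

lemma cH_combI: "(\<And>i. i \<in> I \<Longrightarrow> a i \<in> ringA D \<and> f i \<in> cH) \<Longrightarrow> (\<lambda>z. \<Sum>i\<in>I. a i * f i z) \<in> cH"
  by (auto simp: cH_iff intro!: A.sum_closed)

lemma cH_add: "f \<in> cH \<Longrightarrow> g \<in> cH \<Longrightarrow> (\<lambda>z. f z + g z) \<in> cH"
  and cH_diff: "f \<in> cH \<Longrightarrow> g \<in> cH \<Longrightarrow> (\<lambda>z. f z - g z) \<in> cH"
  and cH_smult: "a \<in> ringA D \<Longrightarrow> f \<in> cH \<Longrightarrow> (\<lambda>z. a * f z) \<in> cH"
  by (auto simp: cH_iff)

lemma hm_sum_left: "(\<lambda>z. \<Sum>i\<in>I. a i * f i z) \<bullet> g = (\<lambda>z. \<Sum>i\<in>I. a i * (f i \<bullet> g) z)"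
proof
  fix z
  have "(\<Sum>x\<in>W. \<Sum>y\<in>W. (\<Sum>i\<in>I. a i * f i x) * g y * m x y z) =
     (\<Sum>x\<in>W. \<Sum>y\<in>W. \<Sum>i\<in>I. a i * (f i x * g y * m x y z))"
    by (simp add: sum_distrib_right mult.assoc)
  also have "\<dots> = (\<Sum>x\<in>W. \<Sum>i\<in>I. \<Sum>y\<in>W. a i * (f i x * g y * m x y z))"
    by (intro sum.cong HOL.refl sum.swap)
  also have "\<dots> = (\<Sum>i\<in>I. \<Sum>x\<in>W. \<Sum>y\<in>W. a i * (f i x * g y * m x y z))"
    by (rule sum.swap)
  finally show "((\<lambda>z. \<Sum>i\<in>I. a i * f i z) \<bullet> g) z = (\<Sum>i\<in>I. a i * (f i \<bullet> g) z)"
    by (simp add: hm_eq sum_distrib_left)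
qed

lemma hm_sum_right: "g \<bullet> (\<lambda>z. \<Sum>i\<in>I. a i * f i z) = (\<lambda>z. \<Sum>i\<in>I. a i * (g \<bullet> f i) z)"
proof
  fix z
  have "(\<Sum>x\<in>W. \<Sum>y\<in>W. g x * (\<Sum>i\<in>I. a i * f i y) * m x y z) =
     (\<Sum>x\<in>W. \<Sum>y\<in>W. \<Sum>i\<in>I. a i * (g x * f i y * m x y z))"
    by (simp add: sum_distrib_right sum_distrib_left mult_ac)
  also have "\<dots> = (\<Sum>x\<in>W. \<Sum>i\<in>I. \<Sum>y\<in>W. a i * (g x * f i y * m x y z))"
    by (intro sum.cong HOL.refl sum.swap)
  also have "\<dots> = (\<Sum>i\<in>I. \<Sum>x\<in>W. \<Sum>y\<in>W. a i * (g x * f i y * m x y z))"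
    by (rule sum.swap)
  finally show "(g \<bullet> (\<lambda>z. \<Sum>i\<in>I. a i * f i z)) z = (\<Sum>i\<in>I. a i * (g \<bullet> f i) z)"
    by (simp add: hm_eq sum_distrib_left)
qed

text \<open>A sum indexed by the two Booleans specialises the finite version to the binary form f +
  a g.\<close>

lemma hm_lin_left: "(\<lambda>z. f z + a * g z) \<bullet> h = (\<lambda>z. (f \<bullet> h) z + a * (g \<bullet> h) z)"
  using hm_sum_left[of "\<lambda>b. if b then 1 else a" "\<lambda>b. if b then f else g" "{True, False}" h] by simp

lemma hm_lin_right: "h \<bullet> (\<lambda>z. f z + a * g z) = (\<lambda>z. (h \<bullet> f) z + a * (h \<bullet> g) z)"
  using hm_sum_right[of h "\<lambda>b. if b then 1 else a" "\<lambda>b. if b then f else g" "{True, False}"] by simp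

lemma expand: "f \<in> cH \<Longrightarrow> (\<lambda>z. \<Sum>w\<in>W. f w * T w z) = f"
  by (auto simp: sum_mult_bas cH_iff fun_eq_iff)

lemma hm_expand_right: "f \<in> cH \<Longrightarrow> g \<bullet> f = (\<lambda>z. \<Sum>w\<in>W. f w * (g \<bullet> T w) z)"
  using hm_sum_right[of g f T W] expand[of f] by simp

lemma hm_expand_left: "f \<in> cH \<Longrightarrow> f \<bullet> g = (\<lambda>z. \<Sum>w\<in>W. f w * (T w \<bullet> g) z)"
  using hm_sum_left[of f T W g] expand[of f] by simp

lemma TT: "x \<in> W \<Longrightarrow> y \<in> W \<Longrightarrow> z \<in> W \<Longrightarrow> (T x \<bullet> T y) z = m x y z"
proof -
  assume *: "x \<in> W" "y \<in> W" "z \<in> W"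
  have "(\<Sum>b\<in>W. T x a * T y b * m a b z) = T x a * m a y z" for a
    using * by (simp add: bas_def if_distrib[of "\<lambda>c. _ * c"] if_distrib[of "\<lambda>c. c * _"] cong: if_cong)
  then show ?thesis using * by (simp add: hm_eq sum_mult_bas)
qed

lemma m_A: "x \<in> W \<Longrightarrow> y \<in> W \<Longrightarrow> z \<in> W \<Longrightarrow> m x y z \<in> ringA D"
  using hm_closed[of "T x" "T y"] cH_iff[of "T x \<bullet> T y"] by (simp add: TT)

lemma m_assoc_coeff:
  assumes "x \<in> W" "y \<in> W" "z \<in> W" "v \<in> W"
  shows "(\<Sum>u\<in>W. m x y u * m u z v) = (\<Sum>u\<in>W. m y z u * m x u v)"
proof -
  have "((T x \<bullet> T y) \<bullet> T z) v = (T x \<bullet> (T y \<bullet> T z)) v"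
    using assms H.m_assoc by simp
  then show ?thesis using assms
    by (simp add: hm_expand_left[of "T x \<bullet> T y"] hm_expand_right[of "T y \<bullet> T z"] TT)
qed

lemma T_one [simp]: "f \<in> cH \<Longrightarrow> T e \<bullet> f = f" "f \<in> cH \<Longrightarrow> f \<bullet> T e = f"
  using H.l_one H.r_one by (simp_all add: hecke_one)

definition \<xi> :: "'w \<Rightarrow> 'g cgr" where
  "\<xi> s = eps (weight D s) - eps (- weight D s)"

lemma xi_int: "\<xi> s \<in> int_gr"
  unfolding \<xi>_def by (intro Z.diff_closed eps_in_group_ring closed_ring_Ints)

lemma bar_xi [simp]: "bar_gr (\<xi> s) = - \<xi> s"
  by (simp add: \<xi>_def)

lemma Ts_up: "s \<in> cgen D \<Longrightarrow> w \<in> W \<Longrightarrow> len D (s \<star> w) = Suc (len D w) \<Longrightarrow> T s \<bullet> T w = T (s \<star> w)"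
  using setting unfolding hecke_setting_def is_iwahori_hecke_def Let_def by auto

lemma Ts_down: "s \<in> cgen D \<Longrightarrow> w \<in> W \<Longrightarrow> len D w = Suc (len D (s \<star> w)) \<Longrightarrow>
    T s \<bullet> T w = (\<lambda>z. T (s \<star> w) z + \<xi> s * T w z)"
  using setting unfolding hecke_setting_def is_iwahori_hecke_def Let_def
  by (auto simp: hecke_add hecke_smult \<xi>_def)

lemma T_mult_len:
  assumes "x \<in> W" "y \<in> W" "len D (x \<star> y) = len D x + len D y"
  shows "T x \<bullet> T y = T (x \<star> y)"
  using assms(1,3)
proof (induction rule: cx.length_induct)
  case one
  then show ?case using assms(2) by simp
next
  case (step s w)
  have a: "s \<star> w \<star> y = s \<star> (w \<star> y)" using step assms(2) by (simp add: cx.m_assoc)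
  \<comment> \<open>Subadditivity bounds the length of w y from above, and one generator adds at
    most one, so the total length forces equality in both.\<close>
  have l: "len D (w \<star> y) = len D w + len D y" "len D (s \<star> (w \<star> y)) = Suc (len D (w \<star> y))"
    using step cx.len_gen_mult[of s "w \<star> y"] cx.len_mult_le[of w y] assms(2) unfolding a by auto
  have "T (s \<star> w) \<bullet> T y = (T s \<bullet> T w) \<bullet> T y" using step by (simp add: Ts_up)
  also have "\<dots> = T s \<bullet> (T w \<bullet> T y)" using step assms(2) by (simp add: H.m_assoc)
  also have "\<dots> = T (s \<star> (w \<star> y))" using step l assms(2) by (simp add: Ts_up)
  finally show ?case by (simp add: a)
qed

text \<open>The relations for T_s T_w have integral coefficients. Over every base ring R this keeps
  the Kazhdan-Lusztig construction inside the integral group ring.\<close>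

lemma int_hm_T:
  assumes "x \<in> W" "f \<in> cH" "\<And>z. f z \<in> int_gr"
  shows "(T x \<bullet> f) z \<in> int_gr"
proof -
  have gen: "(T s \<bullet> f) z \<in> int_gr" if "s \<in> cgen D" "f \<in> cH" "\<And>z. f z \<in> int_gr" for s f z
  proof -
    have "(T s \<bullet> T w) z \<in> int_gr" if "w \<in> W" for w
    proof -
      have "T x z \<in> int_gr" for x by (simp add: bas_def)
      then show ?thesis
        using cx.len_gen_mult[OF \<open>s \<in> cgen D\<close> that] \<open>s \<in> cgen D\<close> that xi_int[of s]
        by (auto simp: Ts_up Ts_down)
    qed
    then show ?thesis using that unfolding hm_expand_right[OF that(2)] by (auto intro!: Z.sum_closed)
  qed
  have "\<forall>z. (T x \<bullet> f) z \<in> int_gr"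
    using assms(1)
  proof (induction rule: cx.length_induct)
    case (step s w)
    have "T (s \<star> w) \<bullet> f = T s \<bullet> (T w \<bullet> f)"
      using step assms(2) by (simp flip: Ts_up add: H.m_assoc)
    then show ?case using gen[of s "T w \<bullet> f"] step assms(2) by auto
  qed (use assms in simp)
  then show ?thesis by blast
qed

text \<open>This says that T_w and T_{w^{-1}} are dual bases for the symmetrizing trace. The last
  generator of x is moved over to y; when it shortens y, an additional term with
  \<open>\<xi> s\<close> appears, and a comparison of lengths shows that it has trace zero.\<close>

lemma hm_trace:
  assumes "x \<in> W" "y \<in> W" shows "m x y e = (if x = iv y then 1 else 0)"
proof -
  have "\<forall>y\<in>W. (T x \<bullet> T y) e = (if x = iv y then 1 else 0)"
    using assms(1)
  proof (induction rule: cx.length_induct_right)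
    case one
    have "e = iv y \<longleftrightarrow> y = e" if "y \<in> W" for y
      using that by (metis cx.inv_inv cx.inv_one)
    then show ?case by simp (auto simp: bas_def)
  next
    case (step s w)
    show ?case
    proof
      fix y assume y: "y \<in> W"
      have "T (w \<star> s) = T w \<bullet> T s" using step T_mult_len[of w s] Ts_up[of s e]
        cx.len_gen_mult[of s e] by simp
      then have eq: "T (w \<star> s) \<bullet> T y = T w \<bullet> (T s \<bullet> T y)" using step y by (simp add: H.m_assoc)
      have sy: "s \<star> y \<in> W" using step y by simp
      have inv: "w = iv (s \<star> y) \<longleftrightarrow> w \<star> s = iv y"
      proof -
        have "iv (s \<star> y) = iv y \<star> s" using step y by (simp add: cx.inv_mult_group)
        then show ?thesis using step y by (metis cx.gen_cancel_right cx.inv_closed)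
      qed
      show "(T (w \<star> s) \<bullet> T y) e = (if w \<star> s = iv y then 1 else 0)"
      proof (cases "len D (s \<star> y) = Suc (len D y)")
        case True
        then show ?thesis using step y sy inv eq by (simp add: Ts_up)
      next
        case False
        then have l: "len D y = Suc (len D (s \<star> y))" using cx.len_gen_mult[of s y] step y by blast
        \<comment> \<open>For w = y^{-1} the element w s would be the inverse of s y and so shorter
          than w, but w s is longer than w.\<close>
        have "w \<noteq> iv y"
        proof
          assume "w = iv y"
          then have "len D (w \<star> s) = len D (iv (s \<star> y))" using step y by (simp add: cx.inv_mult_group)
          then show False using l sy step y \<open>w = iv y\<close> by simp
        qed
        moreover have "T w \<bullet> (T s \<bullet> T y) = (\<lambda>z. (T w \<bullet> T (s \<star> y)) z + \<xi> s * (T w \<bullet> T y) z)"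
          using l step y by (simp add: Ts_down hm_lin_right)
        ultimately show ?thesis using step y sy inv eq by simp
      qed
    qed
  qed
  then show ?thesis using TT assms by simp
qed

text \<open>Both sides are the coefficient of the identity in \<open>T_x T_y T_{z^{-1}}\<close>, up to a cyclic rotation.\<close>

lemma m_rotate:
  assumes "x \<in> W" "y \<in> W" "z \<in> W" shows "m x y z = m (iv z) x (iv y)"
proof -
  have i: "iv z = iv u \<longleftrightarrow> z = u" if "u \<in> W" for u
    using that assms by (metis cx.inv_inv)
  have "m x y z = (\<Sum>u\<in>W. m x y u * m (iv z) u e)"
    using assms i by (simp add: hm_trace if_distrib[of "\<lambda>c. _ * c"] cong: if_cong)
  also have "\<dots> = (\<Sum>u\<in>W. m (iv z) x u * m u y e)"
    using assms by (simp add: m_assoc_coeff)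
  also have "\<dots> = m (iv z) x (iv y)"
    using assms by (simp add: hm_trace if_distrib[of "\<lambda>c. _ * c"] cong: if_cong)
  finally show ?thesis .
qed

end

section \<open>The Kazhdan-Lusztig basis\<close>

definition pos_gr :: "'g::linordered_ab_group_add cgr set" where
  "pos_gr = group_ring_pos \<int>"

lemma pos_gr_iff: "p \<in> pos_gr \<longleftrightarrow> p \<in> int_gr \<and> (\<forall>g\<in>supp p. g > 0)"
  by (simp add: pos_gr_def group_ring_pos_def)

lemma pos_gr_int: "p \<in> pos_gr \<Longrightarrow> p \<in> int_gr"
  by (simp add: pos_gr_iff)

lemma pos_gr_0 [simp]: "0 \<in> pos_gr"
  by (auto simp: pos_gr_iff group_ring_def)

lemma pos_gr_uminus: "p \<in> pos_gr \<Longrightarrow> - p \<in> pos_gr"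
  by (auto simp: pos_gr_iff group_ring_def)

lemma pos_gr_add: "p \<in> pos_gr \<Longrightarrow> q \<in> pos_gr \<Longrightarrow> p + q \<in> pos_gr"
  by (auto simp: pos_gr_iff group_ring_def lookup_add dest!: supp_addD)

lemma pos_gr_diff: "p \<in> pos_gr \<Longrightarrow> q \<in> pos_gr \<Longrightarrow> p - q \<in> pos_gr"
  by (auto simp: pos_gr_iff group_ring_def lookup_minus dest!: supp_diffD)

lemma pos_gr_sum: "(\<And>i. i \<in> I \<Longrightarrow> f i \<in> pos_gr) \<Longrightarrow> (\<Sum>i\<in>I. f i) \<in> pos_gr"
  by (induction I rule: infinite_finite_induct) (auto intro: pos_gr_add)

lemma pos_gr_mult:
  fixes p q :: "'g::linordered_ab_group_add cgr"
  assumes "p \<in> int_gr" "\<forall>g\<in>supp p. g \<ge> 0" "q \<in> pos_gr"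
  shows "p * q \<in> pos_gr"
  using assms supp_mult_pos[OF assms(2)] closed_ring.mult_closed[OF closed_ring_group_ring[OF closed_ring_Ints]]
  by (auto simp: pos_gr_iff)

lemma pos_gr_sign: "p \<in> pos_gr \<Longrightarrow> (- 1) ^ n * p \<in> (pos_gr :: 'g::linordered_ab_group_add cgr set)"
  by (cases "even n") (auto intro: pos_gr_uminus)

lemma bar_gr_sign: "bar_gr ((- 1) ^ n) = ((- 1) ^ n :: 'g::ab_group_add cgr)"
  by (induction n) simp_all

text \<open>A bar-fixed element has support symmetric under negation, which is impossible for a
  nonempty set of positive exponents.\<close>

lemma pos_gr_bar_fixed:
  assumes "p \<in> pos_gr" "bar_gr p = p" shows "p = 0"
proof (rule ccontr)
  assume "p \<noteq> 0"
  then obtain g where "g \<in> supp p" by (metis equals0I keys_eq_empty)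
  moreover from this have "- g \<in> supp p" using assms(2) coeff_at_bar[of p g] by (simp add: in_keys_iff)
  ultimately have "g > 0" "- g > 0" using assms(1) unfolding pos_gr_iff by blast+
  then show False by (simp add: not_less_iff_gr_or_eq)
qed

lemma skew_decomposition:
  assumes "p \<in> int_gr" "bar_gr p = - p"
  obtains q where "q \<in> pos_gr" "p = q - bar_gr q"
proof
  \<comment> \<open>The positive half of p. The negative half is determined by skewness, and the
    coefficient at 0 vanishes because it equals its own negative.\<close>
  define q where "q = (\<Sum>g\<in>{g\<in>supp p. g > 0}. Poly_Mapping.single g (coeff_at p g))"
  have cq: "coeff_at q g = (if g > 0 then coeff_at p g else 0)" for g
    unfolding q_def
    by (auto simp: lookup_sum lookup_single when_def in_keys_iff sum.delta cong: conj_cong)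
  have cp: "coeff_at p (- g) = - coeff_at p g" for g
    using coeff_at_bar[of p g] assms(2) by simp
  have "coeff_at p 0 = 0" using cp[of 0] by simp
  show "q \<in> pos_gr"
    using assms(1) by (auto simp: pos_gr_iff group_ring_def cq in_keys_iff split: if_splits)
  show "p = q - bar_gr q"
    by (rule poly_mapping_eqI)
      (use \<open>coeff_at p 0 = 0\<close> in \<open>auto simp: lookup_minus cq cp not_less dest: antisym\<close>)
qed

context hecke_ctx
begin

section \<open>The bar involution on H\<close>

definition bT :: "'w \<Rightarrow> 'w \<Rightarrow> 'g cgr" where
  "bT w = inv\<^bsub>hecke D\<^esub> (T (iv w))"

abbreviation bar where "bar \<equiv> bar_H D"

lemma bar_eq: "bar h = (\<lambda>z. \<Sum>w\<in>W. bar_gr (h w) * bT w z)"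
  by (simp add: bar_H_def bT_def)

lemma inv_eqI:
  assumes "f \<in> cH" "g \<in> cH" "f \<bullet> g = T e" "g \<bullet> f = T e"
  shows "f \<in> Units (hecke D)" "inv\<^bsub>hecke D\<^esub> f = g"
proof -
  show "f \<in> Units (hecke D)" using assms by (auto simp: Units_def hecke_one)
  show "inv\<^bsub>hecke D\<^esub> f = g" using assms H.inv_char[of f g] by (simp add: hecke_one)
qed

lemma gen_props:
  assumes "s \<in> cgen D" shows "len D s = 1" "iv s = s" "s \<star> s = e"
  using cx.len_gen_mult[of s e] cx.gen_square[OF assms] assms by auto

lemma Ts_square: "s \<in> cgen D \<Longrightarrow> T s \<bullet> T s = (\<lambda>z. T e z + \<xi> s * T s z)"
  using Ts_down[of s s] by (simp add: gen_props)

text \<open>The quadratic relation T_s^2 = 1 + \<xi>_s T_s, read as T_s (T_s - \<xi>_s) = 1,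
  exhibits the inverse.\<close>

lemma gen_inverse:
  assumes "s \<in> cgen D"
  defines "t \<equiv> \<lambda>z. T s z + (- \<xi> s) * T e z"
  shows "t \<in> cH" "T s \<bullet> t = T e" "t \<bullet> T s = T e"
proof -
  have sW: "s \<in> W" using assms by simp
  show "t \<in> cH"
    using cH_add[OF T_cH[OF sW] cH_smult[of "- \<xi> s" "T e"]] int_gr_A[OF xi_int] by (simp add: t_def)
  show "T s \<bullet> t = T e"
    unfolding t_def using sW by (simp only: hm_lin_right Ts_square[OF assms(1)] T_one T_cH) simp
  show "t \<bullet> T s = T e"
    unfolding t_def using sW by (simp only: hm_lin_left Ts_square[OF assms(1)] T_one T_cH) simp
qed

lemma bT_gen: "s \<in> cgen D \<Longrightarrow> bT s = (\<lambda>z. T s z + (- \<xi> s) * T e z)"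
  using inv_eqI(2)[OF T_cH gen_inverse] by (simp add: bT_def gen_props)

lemma bT_one: "bT e = T e"
  using inv_eqI(2)[of "T e" "T e"] by (simp add: bT_def)

text \<open>The ring inverse in \<open>bT\<close> is meaningful only for units, so invertibility is
  carried along the same induction on length as the product formula.\<close>

lemma bT_step:
  assumes "s \<in> cgen D" "w \<in> W" "len D (s \<star> w) = Suc (len D w)"
    and u: "T (iv w) \<in> Units (hecke D)"
  shows "T (iv (s \<star> w)) \<in> Units (hecke D)" "bT (s \<star> w) = bT s \<bullet> bT w"
proof -
  have us: "T s \<in> Units (hecke D)"
    using inv_eqI(1)[OF T_cH gen_inverse] assms(1) by simp
  have i: "iv (s \<star> w) = iv w \<star> s" using assms by (simp add: cx.inv_mult_group)
  have "len D (iv w \<star> s) = len D (iv w) + len D s"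
    using cx.len_inv[of "s \<star> w"] assms by (simp add: i gen_props)
  then have T: "T (iv (s \<star> w)) = T (iv w) \<bullet> T s" using assms by (simp add: i T_mult_len)
  show "T (iv (s \<star> w)) \<in> Units (hecke D)" unfolding T using u us by (rule H.Units_m_closed)
  have s: "bT s = inv\<^bsub>hecke D\<^esub> (T s)" using assms by (simp add: bT_def gen_props)
  show "bT (s \<star> w) = bT s \<bullet> bT w"
    unfolding s unfolding bT_def T
  proof (rule inv_eqI(2))
    let ?a = "T (iv w)" and ?b = "T s"
    have *: "?a \<in> cH" "?b \<in> cH" "inv\<^bsub>hecke D\<^esub> ?a \<in> cH" "inv\<^bsub>hecke D\<^esub> ?b \<in> cH"
      using assms us u by (auto intro: H.Units_inv_closed)
    show "?a \<bullet> ?b \<in> cH" "inv\<^bsub>hecke D\<^esub> ?b \<bullet> inv\<^bsub>hecke D\<^esub> ?a \<in> cH" using * by auto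
    have "?a \<bullet> ?b \<bullet> (inv\<^bsub>hecke D\<^esub> ?b \<bullet> inv\<^bsub>hecke D\<^esub> ?a) = ?a \<bullet> (?b \<bullet> inv\<^bsub>hecke D\<^esub> ?b) \<bullet> inv\<^bsub>hecke D\<^esub> ?a"
      using * by (simp add: H.m_assoc)
    then show "?a \<bullet> ?b \<bullet> (inv\<^bsub>hecke D\<^esub> ?b \<bullet> inv\<^bsub>hecke D\<^esub> ?a) = T e"
      using * us u H.Units_r_inv[OF us] H.Units_r_inv[OF u] by (simp add: hecke_one)
    have "inv\<^bsub>hecke D\<^esub> ?b \<bullet> inv\<^bsub>hecke D\<^esub> ?a \<bullet> (?a \<bullet> ?b) = inv\<^bsub>hecke D\<^esub> ?b \<bullet> (inv\<^bsub>hecke D\<^esub> ?a \<bullet> ?a) \<bullet> ?b"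
      using * by (simp add: H.m_assoc)
    then show "inv\<^bsub>hecke D\<^esub> ?b \<bullet> inv\<^bsub>hecke D\<^esub> ?a \<bullet> (?a \<bullet> ?b) = T e"
      using * us u H.Units_l_inv[OF us] H.Units_l_inv[OF u] by (simp add: hecke_one)
  qed
qed

lemma T_Units: "w \<in> W \<Longrightarrow> T (iv w) \<in> Units (hecke D)"
proof (induction rule: cx.length_induct)
  case one
  show ?case using inv_eqI(1)[of "T e" "T e"] by simp
qed (rule bT_step(1))

lemma bT_up:
  "s \<in> cgen D \<Longrightarrow> w \<in> W \<Longrightarrow> len D (s \<star> w) = Suc (len D w) \<Longrightarrow> bT (s \<star> w) = bT s \<bullet> bT w"
  using bT_step(2) T_Units by blast

lemma bT_cH [simp, intro]: "w \<in> W \<Longrightarrow> bT w \<in> cH"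
  unfolding bT_def using T_Units by (rule H.Units_inv_closed)

lemma bar_T: "w \<in> W \<Longrightarrow> bar (T w) = bT w"
proof -
  assume "w \<in> W"
  have *: "bar_gr (T w x) = T w x" for x by (simp add: bas_def)
  show ?thesis using \<open>w \<in> W\<close> by (simp add: bar_eq * sum_mult_bas)
qed

lemma ringA_bar: "a \<in> ringA D \<Longrightarrow> bar_gr a \<in> ringA D"
  by (simp add: ringA_def bar_gr_in_group_ring)

lemma bar_cH [simp, intro]: "f \<in> cH \<Longrightarrow> bar f \<in> cH"
  unfolding bar_eq using ringA_bar cH_iff[of f] by (intro cH_combI) simp

lemma bar_sum: "bar (\<lambda>z. \<Sum>i\<in>I. a i * f i z) = (\<lambda>z. \<Sum>i\<in>I. bar_gr (a i) * bar (f i) z)"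
proof
  fix z
  have "bar (\<lambda>z. \<Sum>i\<in>I. a i * f i z) z = (\<Sum>w\<in>W. \<Sum>i\<in>I. bar_gr (a i) * (bar_gr (f i w) * bT w z))"
    by (simp add: bar_eq bar_gr_sum sum_distrib_right mult.assoc)
  also have "\<dots> = (\<Sum>i\<in>I. \<Sum>w\<in>W. bar_gr (a i) * (bar_gr (f i w) * bT w z))" by (rule sum.swap)
  finally show "bar (\<lambda>z. \<Sum>i\<in>I. a i * f i z) z = (\<Sum>i\<in>I. bar_gr (a i) * bar (f i) z)"
    by (simp add: bar_eq sum_distrib_left)
qed

lemma bar_lin: "bar (\<lambda>z. f z + a * g z) = (\<lambda>z. bar f z + bar_gr a * bar g z)"
  using bar_sum[of "\<lambda>b. if b then 1 else a" "\<lambda>b. if b then f else g" "{True, False}"] by simp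

text \<open>The bar images obey the defining relations with \<open>\<xi> s\<close> replaced by its
  conjugate \<open>- \<xi> s\<close>. Together with \<open>bT_up\<close> this makes bar compatible
  with left multiplication by T_s.\<close>

lemma bT_down:
  assumes "s \<in> cgen D" "w \<in> W" "len D w = Suc (len D (s \<star> w))"
  shows "bT s \<bullet> bT w = (\<lambda>z. bT (s \<star> w) z + (- \<xi> s) * bT w z)"
proof -
  have sW: "s \<in> W" and swW: "s \<star> w \<in> W" using assms by auto
  have w: "bT w = bT s \<bullet> bT (s \<star> w)" using bT_up[of s "s \<star> w"] assms by simp
  have c: "(\<lambda>z. T s z + (- \<xi> s) * T e z) \<in> cH"
    using bT_cH[OF sW] bT_gen[OF assms(1)] by simp
  have sq: "bT s \<bullet> bT s = (\<lambda>z. T e z + (- \<xi> s) * bT s z)"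
    unfolding bT_gen[OF assms(1)]
    using sW c by (simp only: hm_lin_left hm_lin_right Ts_square[OF assms(1)] T_one T_cH)
      (simp add: algebra_simps fun_eq_iff)
  have "bT s \<bullet> bT w = bT s \<bullet> bT s \<bullet> bT (s \<star> w)"
    using sW swW unfolding w by (simp add: H.m_assoc)
  also have "\<dots> = (\<lambda>z. bT (s \<star> w) z + (- \<xi> s) * bT w z)"
    unfolding sq w using swW by (simp only: hm_lin_left T_one bT_cH)
  finally show ?thesis .
qed

lemma bar_gen_mult:
  assumes "s \<in> cgen D" "f \<in> cH" shows "bar (T s \<bullet> f) = bT s \<bullet> bar f"
proof -
  have b: "bar (T s \<bullet> T w) = bT s \<bullet> bT w" if "w \<in> W" for w
  proof (cases "len D (s \<star> w) = Suc (len D w)")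
    case True
    then show ?thesis using assms that by (simp add: Ts_up bT_up bar_T)
  next
    case False
    then have "len D w = Suc (len D (s \<star> w))" using cx.len_gen_mult assms(1) that by blast
    then show ?thesis using assms that by (simp add: Ts_down bT_down bar_lin bar_T)
  qed
  have "bar (T s \<bullet> f) = (\<lambda>z. \<Sum>w\<in>W. bar_gr (f w) * bar (T s \<bullet> T w) z)"
    by (simp only: hm_expand_right[OF assms(2)] bar_sum)
  also have "\<dots> = (\<lambda>z. \<Sum>w\<in>W. bar_gr (f w) * (bT s \<bullet> bT w) z)"
    using b by simp
  also have "\<dots> = bT s \<bullet> bar f"
    unfolding bar_eq by (simp only: hm_sum_right)
  finally show ?thesis .
qed

lemma bar_bT: "w \<in> W \<Longrightarrow> bar (bT w) = T w"
proof (induction rule: cx.length_induct)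
  case one
  then show ?case by (simp add: bT_one bar_T)
next
  case (step s w)
  have sW: "s \<in> W" using step by simp
  \<comment> \<open>Writing \<open>bT s\<close> as T_s - \<xi>_s produces a product with T_s, to
    which \<open>bar_gen_mult\<close> and the induction hypothesis apply.\<close>
  have "bT (s \<star> w) = (\<lambda>z. (T s \<bullet> bT w) z + (- \<xi> s) * bT w z)"
    using step sW by (simp only: bT_up) (simp only: bT_gen hm_lin_left T_one bT_cH)
  then have "bar (bT (s \<star> w)) = (\<lambda>z. (bT s \<bullet> T w) z + \<xi> s * T w z)"
    using step by (simp only: bar_lin bT_cH bar_gen_mult bar_gr_simps bar_xi) simp
  also have "bT s \<bullet> T w = (\<lambda>z. (T s \<bullet> T w) z + (- \<xi> s) * T w z)"
    using step by (simp only: bT_gen hm_lin_left T_one T_cH)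
  finally show ?case using step by (simp add: Ts_up)
qed

lemma bar_bar [simp]: "f \<in> cH \<Longrightarrow> bar (bar f) = f"
  unfolding bar_eq[of f] using expand[of f] by (simp add: bar_sum bar_bT)

text \<open>Triangularity of the bar involution. Ordering by length is coarser than the Bruhat order
  but suffices for everything that follows: all other terms of \<open>bT w\<close> are strictly
  shorter than w.\<close>

lemma bT_triangular:
  assumes "w \<in> W"
  shows "(\<forall>z. bT w z \<in> int_gr) \<and> (\<forall>z\<in>W. len D z \<ge> len D w \<longrightarrow> bT w z = T w z)"
  using assms
proof (induction rule: cx.length_induct)
  case one
  have "T x z \<in> int_gr" for x z by (simp add: bas_def)
  then show ?case by (simp add: bT_one)
next
  case (step s w)
  have sW: "s \<in> W" using step by simp
  have eq: "bT (s \<star> w) = (\<lambda>z. (T s \<bullet> bT w) z + (- \<xi> s) * bT w z)"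
    using step sW by (simp only: bT_up) (simp only: bT_gen hm_lin_left T_one bT_cH)
  show ?case
  proof (intro conjI allI ballI impI)
    fix z
    show "bT (s \<star> w) z \<in> int_gr" unfolding eq
      using step sW xi_int[of s] by (auto intro!: Z.add_closed Z.mult_closed int_hm_T)
    assume z: "z \<in> W" "len D (s \<star> w) \<le> len D z"
    then have lz: "len D z > len D w" "z \<noteq> w" using step by auto
    then have "bT w z = 0" using step z by (auto simp: bas_def)
    have "(T s \<bullet> bT w) z = (\<Sum>y\<in>W. bT w y * (T s \<bullet> T y) z)"
      using step by (simp only: hm_expand_right[of "bT w"] bT_cH)
    \<comment> \<open>Apart from w, only shorter y occur in \<open>bT w\<close>, and T_s T_y
      involves nothing longer than w, whereas z is longer than w.\<close>
    also have "\<dots> = (\<Sum>y\<in>W. if y = w then T (s \<star> w) z else 0)"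
    proof (rule sum.cong[OF HOL.refl])
      fix y assume y: "y \<in> W"
      show "bT w y * (T s \<bullet> T y) z = (if y = w then T (s \<star> w) z else 0)"
      proof (cases "y = w")
        case True
        then show ?thesis using step by (simp add: Ts_up) (simp add: bas_def)
      next
        case False
        show ?thesis
        proof (cases "len D y < len D w")
          case True
          then have "z \<noteq> y" using lz by auto
          moreover have "z \<noteq> s \<star> y"
            using True z step cx.len_gen_mult[of s y] y by auto
          ultimately have "(T s \<bullet> T y) z = 0"
            using cx.len_gen_mult[of s y] step y Ts_up[of s y] Ts_down[of s y] by (auto simp: bas_def)
          then show ?thesis using \<open>y \<noteq> w\<close> by simp
        next
          case False
          then have "bT w y = 0" using step y \<open>y \<noteq> w\<close> by (auto simp: bas_def)
          then show ?thesis using \<open>y \<noteq> w\<close> by simp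
        qed
      qed
    qed
    also have "\<dots> = T (s \<star> w) z" using step by simp
    finally show "bT (s \<star> w) z = T (s \<star> w) z" by (simp add: eq \<open>bT w z = 0\<close>)
  qed
qed

lemma bT_int: "w \<in> W \<Longrightarrow> bT w z \<in> int_gr"
  and bT_top: "w \<in> W \<Longrightarrow> z \<in> W \<Longrightarrow> len D z \<ge> len D w \<Longrightarrow> bT w z = T w z"
  using bT_triangular by blast+

text \<open>Longer elements are absent from f, and by triangularity those of length at most that of
  z reach the coefficient at z only through T_z itself.\<close>

lemma bar_at_top:
  assumes "f \<in> cH" "z \<in> W" "\<And>w. w \<in> W \<Longrightarrow> len D w > len D z \<Longrightarrow> f w = 0"
  shows "bar f z = bar_gr (f z)"
proof -
  have "bar f z = (\<Sum>w\<in>W. bar_gr (f w) * T w z)"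
    unfolding bar_eq
  proof (rule sum.cong[OF HOL.refl])
    fix w assume "w \<in> W"
    then show "bar_gr (f w) * bT w z = bar_gr (f w) * T w z"
      using assms bT_top[of w z] by (cases "len D w > len D z") auto
  qed
  then show ?thesis using assms by (simp add: sum_mult_bas)
qed

section \<open>Existence and uniqueness of the Kazhdan-Lusztig elements\<close>

lemma ex_max_len:
  assumes "x \<in> W" "P x" obtains z where "z \<in> W" "P z" "\<And>w. w \<in> W \<Longrightarrow> P w \<Longrightarrow> len D w \<le> len D z"
proof -
  have "\<forall>w. w \<in> W \<and> P w \<longrightarrow> len D w < Suc (Max (len D ` W))"
    by (simp add: less_Suc_eq_le)
  from arg_max_nat_lemma[of "\<lambda>w. w \<in> W \<and> P w", OF _ this] show ?thesis
    using that assms by blast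
qed

text \<open>At a longest element of the support bar acts on the coefficient alone, so that
  coefficient would be bar-fixed with positive exponents only. Uniqueness of C_w is applied in this
  form.\<close>

lemma bar_fixed_pos_zero:
  assumes "f \<in> cH" "bar f = f" "\<And>z. z \<in> W \<Longrightarrow> f z \<in> pos_gr"
  shows "f = (\<lambda>_. 0)"
proof (rule ccontr)
  assume "f \<noteq> (\<lambda>_. 0)"
  then obtain x where "x \<in> W" "f x \<noteq> 0" using assms(1) by (auto simp: cH_iff fun_eq_iff)
  then obtain z where z: "z \<in> W" "f z \<noteq> 0" "\<And>w. w \<in> W \<Longrightarrow> f w \<noteq> 0 \<Longrightarrow> len D w \<le> len D z"
    using ex_max_len[of x "\<lambda>x. f x \<noteq> 0"] by blast
  have "bar f z = bar_gr (f z)" using assms(1) z by (intro bar_at_top) (auto simp: not_le[symmetric])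
  then have "bar_gr (f z) = f z" using assms(2) by simp
  then show False using pos_gr_bar_fixed assms(3) z by blast
qed

text \<open>The normalisation with leading coefficient 1; the sign (-1)^{l(w)} of C_w is multiplied
  in only at the end.\<close>

definition unitri :: "'w \<Rightarrow> ('w \<Rightarrow> 'g cgr) \<Rightarrow> bool" where
  "unitri w C \<longleftrightarrow> C \<in> cH \<and> C w = 1 \<and> (\<forall>z\<in>W. z \<noteq> w \<longrightarrow> C z \<in> pos_gr) \<and>
    (\<forall>z\<in>W. z \<noteq> w \<longrightarrow> len D z \<ge> len D w \<longrightarrow> C z = 0)"

lemma unitri_int: "unitri w C \<Longrightarrow> z \<in> W \<Longrightarrow> C z \<in> int_gr"
  unfolding unitri_def by (cases "z = w") (auto intro: pos_gr_int)

text \<open>Bar invariance is achieved one length layer at a time, going down from w, and k counts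
  the layers below w already treated. On the next layer the error bar C - C is skew, hence of the
  form q - bar q, and adding q to C removes it without disturbing longer elements.\<close>

lemma ex_KL_aux:
  assumes "w \<in> W" "k \<le> len D w"
  shows "\<exists>C. unitri w C \<and> (\<forall>z\<in>W. len D z + k \<ge> len D w \<longrightarrow> bar C z = C z)"
  using assms(2)
proof (induction k)
  case 0
  have "unitri w (T w)" using assms(1) by (auto simp: unitri_def) (auto simp: bas_def)
  then show ?case using assms(1) by (intro exI[of _ "T w"]) (auto simp: bar_T bT_top)
next
  case (Suc k)
  then obtain C where C: "unitri w C" "\<And>z. z \<in> W \<Longrightarrow> len D z + k \<ge> len D w \<Longrightarrow> bar C z = C z"
    by auto
  have CH: "C \<in> cH" using C(1) by (simp add: unitri_def)
  define L where "L = {z\<in>W. len D z + Suc k = len D w}"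
  define E where "E = (\<lambda>z. bar C z + (- 1) * C z)"
  have EH: "E \<in> cH" unfolding E_def using CH cH_add[OF bar_cH[OF CH] cH_smult[of "- 1" C]] by simp
  have barE: "bar E = (\<lambda>z. - E z)" unfolding E_def using CH by (simp only: bar_lin bar_bar) simp
  have E0: "E z = 0" if "z \<in> W" "len D z + k \<ge> len D w" for z using C(2)[OF that] by (simp add: E_def)
  \<comment> \<open>The error vanishes on all longer elements, so bar acts on its coefficient at z
    alone; combined with bar E = - E this coefficient is skew.\<close>
  have "\<exists>q. q \<in> pos_gr \<and> E z = q - bar_gr q" if "z \<in> L" for z
  proof -
    have z: "z \<in> W" "len D z + Suc k = len D w" using that by (auto simp: L_def)
    have "bar E z = bar_gr (E z)" using z EH E0 by (intro bar_at_top) auto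
    moreover have "E z \<in> int_gr" unfolding E_def bar_eq using unitri_int[OF C(1)] z
      by (auto intro!: Z.diff_closed Z.sum_closed Z.mult_closed bar_gr_in_group_ring bT_int)
    ultimately show ?thesis using barE skew_decomposition[of "E z"] by metis
  qed
  then obtain q where q: "\<And>z. z \<in> L \<Longrightarrow> q z \<in> pos_gr" "\<And>z. z \<in> L \<Longrightarrow> E z = q z - bar_gr (q z)"
    by metis
  define Q where "Q = (\<lambda>z. if z \<in> L then q z else 0)"
  have QH: "Q \<in> cH" using q(1) by (auto simp: cH_iff Q_def L_def intro: int_gr_A pos_gr_int)
  define C' where "C' = (\<lambda>z. C z + 1 * Q z)"
  have wL: "w \<notin> L" by (auto simp: L_def)
  have "unitri w C'"
    using C(1) wL q(1) QH unfolding unitri_def C'_def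
    by (auto intro!: cH_add pos_gr_add simp: Q_def L_def)
  moreover have "bar C' z = C' z" if z: "z \<in> W" "len D z + Suc k \<ge> len D w" for z
  proof -
    have "bar Q z = bar_gr (Q z)" using z QH by (intro bar_at_top) (auto simp: Q_def L_def)
    moreover have "E z + bar_gr (Q z) - Q z = 0"
    proof (cases "z \<in> L")
      case False
      then show ?thesis using z E0[of z] by (auto simp: Q_def L_def)
    qed (simp add: Q_def q)
    ultimately show ?thesis by (simp only: C'_def bar_lin) (simp add: E_def algebra_simps)
  qed
  ultimately show ?case by blast
qed

abbreviation sg :: "'w \<Rightarrow> 'g cgr" where "sg w \<equiv> (- 1) ^ len D w"

lemma sg_square [simp]: "sg w * sg w = 1" "sg w * (sg w * a) = a"
  by (simp_all flip: power_add mult.assoc power_mult_distrib)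

lemma KL_unitri:
  assumes "w \<in> W"
  obtains C where "unitri w C" "KL D w = (\<lambda>z. sg w * C z)" "bar (KL D w) = KL D w" "KL D w \<in> cH"
proof -
  obtain C where C: "unitri w C" "\<And>z. z \<in> W \<Longrightarrow> bar C z = C z"
    using ex_KL_aux[OF assms, of "len D w"] by auto
  have CH: "C \<in> cH" using C(1) by (simp add: unitri_def)
  have barC: "bar C = C"
  proof
    fix z show "bar C z = C z"
      using C(2)[of z] CH bar_cH[OF CH] by (cases "z \<in> W") (auto simp: cH_iff)
  qed
  define C' where "C' = (\<lambda>z. sg w * C z)"
  have bsg: "bar_gr (sg w) = sg w" by (rule bar_gr_sign)
  have C'H: "C' \<in> cH" unfolding C'_def using CH by (intro cH_smult) auto
  have barC': "bar C' = C'"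
    unfolding C'_def using bar_sum[of "\<lambda>_. sg w" "\<lambda>_. C" "{()}"] by (simp add: bsg barC)
  have C'q: "\<exists>q. (\<forall>y\<in>W. q y \<in> group_ring_pos \<int>) \<and> (\<forall>y\<in>W. C' y = (- 1) ^ len D w * T w y + q y)"
    using C(1) by (intro exI[of _ "\<lambda>y. if y = w then 0 else C' y"])
      (auto simp: C'_def unitri_def bas_def pos_gr_def[symmetric] pos_gr_sign)
  have "KL D w = C'"
    unfolding KL_def
  proof (rule the_equality)
    show "C' \<in> cH \<and> bar C' = C' \<and>
      (\<exists>q. (\<forall>y\<in>W. q y \<in> group_ring_pos \<int>) \<and> (\<forall>y\<in>W. C' y = (- 1) ^ len D w * T w y + q y))"
      using C'H barC' C'q by blast
    fix F assume F: "F \<in> cH \<and> bar F = F \<and>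
      (\<exists>q. (\<forall>y\<in>W. q y \<in> group_ring_pos \<int>) \<and> (\<forall>y\<in>W. F y = (- 1) ^ len D w * T w y + q y))"
    then obtain p where p: "\<forall>y\<in>W. p y \<in> pos_gr" "\<forall>y\<in>W. F y = (- 1) ^ len D w * T w y + p y"
      unfolding pos_gr_def by blast
    from C'q obtain q where q: "\<forall>y\<in>W. q y \<in> pos_gr" "\<forall>y\<in>W. C' y = (- 1) ^ len D w * T w y + q y"
      unfolding pos_gr_def by blast
    \<comment> \<open>The signed terms T_w cancel, which leaves a bar-fixed element with positive
      exponents.\<close>
    have "(\<lambda>z. F z + (- 1) * C' z) = (\<lambda>_. 0)"
    proof (rule bar_fixed_pos_zero)
      show "(\<lambda>z. F z + (- 1) * C' z) \<in> cH" using F C'H cH_diff by simp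
      show "bar (\<lambda>z. F z + (- 1) * C' z) = (\<lambda>z. F z + (- 1) * C' z)"
        using F barC' by (simp only: bar_lin) simp
      show "F z + (- 1) * C' z \<in> pos_gr" if "z \<in> W" for z
        using p q that by (auto intro: pos_gr_diff)
    qed
    then show "F = C'" by (auto simp: fun_eq_iff)
  qed
  then show ?thesis using that C(1) barC' C'H by (auto simp: C'_def)
qed

section \<open>The Kazhdan-Lusztig elements as a basis\<close>

abbreviation C where "C \<equiv> KL D"

lemma KL_cH [simp, intro]: "w \<in> W \<Longrightarrow> C w \<in> cH"
  by (rule KL_unitri)

lemma KL_diag: "w \<in> W \<Longrightarrow> C w w = sg w"
  by (rule KL_unitri[of w]) (auto simp: unitri_def)

lemma KL_pos: "w \<in> W \<Longrightarrow> z \<in> W \<Longrightarrow> z \<noteq> w \<Longrightarrow> C w z \<in> pos_gr"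
  by (rule KL_unitri[of w]) (auto simp: unitri_def pos_gr_sign)

lemma KL_top: "w \<in> W \<Longrightarrow> z \<in> W \<Longrightarrow> z \<noteq> w \<Longrightarrow> len D z \<ge> len D w \<Longrightarrow> C w z = 0"
  by (rule KL_unitri[of w]) (auto simp: unitri_def)

text \<open>At a longest element of the support of c, unitriangularity leaves only the diagonal
  term, which is c z up to sign.\<close>

lemma KL_independent:
  assumes c: "c \<in> cH" and zero: "\<And>u. u \<in> W \<Longrightarrow> (\<Sum>z\<in>W. c z * C z u) = 0"
  shows "c = (\<lambda>_. 0)"
proof (rule ccontr)
  assume "c \<noteq> (\<lambda>_. 0)"
  then obtain x where "x \<in> W" "c x \<noteq> 0" using c by (auto simp: cH_iff fun_eq_iff)
  then obtain z where z: "z \<in> W" "c z \<noteq> 0" "\<And>w. w \<in> W \<Longrightarrow> c w \<noteq> 0 \<Longrightarrow> len D w \<le> len D z"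
    using ex_max_len[of x "\<lambda>x. c x \<noteq> 0"] by blast
  have "(\<Sum>w\<in>W. c w * C w z) = (\<Sum>w\<in>W. if w = z then c z * sg z else 0)"
  proof (rule sum.cong[OF HOL.refl])
    fix w assume "w \<in> W"
    then show "c w * C w z = (if w = z then c z * sg z else 0)"
      using z KL_diag KL_top[of w z] by (cases "c w = 0") auto
  qed
  also have "\<dots> = c z * sg z" using z by simp
  finally have "c z * sg z = 0" using zero z by simp
  then show False using z(2) by simp
qed

text \<open>Inversion of the unitriangular base change by induction on length. The second clause
  says that its leading terms survive inversion; through it the dual basis has the same leading
  coefficients as T_y.\<close>

lemma T_in_KL:
  assumes "w \<in> W"
  shows "\<exists>c\<in>cH. T w = (\<lambda>u. \<Sum>z\<in>W. c z * C z u) \<and> (\<forall>z\<in>W. c z - sg w * T w z \<in> pos_gr)"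
  using assms
proof (induction "len D w" arbitrary: w rule: less_induct)
  case less
  define L where "L = {y\<in>W. len D y < len D w}"
  have L: "finite L" "L \<subseteq> W" "w \<notin> L" by (auto simp: L_def)
  have "\<forall>y\<in>L. \<exists>c\<in>cH. T y = (\<lambda>u. \<Sum>z\<in>W. c z * C z u) \<and> (\<forall>z\<in>W. c z - sg y * T y z \<in> pos_gr)"
    using less.hyps unfolding L_def by blast
  then have "\<exists>k. \<forall>y\<in>L. k y \<in> cH \<and> T y = (\<lambda>u. \<Sum>z\<in>W. k y z * C z u) \<and>
      (\<forall>z\<in>W. k y z - sg y * T y z \<in> pos_gr)"
    unfolding Bex_def by (rule bchoice)
  then obtain k where k: "\<And>y. y \<in> L \<Longrightarrow> k y \<in> cH"
    "\<And>y. y \<in> L \<Longrightarrow> T y = (\<lambda>u. \<Sum>z\<in>W. k y z * C z u)"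
    "\<And>y z. y \<in> L \<Longrightarrow> z \<in> W \<Longrightarrow> k y z - sg y * T y z \<in> pos_gr"
    by blast
  \<comment> \<open>The solution of C_w = (-1)^{l(w)} T_w + (shorter terms) for T_w, with the
    shorter T_y already expressed in the new basis.\<close>
  define c where "c = (\<lambda>z. sg w * T w z - sg w * (\<Sum>y\<in>L. C w y * k y z))"
  have Cw: "C w u = sg w * T w u + (\<Sum>y\<in>L. C w y * T y u)" if "u \<in> W" for u
  proof -
    have "(\<Sum>y\<in>L. C w y * T y u) = (if u \<in> L then C w u else 0)" using L by (simp add: sum_mult_bas)
    then show ?thesis using that less.prems KL_diag KL_top[of w u] L
      by (auto simp: bas_def L_def not_less)
  qed
  have "c \<in> cH"
  proof -
    have "C w y \<in> ringA D" if "y \<in> L" for y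
      using that L KL_cH[OF less.prems] cH_iff[of "C w"] by blast
    then show ?thesis
      unfolding c_def using less.prems k(1) by (intro cH_diff cH_smult cH_combI T_cH) auto
  qed
  moreover have "T w = (\<lambda>u. \<Sum>z\<in>W. c z * C z u)"
  proof
    fix u show "T w u = (\<Sum>z\<in>W. c z * C z u)"
    proof (cases "u \<in> W")
      case True
      have "(\<Sum>z\<in>W. c z * C z u) = sg w * (\<Sum>z\<in>W. C z u * T w z) - sg w * (\<Sum>z\<in>W. \<Sum>y\<in>L. C w y * (k y z * C z u))"
      proof -
        have *: "(\<Sum>y\<in>L. C w y * (k y z * C z u)) = (\<Sum>y\<in>L. C w y * k y z) * C z u" for z
          by (simp add: sum_distrib_right mult.assoc)
        have "c z * C z u = sg w * (C z u * T w z) - sg w * (\<Sum>y\<in>L. C w y * (k y z * C z u))" for z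
          unfolding * c_def by (simp only: left_diff_distrib right_diff_distrib mult_ac)
        then show ?thesis by (simp add: sum_subtractf sum_distrib_left)
      qed
      also have "(\<Sum>z\<in>W. \<Sum>y\<in>L. C w y * (k y z * C z u)) = (\<Sum>y\<in>L. C w y * T y u)"
        by (subst sum.swap) (simp add: k(2) sum_distrib_left)
      also have "(\<Sum>z\<in>W. C z u * T w z) = C w u" using less.prems by (simp add: sum_mult_bas)
      also have "sg w * C w u - sg w * (\<Sum>y\<in>L. C w y * T y u) = T w u"
        unfolding Cw[OF True] by (simp add: algebra_simps)
      finally show ?thesis by simp
    next
      case False
      then have "C z u = 0" if "z \<in> W" for z using KL_cH[OF that] by (auto simp: cH_iff)
      then show ?thesis using False less.prems by (auto simp: bas_def)
    qed
  qed
  moreover have "c z - sg w * T w z \<in> pos_gr" if z: "z \<in> W" for z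
  proof -
    have "C w y * k y z \<in> pos_gr" if y: "y \<in> L" for y
    proof -
      have p: "C w y \<in> pos_gr" using KL_pos[of w y] y L less.prems by auto
      \<comment> \<open>The coefficient \<open>k y z\<close> may contain the constant +-1, namely at
        z = y. It is split off here, and the factor \<open>C w y\<close> makes both parts
        positive.\<close>
      have "C w y * (k y z - sg y * T y z) \<in> pos_gr"
        by (rule pos_gr_mult[OF pos_gr_int[OF p] _ k(3)[OF y z]]) (use p in \<open>simp add: pos_gr_iff less_imp_le\<close>)
      moreover have "C w y * (sg y * T y z) \<in> pos_gr"
      proof (cases "z = y")
        case True
        then have "C w y * (sg y * T y z) = sg y * C w y" by (simp add: bas_def)
        then show ?thesis using pos_gr_sign[OF p] by metis
      qed (simp add: bas_def)
      ultimately have "C w y * (k y z - sg y * T y z) + C w y * (sg y * T y z) \<in> pos_gr"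
        by (rule pos_gr_add)
      then show ?thesis by (simp add: algebra_simps)
    qed
    then have "sg w * (\<Sum>y\<in>L. C w y * k y z) \<in> pos_gr" by (intro pos_gr_sign pos_gr_sum)
    then show ?thesis using pos_gr_uminus by (simp add: c_def)
  qed
  ultimately have "c \<in> cH \<and> T w = (\<lambda>u. \<Sum>z\<in>W. c z * C z u) \<and> (\<forall>z\<in>W. c z - sg w * T w z \<in> pos_gr)"
    by blast
  then show ?case by blast
qed

section \<open>Coordinates in the Kazhdan-Lusztig basis\<close>

abbreviation kc where "kc \<equiv> KL_coords D"

lemma KL_coords_ex:
  assumes "f \<in> cH" shows "\<exists>c\<in>cH. f = (\<lambda>u. \<Sum>z\<in>W. c z * C z u)"
proof -
  have "\<forall>w\<in>W. \<exists>c. c \<in> cH \<and> T w = (\<lambda>u. \<Sum>z\<in>W. c z * C z u)"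
    using T_in_KL by blast
  from bchoice[OF this] obtain k where k: "\<And>w. w \<in> W \<Longrightarrow> k w \<in> cH"
      "\<And>w. w \<in> W \<Longrightarrow> T w = (\<lambda>u. \<Sum>z\<in>W. k w z * C z u)"
    by blast
  define c where "c = (\<lambda>z. \<Sum>w\<in>W. f w * k w z)"
  have "c \<in> cH" unfolding c_def using assms k by (intro cH_combI) (auto simp: cH_iff)
  moreover have "f u = (\<Sum>z\<in>W. c z * C z u)" for u
  proof -
    have "(\<Sum>z\<in>W. c z * C z u) = (\<Sum>z\<in>W. \<Sum>w\<in>W. f w * (k w z * C z u))"
      by (simp add: c_def sum_distrib_right mult.assoc)
    also have "\<dots> = (\<Sum>w\<in>W. f w * T w u)"
      by (subst sum.swap) (simp add: k(2) sum_distrib_left)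
    finally show ?thesis using expand[OF assms] by (simp add: fun_eq_iff)
  qed
  ultimately show ?thesis by blast
qed

lemma KL_coords_unique:
  assumes "c \<in> cH" "f = (\<lambda>u. \<Sum>z\<in>W. c z * C z u)" shows "kc f = c"
  unfolding KL_coords_def
proof (rule the_equality)
  fix d assume d: "d \<in> cH \<and> f = (\<lambda>u. \<Sum>z\<in>W. d z * C z u)"
  have "(\<lambda>z. d z - c z) = (\<lambda>_. 0)"
  proof (rule KL_independent)
    show "(\<lambda>z. d z - c z) \<in> cH" using d assms cH_diff by blast
    fix u
    have "(\<Sum>z\<in>W. d z * C z u) = (\<Sum>z\<in>W. c z * C z u)" using d assms(2) by (metis (no_types, lifting))
    then show "(\<Sum>z\<in>W. (d z - c z) * C z u) = 0" by (simp add: left_diff_distrib sum_subtractf)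
  qed
  then show "d = c" by (auto simp: fun_eq_iff)
qed (use assms in blast)

lemma KL_coords:
  assumes "f \<in> cH" shows kc_cH [simp, intro]: "kc f \<in> cH"
    and kc_expand: "(\<lambda>u. \<Sum>z\<in>W. kc f z * C z u) = f"
proof -
  obtain c where "c \<in> cH" "f = (\<lambda>u. \<Sum>z\<in>W. c z * C z u)" using KL_coords_ex[OF assms] by blast
  then show "kc f \<in> cH" "(\<lambda>u. \<Sum>z\<in>W. kc f z * C z u) = f" using KL_coords_unique[of c f] by simp_all
qed

lemma kc_sum:
  assumes "\<And>i. i \<in> I \<Longrightarrow> a i \<in> ringA D \<and> f i \<in> cH"
  shows "kc (\<lambda>u. \<Sum>i\<in>I. a i * f i u) = (\<lambda>z. \<Sum>i\<in>I. a i * kc (f i) z)"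
proof (rule KL_coords_unique)
  show "(\<lambda>z. \<Sum>i\<in>I. a i * kc (f i) z) \<in> cH" using assms by (intro cH_combI) auto
  show "(\<lambda>u. \<Sum>i\<in>I. a i * f i u) = (\<lambda>u. \<Sum>z\<in>W. (\<Sum>i\<in>I. a i * kc (f i) z) * C z u)"
  proof
    fix u
    have "(\<Sum>z\<in>W. (\<Sum>i\<in>I. a i * kc (f i) z) * C z u) = (\<Sum>z\<in>W. \<Sum>i\<in>I. a i * (kc (f i) z * C z u))"
      by (simp add: sum_distrib_right mult.assoc)
    also have "\<dots> = (\<Sum>i\<in>I. a i * (\<Sum>z\<in>W. kc (f i) z * C z u))"
      by (subst sum.swap) (simp add: sum_distrib_left)
    also have "\<dots> = (\<Sum>i\<in>I. a i * f i u)"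
      using assms kc_expand by (intro sum.cong) (auto simp: fun_eq_iff)
    finally show "(\<Sum>i\<in>I. a i * f i u) = (\<Sum>z\<in>W. (\<Sum>i\<in>I. a i * kc (f i) z) * C z u)" by simp
  qed
qed

lemma kc_KL: "w \<in> W \<Longrightarrow> kc (C w) = T w"
  using KL_cH[of w] by (intro KL_coords_unique) (auto simp: sum_mult_bas cH_iff[of "C w"] fun_eq_iff)

lemma kc_T_pos:
  assumes "w \<in> W" "z \<in> W" shows "kc (T w) z - sg w * T w z \<in> pos_gr"
proof -
  obtain c where "c \<in> cH" "T w = (\<lambda>u. \<Sum>z\<in>W. c z * C z u)" "\<forall>z\<in>W. c z - sg w * T w z \<in> pos_gr"
    using T_in_KL[OF assms(1)] by blast
  then show ?thesis using KL_coords_unique[of c "T w"] assms(2) by blast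
qed

end

section \<open>Two-sided cells\<close>

context hecke_ctx
begin

section \<open>Structure constants, the preorder and its ideals\<close>

abbreviation hc where "hc \<equiv> hcoef D"
abbreviation le where "le \<equiv> le_LR D"
abbreviation sim where "sim \<equiv> sim_LR D"

lemma hc_A: "x \<in> W \<Longrightarrow> y \<in> W \<Longrightarrow> z \<in> W \<Longrightarrow> hc x y z \<in> ringA D"
  using kc_cH[of "C x \<bullet> C y"] cH_iff[of "kc (C x \<bullet> C y)"] unfolding hcoef_def by simp

lemma kc_mult:
  assumes "f \<in> cH" "g \<in> cH"
  shows "kc (f \<bullet> g) = (\<lambda>z. \<Sum>x\<in>W. \<Sum>y\<in>W. kc f x * kc g y * hc x y z)"
proof -
  have fA: "kc f x \<in> ringA D" "kc g x \<in> ringA D" if "x \<in> W" for x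
    using kc_cH[OF assms(1)] kc_cH[OF assms(2)] cH_iff that by blast+
  have "f \<bullet> g = (\<lambda>u. \<Sum>x\<in>W. kc f x * (C x \<bullet> g) u)"
    using hm_sum_left[of "kc f" C W g] kc_expand[OF assms(1)] by simp
  then have "kc (f \<bullet> g) = (\<lambda>z. \<Sum>x\<in>W. kc f x * kc (C x \<bullet> g) z)"
    using fA assms by (simp add: kc_sum)
  also have "\<dots> = (\<lambda>z. \<Sum>x\<in>W. kc f x * (\<Sum>y\<in>W. kc g y * hc x y z))"
  proof (intro ext sum.cong HOL.refl)
    fix z x assume x: "x \<in> W"
    have "C x \<bullet> g = (\<lambda>u. \<Sum>y\<in>W. kc g y * (C x \<bullet> C y) u)"
      using hm_sum_right[of "C x" "kc g" C W] kc_expand[OF assms(2)] by simp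
    then have "kc (C x \<bullet> g) = (\<lambda>z. \<Sum>y\<in>W. kc g y * kc (C x \<bullet> C y) z)"
      using fA x by (simp add: kc_sum)
    then show "kc f x * kc (C x \<bullet> g) z = kc f x * (\<Sum>y\<in>W. kc g y * hc x y z)"
      by (simp add: hcoef_def)
  qed
  finally show ?thesis by (simp add: sum_distrib_left mult.assoc)
qed

lemma hc_assoc:
  assumes "x \<in> W" "y \<in> W" "w \<in> W" "z \<in> W"
  shows "(\<Sum>u\<in>W. hc y w u * hc x u z) = (\<Sum>u\<in>W. hc x y u * hc u w z)"
proof -
  have "kc (C x \<bullet> (C y \<bullet> C w)) z = kc (C x \<bullet> C y \<bullet> C w) z"
    using assms by (simp add: H.m_assoc)
  moreover have "kc (C x \<bullet> (C y \<bullet> C w)) z = (\<Sum>v\<in>W. T x v * (\<Sum>u\<in>W. kc (C y \<bullet> C w) u * hc v u z))"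
    using assms by (simp add: kc_mult[of "C x"] kc_KL sum_distrib_left mult.assoc)
  moreover have "kc (C x \<bullet> C y \<bullet> C w) z = (\<Sum>v\<in>W. \<Sum>u\<in>W. kc (C x \<bullet> C y) v * (T w u * hc v u z))"
    using assms by (simp add: kc_mult[of "C x \<bullet> C y"] kc_KL mult.assoc)
  ultimately show ?thesis
    using assms by (simp add: sum_mult_bas flip: hcoef_def sum_distrib_left)
qed

lemma le_refl [simp]: "le x x" by (simp add: le_LR_def)

lemma le_trans: "le x y \<Longrightarrow> le y z \<Longrightarrow> le x z" by (simp add: le_LR_def)

lemma sim_refl [simp]: "sim x x" by (simp add: sim_LR_def)

lemma sim_sym: "sim x y \<Longrightarrow> sim y x" by (simp add: sim_LR_def)

lemma sim_trans: "sim x y \<Longrightarrow> sim y z \<Longrightarrow> sim x z"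
  unfolding sim_LR_def using le_trans by blast

lemma hc_le:
  assumes "x \<in> W" "y \<in> W" "z \<in> W" "hc x y z \<noteq> 0" shows "le z y" "le z x"
  unfolding le_LR_def using assms by (blast intro: r_into_rtrancl)+

text \<open>Membership in the two-sided ideal attached to x by the cell filtration.\<close>

definition below :: "'w \<Rightarrow> ('w \<Rightarrow> 'g cgr) \<Rightarrow> bool" where
  "below x f \<longleftrightarrow> f \<in> cH \<and> (\<forall>z\<in>W. kc f z \<noteq> 0 \<longrightarrow> le z x)"

lemma below_KL: "x \<in> W \<Longrightarrow> below x (C x)"
  by (auto simp: below_def kc_KL bas_def)

lemma sum_nonzeroE:
  assumes "(\<Sum>x\<in>I. f x) \<noteq> (0::'a::comm_monoid_add)" obtains x where "x \<in> I" "f x \<noteq> 0"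
  using assms by (metis sum.neutral)

text \<open>The preorder is generated by left and right multiplication alike, so every basis element
  occurring in C_a C_b lies below both a and b.\<close>

lemma below_mult:
  assumes "below x f" "g \<in> cH" shows "below x (f \<bullet> g)" "below x (g \<bullet> f)"
proof -
  have f: "f \<in> cH" using assms by (simp add: below_def)
  have "le z x" if z: "z \<in> W" "kc (f \<bullet> g) z \<noteq> 0" for z
  proof -
    from z obtain a b where "a \<in> W" "b \<in> W" "kc f a * kc g b * hc a b z \<noteq> 0"
      unfolding kc_mult[OF f assms(2)] by (elim sum_nonzeroE)
    then have "le z a" "le a x" using hc_le(2) z assms(1) by (auto simp: below_def)
    then show ?thesis by (rule le_trans)
  qed
  then show "below x (f \<bullet> g)" using f assms by (simp add: below_def)
  have "le z x" if z: "z \<in> W" "kc (g \<bullet> f) z \<noteq> 0" for z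
  proof -
    from z obtain a b where "a \<in> W" "b \<in> W" "kc g a * kc f b * hc a b z \<noteq> 0"
      unfolding kc_mult[OF assms(2) f] by (elim sum_nonzeroE)
    then have "le z b" "le b x" using hc_le(1) z assms(1) by (auto simp: below_def)
    then show ?thesis by (rule le_trans)
  qed
  then show "below x (g \<bullet> f)" using f assms by (simp add: below_def)
qed

text \<open>The element dual to \<open>C_{y^{-1}}\<close> with respect to the symmetrizing trace
  \<open>T_w \<mapsto> \<delta>_{w,1}\<close>.\<close>

definition KL_dual :: "'w \<Rightarrow> 'w \<Rightarrow> 'g cgr" where
  "KL_dual y = (\<lambda>w. if w \<in> W then kc (T (iv w)) (iv y) else 0)"

lemma iv_eq_iff: "x \<in> W \<Longrightarrow> y \<in> W \<Longrightarrow> iv x = iv y \<longleftrightarrow> x = y"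
  by (metis cx.inv_inv)

lemma sum_iv: "(\<Sum>w\<in>W. f (iv w)) = (\<Sum>w\<in>W. f w)"
  by (rule sum.reindex_bij_witness[of _ iv iv]) auto

lemma KL_dual_pos:
  assumes "y \<in> W" "w \<in> W" shows "KL_dual y w - sg y * T y w \<in> pos_gr"
  using kc_T_pos[of "iv w" "iv y"] assms iv_eq_iff[of w y] iv_eq_iff[of y w]
  by (auto simp: KL_dual_def bas_def)

text \<open>By duality and rotation, the coefficient of g times the dual element at v is the
  coefficient of C_{y^{-1}} in T_{v^{-1}} g. The latter element stays in the ideal below x, where
  C_{y^{-1}} does not occur.\<close>

lemma mult_KL_dual:
  assumes "y \<in> W" "below x g" "\<not> le (iv y) x" shows "g \<bullet> KL_dual y = (\<lambda>_. 0)"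
proof
  fix v
  have g: "g \<in> cH" using assms(2) by (simp add: below_def)
  show "(g \<bullet> KL_dual y) v = 0"
  proof (cases "v \<in> W")
    case True
    have gA: "g a \<in> ringA D" if "a \<in> W" for a using g cH_iff that by blast
    have inner: "(\<Sum>b\<in>W. KL_dual y b * m a b v) = kc (T (iv v) \<bullet> T a) (iv y)" if a: "a \<in> W" for a
    proof -
      have "(\<Sum>b\<in>W. KL_dual y b * m a b v) = (\<Sum>b\<in>W. m (iv v) a (iv b) * kc (T (iv b)) (iv y))"
        using a True by (intro sum.cong) (simp_all add: KL_dual_def m_rotate[of a _ v])
      also have "\<dots> = (\<Sum>b\<in>W. m (iv v) a b * kc (T b) (iv y))"
        by (rule sum_iv)
      also have "\<dots> = kc (\<lambda>u. \<Sum>b\<in>W. m (iv v) a b * T b u) (iv y)"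
        using a True by (subst kc_sum) (auto intro: m_A)
      also have "(\<lambda>u. \<Sum>b\<in>W. m (iv v) a b * T b u) = T (iv v) \<bullet> T a"
      proof -
        have "(\<lambda>u. \<Sum>b\<in>W. m (iv v) a b * T b u) = (\<lambda>u. \<Sum>b\<in>W. (T (iv v) \<bullet> T a) b * T b u)"
          using a True by (simp add: TT)
        then show ?thesis using expand[of "T (iv v) \<bullet> T a"] a True by simp
      qed
      finally show ?thesis .
    qed
    have "(g \<bullet> KL_dual y) v = (\<Sum>a\<in>W. g a * (\<Sum>b\<in>W. KL_dual y b * m a b v))"
      using True by (simp add: hm_eq sum_distrib_left mult.assoc)
    also have "\<dots> = (\<Sum>a\<in>W. g a * kc (T (iv v) \<bullet> T a) (iv y))"
      by (simp add: inner)
    also have "\<dots> = kc (T (iv v) \<bullet> g) (iv y)"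
      unfolding hm_expand_right[OF g] using gA True by (subst kc_sum) auto
    also have "\<dots> = 0"
      using below_mult(2)[OF assms(2), of "T (iv v)"] assms True by (auto simp: below_def)
    finally show ?thesis .
  qed (simp add: hm_eq)
qed

end

section \<open>Schur's lemma\<close>

lemma mats_over_iff:
  "N \<in> mats_over k d \<longleftrightarrow> N \<in> carrier_mat d d \<and> (\<forall>i<d. \<forall>j<d. N $$ (i, j) \<in> k)"
proof -
  have "elements_mat N \<subseteq> k \<longleftrightarrow> (\<forall>i<d. \<forall>j<d. N $$ (i, j) \<in> k)" if "N \<in> carrier_mat d d"
    using that by (auto dest!: elements_matD)
  then show ?thesis by (auto simp: mats_over_def)
qed

lemma mult_mat_vec_index:
  assumes "N \<in> carrier_mat d d'" "v \<in> carrier_vec d'" "i < d"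
  shows "(N *\<^sub>v v) $ i = (\<Sum>l<d'. N $$ (i, l) * v $ l)"
  using assms by (simp add: scalar_prod_def lessThan_atLeast0)

lemma mult_mat_index:
  assumes "N \<in> carrier_mat d d'" "M \<in> carrier_mat d' d''" "i < d" "j < d''"
  shows "(N * M) $$ (i, j) = (\<Sum>l<d'. N $$ (i, l) * M $$ (l, j))"
  using assms by (simp add: scalar_prod_def lessThan_atLeast0)

lemma (in closed_ring) mult_mat_vec_over:
  assumes "N \<in> carrier_mat d d'" "\<forall>i<d. \<forall>j<d'. N $$ (i, j) \<in> B" "v \<in> vecs_over B d'"
  shows "N *\<^sub>v v \<in> vecs_over B d"
  using assms mult_mat_vec_index[OF assms(1), of v]
  by (auto simp: vecs_over_def intro!: sum_closed mult_mat_vec_carrier)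

text \<open>The traces of N Q and Q N agree, and in characteristic zero the trace of an identity
  matrix determines its size.\<close>

lemma inverse_mats_dim:
  fixes N :: "'a::field mat"
  assumes N: "N \<in> carrier_mat d d'" and Q: "Q \<in> carrier_mat d' d"
    and "N * Q = 1\<^sub>m d" "Q * N = 1\<^sub>m d'"
    and char0: "\<And>n. n > 0 \<Longrightarrow> (of_nat n :: 'a) \<noteq> 0"
  shows "d = d'"
proof -
  have "(of_nat d :: 'a) = (\<Sum>i<d. (N * Q) $$ (i, i))" using assms by simp
  also have "\<dots> = (\<Sum>i<d. \<Sum>l<d'. N $$ (i, l) * Q $$ (l, i))"
    using mult_mat_index[OF N Q] by simp
  also have "\<dots> = (\<Sum>l<d'. \<Sum>i<d. Q $$ (l, i) * N $$ (i, l))"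
    by (subst sum.swap) (simp add: mult.commute)
  also have "\<dots> = (\<Sum>l<d'. (Q * N) $$ (l, l))" using mult_mat_index[OF Q N] by simp
  also have "\<dots> = of_nat d'" using assms by simp
  finally have eq: "(of_nat d :: 'a) = of_nat d'" .
  show ?thesis
  proof (cases d d' rule: linorder_cases)
    case less
    then have "(of_nat (d' - d) :: 'a) = 0" using eq by (simp add: of_nat_diff)
    then show ?thesis using char0[of "d' - d"] less by simp
  next
    case greater
    then have "(of_nat (d - d') :: 'a) = 0" using eq by (simp add: of_nat_diff)
    then show ?thesis using char0[of "d - d'"] greater by simp
  qed simp
qed

text \<open>The kernel U and the image V of N are invariant, so irreducibility makes U zero and V
  everything. Preimages of the unit vectors give a right inverse over k, and the trivial kernel
  makes it a left inverse.\<close>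

lemma intertwiner_equivalent:
  fixes k :: "'a::field set"
  assumes k: "closed_field k" and char0: "\<And>n. n > 0 \<Longrightarrow> (of_nat n :: 'a) \<noteq> 0"
    and \<rho>: "irreducible_rep k M d \<rho>" and \<rho>': "irreducible_rep k M d' \<rho>'"
    and N: "N \<in> carrier_mat d d'" "\<forall>i<d. \<forall>j<d'. N $$ (i, j) \<in> k"
    and comm: "\<And>h. h \<in> carrier M \<Longrightarrow> \<rho> h * N = N * \<rho>' h"
    and nz: "N \<noteq> 0\<^sub>m d d'"
  shows "equivalent_reps k M d' \<rho>' d \<rho>"
proof -
  interpret k: closed_field k by fact
  have m: "\<rho> h \<in> mats_over k d" "\<rho>' h \<in> mats_over k d'" if "h \<in> carrier M" for h
    using \<rho> \<rho>' that by (auto simp: irreducible_rep_def matrix_rep_def)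
  have c: "\<rho> h \<in> carrier_mat d d" "\<rho>' h \<in> carrier_mat d' d'"
    "\<forall>i<d. \<forall>j<d. \<rho> h $$ (i, j) \<in> k" "\<forall>i<d'. \<forall>j<d'. \<rho>' h $$ (i, j) \<in> k" if "h \<in> carrier M" for h
    using m[OF that] unfolding mats_over_iff by auto
  have unit: "unit_vec n j \<in> vecs_over k n" for n j
    by (auto simp: vecs_over_def unit_vec_def)
  have vc: "v \<in> carrier_vec n" if "v \<in> vecs_over k n" for v n using that by (simp add: vecs_over_def)
  define U where "U = {v \<in> vecs_over k d'. N *\<^sub>v v = 0\<^sub>v d}"
  define V where "V = (\<lambda>v. N *\<^sub>v v) ` vecs_over k d'"
  have add: "u + v \<in> vecs_over k n" if "u \<in> vecs_over k n" "v \<in> vecs_over k n" for u v n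
    using that by (auto simp: vecs_over_def)
  have smult: "a \<cdot>\<^sub>v v \<in> vecs_over k n" if "a \<in> k" "v \<in> vecs_over k n" for a v n
    using that by (auto simp: vecs_over_def)
  have zero: "0\<^sub>v n \<in> vecs_over k n" for n by (auto simp: vecs_over_def)
  have N0: "N *\<^sub>v 0\<^sub>v d' = 0\<^sub>v d" using N(1) by (intro eq_vecI) auto
  have cv: "\<rho> h *\<^sub>v (N *\<^sub>v v) = N *\<^sub>v (\<rho>' h *\<^sub>v v)" if "h \<in> carrier M" "v \<in> carrier_vec d'" for h v
  proof -
    have "\<rho> h *\<^sub>v (N *\<^sub>v v) = (\<rho> h * N) *\<^sub>v v"
      using c(1)[OF that(1)] N(1) that(2) by (rule assoc_mult_mat_vec[symmetric])
    also have "\<dots> = N *\<^sub>v (\<rho>' h *\<^sub>v v)"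
      unfolding comm[OF that(1)] using N(1) c(2)[OF that(1)] that(2) by (rule assoc_mult_mat_vec)
    finally show ?thesis .
  qed
  have "U = {0\<^sub>v d'} \<or> U = vecs_over k d'"
  proof -
    have "0\<^sub>v d' \<in> U \<and> (\<forall>u\<in>U. \<forall>v\<in>U. u + v \<in> U) \<and> (\<forall>a\<in>k. \<forall>u\<in>U. a \<cdot>\<^sub>v u \<in> U) \<and>
        (\<forall>h\<in>carrier M. \<forall>u\<in>U. \<rho>' h *\<^sub>v u \<in> U)"
    proof (intro conjI ballI)
      show "0\<^sub>v d' \<in> U" using zero N0 by (simp add: U_def)
      fix u assume u: "u \<in> U"
      then have uc: "u \<in> carrier_vec d'" using vc by (simp add: U_def)
      { fix v assume v: "v \<in> U"
        then have "v \<in> carrier_vec d'" using vc by (simp add: U_def)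
        then have "N *\<^sub>v (u + v) = N *\<^sub>v u + N *\<^sub>v v" using N(1) uc by (simp add: mult_add_distrib_mat_vec)
        then show "u + v \<in> U" using u v add by (simp add: U_def) }
      { fix a assume a: "a \<in> k"
        have "N *\<^sub>v (a \<cdot>\<^sub>v u) = a \<cdot>\<^sub>v (N *\<^sub>v u)" using N(1) uc by (rule mult_mat_vec)
        moreover have "a \<cdot>\<^sub>v 0\<^sub>v d = 0\<^sub>v d" by (intro eq_vecI) auto
        ultimately show "a \<cdot>\<^sub>v u \<in> U" using u a smult by (simp add: U_def) }
      { fix h assume h: "h \<in> carrier M"
        have "N *\<^sub>v (\<rho>' h *\<^sub>v u) = \<rho> h *\<^sub>v 0\<^sub>v d" using cv[OF h uc] u by (simp add: U_def)
        also have "\<dots> = 0\<^sub>v d" using c(1)[OF h] by (intro eq_vecI) auto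
        finally show "\<rho>' h *\<^sub>v u \<in> U"
          using u k.mult_mat_vec_over[OF c(2)[OF h] c(4)[OF h]] by (simp add: U_def) }
    qed
    moreover have "U \<subseteq> vecs_over k d'" unfolding U_def by (rule Collect_restrict)
    moreover have "\<forall>U \<subseteq> vecs_over k d'. 0\<^sub>v d' \<in> U \<and> (\<forall>u\<in>U. \<forall>v\<in>U. u + v \<in> U) \<and>
        (\<forall>a\<in>k. \<forall>u\<in>U. a \<cdot>\<^sub>v u \<in> U) \<and> (\<forall>h\<in>carrier M. \<forall>u\<in>U. \<rho>' h *\<^sub>v u \<in> U) \<longrightarrow>
        U = {0\<^sub>v d'} \<or> U = vecs_over k d'"
      using \<rho>' by (simp add: irreducible_rep_def)
    ultimately show ?thesis by (elim allE[of _ U]) iprover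
  qed
  moreover have "U \<noteq> vecs_over k d'"
  proof
    assume U: "U = vecs_over k d'"
    have "N = 0\<^sub>m d d'"
    proof (rule eq_matI)
      fix i j assume ij: "i < dim_row (0\<^sub>m d d')" "j < dim_col (0\<^sub>m d d')"
      have "unit_vec d' j \<in> U" using U unit by simp
      then have "N *\<^sub>v unit_vec d' j = 0\<^sub>v d" by (simp add: U_def)
      then have "(N *\<^sub>v unit_vec d' j) $ i = 0" using ij by simp
      then have "(\<Sum>l<d'. N $$ (i, l) * unit_vec d' j $ l) = 0"
        using ij N(1) by (subst (asm) mult_mat_vec_index) auto
      then show "N $$ (i, j) = 0\<^sub>m d d' $$ (i, j)"
        using ij by (simp add: unit_vec_def if_distrib[of "\<lambda>c. _ * c"] sum.delta cong: if_cong)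
    qed (use N in auto)
    then show False using nz by simp
  qed
  ultimately have U0: "U = {0\<^sub>v d'}" by blast
  have "V = {0\<^sub>v d} \<or> V = vecs_over k d"
  proof -
    have "V \<subseteq> vecs_over k d" using k.mult_mat_vec_over[OF N] by (auto simp: V_def)
    moreover have "0\<^sub>v d \<in> V \<and> (\<forall>u\<in>V. \<forall>v\<in>V. u + v \<in> V) \<and> (\<forall>a\<in>k. \<forall>u\<in>V. a \<cdot>\<^sub>v u \<in> V) \<and>
        (\<forall>h\<in>carrier M. \<forall>u\<in>V. \<rho> h *\<^sub>v u \<in> V)"
    proof (intro conjI ballI)
      show "0\<^sub>v d \<in> V" unfolding V_def using N0 zero by (intro image_eqI[of _ _ "0\<^sub>v d'"]) simp_all
      fix u assume "u \<in> V"
      then obtain x where x: "x \<in> vecs_over k d'" "u = N *\<^sub>v x" by (auto simp: V_def)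
      { fix v assume "v \<in> V"
        then obtain y where y: "y \<in> vecs_over k d'" "v = N *\<^sub>v y" by (auto simp: V_def)
        have "u + v = N *\<^sub>v (x + y)" using N(1) vc x y by (simp add: mult_add_distrib_mat_vec)
        then show "u + v \<in> V" using add x y by (auto simp: V_def) }
      { fix a assume a: "a \<in> k"
        have "N *\<^sub>v (a \<cdot>\<^sub>v x) = a \<cdot>\<^sub>v (N *\<^sub>v x)" using N(1) vc x(1) by (intro mult_mat_vec) auto
        then show "a \<cdot>\<^sub>v u \<in> V"
          using smult[OF a x(1)] unfolding x(2) V_def by (intro image_eqI[of _ _ "a \<cdot>\<^sub>v x"]) auto }
      { fix h assume h: "h \<in> carrier M"
        have "\<rho> h *\<^sub>v u = N *\<^sub>v (\<rho>' h *\<^sub>v x)" using cv[OF h vc] x by simp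
        then show "\<rho> h *\<^sub>v u \<in> V"
          using k.mult_mat_vec_over[OF c(2)[OF h] c(4)[OF h] x(1)] by (simp add: V_def) }
    qed
    moreover have "\<forall>V \<subseteq> vecs_over k d. 0\<^sub>v d \<in> V \<and> (\<forall>u\<in>V. \<forall>v\<in>V. u + v \<in> V) \<and>
        (\<forall>a\<in>k. \<forall>u\<in>V. a \<cdot>\<^sub>v u \<in> V) \<and> (\<forall>h\<in>carrier M. \<forall>u\<in>V. \<rho> h *\<^sub>v u \<in> V) \<longrightarrow>
        V = {0\<^sub>v d} \<or> V = vecs_over k d"
      using \<rho> by (simp add: irreducible_rep_def)
    ultimately show ?thesis by (elim allE[of _ V]) iprover
  qed
  moreover have "V \<noteq> {0\<^sub>v d}"
  proof
    assume V: "V = {0\<^sub>v d}"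
    have "N *\<^sub>v v = 0\<^sub>v d" if "v \<in> vecs_over k d'" for v using that V by (auto simp: V_def)
    then have "U = vecs_over k d'" by (auto simp: U_def)
    with \<open>U \<noteq> vecs_over k d'\<close> show False by blast
  qed
  ultimately have V: "V = vecs_over k d" by blast
  have "\<exists>q. q \<in> vecs_over k d' \<and> N *\<^sub>v q = unit_vec d i" for i
  proof -
    have "unit_vec d i \<in> V" using unit V by simp
    then show ?thesis unfolding V_def by (elim imageE) auto
  qed
  then have "\<forall>i. \<exists>q. q \<in> vecs_over k d' \<and> N *\<^sub>v q = unit_vec d i" by blast
  from choice[OF this] obtain q where q: "\<And>i. q i \<in> vecs_over k d'" "\<And>i. N *\<^sub>v q i = unit_vec d i"
    by blast
  define Q where "Q = mat d' d (\<lambda>(a, b). q b $ a)"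
  have Q: "Q \<in> carrier_mat d' d" by (simp add: Q_def)
  have colQ: "col Q j = q j" if "j < d" for j
    using that vc[OF q(1)[of j]] by (intro eq_vecI) (auto simp: Q_def)
  have NQ: "N * Q = 1\<^sub>m d"
  proof (rule mat_col_eqI)
    fix j assume j: "j < dim_col (1\<^sub>m d)"
    have "col (N * Q) j = N *\<^sub>v col Q j" using N(1) Q j by (intro eq_vecI) auto
    then show "col (N * Q) j = col (1\<^sub>m d) j" using j colQ q by simp
  qed (use N Q in auto)
  have Qk: "\<forall>i<d'. \<forall>j<d. Q $$ (i, j) \<in> k" using q(1) by (auto simp: Q_def vecs_over_def)
  have QN: "Q * N = 1\<^sub>m d'"
  proof (rule mat_col_eqI)
    fix j assume j: "j < dim_col (1\<^sub>m d')"
    let ?u = "unit_vec d' j"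
    \<comment> \<open>N annihilates Q N u - u because N Q = 1, so this vector lies in the trivial
      kernel.\<close>
    let ?v = "Q *\<^sub>v (N *\<^sub>v ?u) - ?u"
    have w: "Q *\<^sub>v (N *\<^sub>v ?u) \<in> vecs_over k d'"
      by (intro k.mult_mat_vec_over[OF Q Qk] k.mult_mat_vec_over[OF N] unit)
    have "N *\<^sub>v ?v = N *\<^sub>v (Q *\<^sub>v (N *\<^sub>v ?u)) - N *\<^sub>v ?u"
      using N(1) vc[OF w] by (intro mult_minus_distrib_mat_vec) auto
    also have "N *\<^sub>v (Q *\<^sub>v (N *\<^sub>v ?u)) = (N * Q) *\<^sub>v (N *\<^sub>v ?u)"
      using N(1) Q by (intro assoc_mult_mat_vec[symmetric]) auto
    also have "\<dots> - N *\<^sub>v ?u = 0\<^sub>v d" unfolding NQ using N(1) by (intro eq_vecI) auto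
    finally have "N *\<^sub>v ?v = 0\<^sub>v d" .
    moreover have "?v \<in> vecs_over k d'"
      using w unit[of d' j] by (simp add: vecs_over_def)
    ultimately have "?v \<in> U" by (simp add: U_def)
    then have v0: "?v = 0\<^sub>v d'" using U0 by simp
    have "col (Q * N) j = Q *\<^sub>v col N j" using N(1) Q j by (intro eq_vecI) auto
    also have "col N j = N *\<^sub>v ?u"
      using N(1) j by (intro eq_vecI) auto
    also have "Q *\<^sub>v (N *\<^sub>v ?u) = ?u"
    proof (rule eq_vecI)
      fix i assume i: "i < dim_vec ?u"
      then have "?v $ i = 0" using v0 by simp
      then show "(Q *\<^sub>v (N *\<^sub>v ?u)) $ i = ?u $ i" using i Q by simp
    qed (use Q in simp)
    finally show "col (Q * N) j = col (1\<^sub>m d') j" using j by simp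
  qed (use N Q in auto)
  \<comment> \<open>Up to here N is formally rectangular, whereas equivalence of representations
    demands equal sizes.\<close>
  have d: "d = d'" using inverse_mats_dim[OF N(1) Q NQ QN char0] .
  have "\<rho> h = N * \<rho>' h * Q" if h: "h \<in> carrier M" for h
  proof -
    have "N * \<rho>' h * Q = \<rho> h * N * Q" using comm[OF h] by simp
    also have "\<dots> = \<rho> h * (N * Q)" using c(1)[OF h] N(1) Q by (rule assoc_mult_mat)
    finally show ?thesis using NQ c(1)[OF h] by simp
  qed
  moreover have "N \<in> mats_over k d'" "Q \<in> mats_over k d'" using N Q Qk d by (simp_all add: mats_over_iff)
  ultimately show ?thesis
    unfolding equivalent_reps_def using d NQ QN by blast
qed

section \<open>Schur relations\<close>

context hecke_ctx
begin

section \<open>Matrix coefficients of the irreducible representations\<close>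

abbreviation K where "K \<equiv> fieldK D"
abbreviation HK where "HK \<equiv> hecke_K D"

sublocale K: closed_field "fieldK D"
  unfolding fieldK_def
proof (rule closed_field_fractions, unfold_locales)
  fix x y :: "'g cgrf" assume "x \<in> to_fract ` ringA D" "y \<in> to_fract ` ringA D"
  then obtain a b where x: "x = to_fract a" "y = to_fract b" "a \<in> ringA D" "b \<in> ringA D" by blast
  have "a + b \<in> ringA D" "a * b \<in> ringA D" using x by auto
  then show "x + y \<in> to_fract ` ringA D" "x * y \<in> to_fract ` ringA D"
    unfolding x to_fract_add[symmetric] to_fract_mult[symmetric] by (blast intro: imageI)+
next
  fix x :: "'g cgrf" assume "x \<in> to_fract ` ringA D"
  then obtain a where x: "x = to_fract a" "- a \<in> ringA D" by auto
  then show "- x \<in> to_fract ` ringA D" unfolding x(1) to_fract_uminus[symmetric] by blast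
next
  show "0 \<in> to_fract ` ringA D" by (rule image_eqI[of _ _ 0]) auto
  show "1 \<in> to_fract ` ringA D" by (rule image_eqI[of _ _ 1]) auto
qed

lemma to_fract_K: "a \<in> ringA D \<Longrightarrow> to_fract a \<in> K"
  unfolding fieldK_def fractions_def
  by (intro CollectI exI[of _ "to_fract a"] exI[of _ 1]) (auto intro: image_eqI[of _ _ 1])

lemma of_nat_K_nonzero: "n > 0 \<Longrightarrow> (of_nat n :: 'g cgrf) \<noteq> 0"
proof -
  have "(of_nat n :: 'g cgrf) = to_fract (of_nat n)" by (induction n) auto
  then show "n > 0 \<Longrightarrow> (of_nat n :: 'g cgrf) \<noteq> 0" by simp
qed

lemma irrH_irr: "\<mu> \<in> idx D \<Longrightarrow> irreducible_rep K HK (dm D \<mu>) (irrH D \<mu>)"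
  using setting by (auto simp: hecke_setting_def complete_irreps_def)

lemma irrH_rep: "\<mu> \<in> idx D \<Longrightarrow> matrix_rep K HK (dm D \<mu>) (irrH D \<mu>)"
  using irrH_irr by (auto simp: irreducible_rep_def)

lemma dm_pos: "\<mu> \<in> idx D \<Longrightarrow> dm D \<mu> > 0"
  using irrH_irr by (auto simp: irreducible_rep_def)

lemma HK_iff: "f \<in> carrier HK \<longleftrightarrow> (\<forall>w\<in>W. f w \<in> K) \<and> (\<forall>w. w \<notin> W \<longrightarrow> f w = 0)"
  by (simp add: hecke_K_def basis_algebra_def)

lemma bas_HK: "w \<in> W \<Longrightarrow> bas w \<in> carrier HK"
  by (auto simp: HK_iff bas_def)

definition rep :: "'i \<Rightarrow> 'w \<Rightarrow> nat \<Rightarrow> nat \<Rightarrow> 'g cgrf" where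
  "rep \<mu> w i j = irrH D \<mu> (bas w) $$ (i, j)"

lemma irrH_carrier:
  assumes "\<mu> \<in> idx D" "h \<in> carrier HK"
  shows "irrH D \<mu> h \<in> carrier_mat (dm D \<mu>) (dm D \<mu>)"
    and "i < dm D \<mu> \<Longrightarrow> j < dm D \<mu> \<Longrightarrow> irrH D \<mu> h $$ (i, j) \<in> K"
proof -
  have "irrH D \<mu> h \<in> mats_over K (dm D \<mu>)"
    using irrH_rep[OF assms(1)] assms(2) by (simp add: matrix_rep_def)
  then show "irrH D \<mu> h \<in> carrier_mat (dm D \<mu>) (dm D \<mu>)"
    "i < dm D \<mu> \<Longrightarrow> j < dm D \<mu> \<Longrightarrow> irrH D \<mu> h $$ (i, j) \<in> K"
    by (simp_all add: mats_over_iff)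
qed

lemma rep_K: "\<mu> \<in> idx D \<Longrightarrow> w \<in> W \<Longrightarrow> i < dm D \<mu> \<Longrightarrow> j < dm D \<mu> \<Longrightarrow> rep \<mu> w i j \<in> K"
  unfolding rep_def using irrH_carrier(2) bas_HK by blast

lemma irrH_lincomb:
  assumes \<mu>: "\<mu> \<in> idx D" and ij: "i < dm D \<mu>" "j < dm D \<mu>" and "h \<in> carrier HK"
  shows "irrH D \<mu> h $$ (i, j) = (\<Sum>w\<in>W. h w * rep \<mu> w i j)"
proof -
  have add: "irrH D \<mu> (\<lambda>z. f z + g z) = irrH D \<mu> f + irrH D \<mu> g"
    if "f \<in> carrier HK" "g \<in> carrier HK" for f g
    using irrH_rep[OF \<mu>] that by (simp add: matrix_rep_def hecke_K_def basis_algebra_def)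
  have smult: "irrH D \<mu> (\<lambda>z. a * f z) = a \<cdot>\<^sub>m irrH D \<mu> f"
    if "f \<in> carrier HK" "a \<in> K" for f a
    using irrH_rep[OF \<mu>] that by (simp add: matrix_rep_def hecke_K_def basis_algebra_def)
  have z: "(\<lambda>_. 0) \<in> carrier HK" by (simp add: HK_iff)
  have zero: "irrH D \<mu> (\<lambda>_. 0) $$ (i, j) = 0"
  proof -
    have "irrH D \<mu> (\<lambda>_. 0) $$ (i, j) = (0 \<cdot>\<^sub>m irrH D \<mu> (\<lambda>_. 0)) $$ (i, j)"
      using smult[OF z, of 0] by simp
    then show ?thesis using irrH_carrier(1)[OF \<mu> z] ij by simp
  qed
  \<comment> \<open>A matrix representation is assumed additive for two summands only; truncating h
    to growing subsets of W yields the full linear combination.\<close>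
  have "finite X' \<Longrightarrow> X' \<subseteq> W \<Longrightarrow>
      irrH D \<mu> (\<lambda>z. if z \<in> X' then h z else 0) $$ (i, j) = (\<Sum>w\<in>X'. h w * rep \<mu> w i j)" for X'
  proof (induction X' rule: finite_induct)
    case empty
    then show ?case using zero by simp
  next
    case (insert x F)
    have x: "x \<in> W" "h x \<in> K" using insert assms(4) by (auto simp: HK_iff)
    have F: "(\<lambda>z. if z \<in> F then h z else 0) \<in> carrier HK"
      using assms(4) insert.prems by (auto simp: HK_iff)
    have hx: "(\<lambda>z. h x * bas x z) \<in> carrier HK" using x by (auto simp: HK_iff bas_def)
    have "(\<lambda>z. if z \<in> insert x F then h z else 0) = (\<lambda>z. h x * bas x z + (if z \<in> F then h z else 0))"
      using insert by (auto simp: bas_def)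
    then have "irrH D \<mu> (\<lambda>z. if z \<in> insert x F then h z else 0) =
        h x \<cdot>\<^sub>m irrH D \<mu> (bas x) + irrH D \<mu> (\<lambda>z. if z \<in> F then h z else 0)"
      using add[OF hx F] smult[OF bas_HK[OF x(1)] x(2)] by simp
    then show ?case
      using insert ij irrH_carrier(1)[OF \<mu> F] irrH_carrier(1)[OF \<mu> bas_HK[OF x(1)]]
      by (simp add: rep_def)
  qed
  from this[OF finW] have "irrH D \<mu> (\<lambda>z. if z \<in> W then h z else 0) $$ (i, j) = (\<Sum>w\<in>W. h w * rep \<mu> w i j)"
    by blast
  moreover have "(\<lambda>z. if z \<in> W then h z else 0) = h" using assms(4) by (auto simp: HK_iff)
  ultimately show ?thesis by simp
qed

lemma rep_mult:
  assumes \<mu>: "\<mu> \<in> idx D" and ij: "i < dm D \<mu>" "j < dm D \<mu>" and xy: "x \<in> W" "y \<in> W"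
  shows "(\<Sum>l<dm D \<mu>. rep \<mu> x i l * rep \<mu> y l j) = (\<Sum>z\<in>W. to_fract (m x y z) * rep \<mu> z i j)"
proof -
  have eq: "bas x \<otimes>\<^bsub>HK\<^esub> bas y = (\<lambda>z. if z \<in> W then to_fract (m x y z) else 0)"
  proof -
    have "(\<Sum>b\<in>W. bas x a * bas y b * to_fract (m a b z)) = bas x a * to_fract (m a y z)" for a z
      using xy by (simp add: bas_def if_distrib[of "\<lambda>c. _ * c"] if_distrib[of "\<lambda>c. c * _"] cong: if_cong)
    then have "(\<Sum>a\<in>W. \<Sum>b\<in>W. bas x a * bas y b * to_fract (m a b z)) = to_fract (m x y z)" for z
      using xy by (simp only: sum_mult_bas finW if_True)
    then show ?thesis by (simp add: hecke_K_def basis_algebra_def cong: if_cong)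
  qed
  have c: "(\<lambda>z. if z \<in> W then to_fract (m x y z) else 0) \<in> carrier HK"
    using xy by (auto simp: HK_iff intro: to_fract_K m_A)
  have "irrH D \<mu> (bas x \<otimes>\<^bsub>HK\<^esub> bas y) = irrH D \<mu> (bas x) * irrH D \<mu> (bas y)"
    using irrH_rep[OF \<mu>] bas_HK xy by (simp add: matrix_rep_def)
  then have "irrH D \<mu> (bas x \<otimes>\<^bsub>HK\<^esub> bas y) $$ (i, j) = (\<Sum>l<dm D \<mu>. rep \<mu> x i l * rep \<mu> y l j)"
    using mult_mat_index[OF irrH_carrier(1)[OF \<mu> bas_HK[OF xy(1)]] irrH_carrier(1)[OF \<mu> bas_HK[OF xy(2)]] ij]
    by (simp add: rep_def)
  moreover have "irrH D \<mu> (bas x \<otimes>\<^bsub>HK\<^esub> bas y) $$ (i, j) = (\<Sum>z\<in>W. to_fract (m x y z) * rep \<mu> z i j)"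
    unfolding eq irrH_lincomb[OF \<mu> ij c] by simp
  ultimately show ?thesis by simp
qed

lemma intertwine_generators:
  assumes \<mu>: "\<mu> \<in> idx D" and \<nu>: "\<nu> \<in> idx D"
    and N: "N \<in> carrier_mat (dm D \<mu>) (dm D \<nu>)"
    and comm: "\<And>x i j. x \<in> W \<Longrightarrow> i < dm D \<mu> \<Longrightarrow> j < dm D \<nu> \<Longrightarrow>
      (\<Sum>l<dm D \<mu>. rep \<mu> x i l * N $$ (l, j)) = (\<Sum>l<dm D \<nu>. N $$ (i, l) * rep \<nu> x l j)"
    and h: "h \<in> carrier HK"
  shows "irrH D \<mu> h * N = N * irrH D \<nu> h"
proof (rule eq_matI)
  note c = irrH_carrier(1)[OF \<mu> h] irrH_carrier(1)[OF \<nu> h]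
  fix i j assume "i < dim_row (N * irrH D \<nu> h)" "j < dim_col (N * irrH D \<nu> h)"
  then have ij: "i < dm D \<mu>" "j < dm D \<nu>" using N c by auto
  have "(irrH D \<mu> h * N) $$ (i, j) = (\<Sum>l<dm D \<mu>. \<Sum>w\<in>W. h w * (rep \<mu> w i l * N $$ (l, j)))"
    unfolding mult_mat_index[OF c(1) N ij] using ij
    by (simp add: irrH_lincomb[OF \<mu> _ _ h] sum_distrib_right mult.assoc)
  also have "\<dots> = (\<Sum>w\<in>W. h w * (\<Sum>l<dm D \<mu>. rep \<mu> w i l * N $$ (l, j)))"
    by (subst sum.swap) (simp add: sum_distrib_left)
  also have "\<dots> = (\<Sum>w\<in>W. h w * (\<Sum>l<dm D \<nu>. N $$ (i, l) * rep \<nu> w l j))"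
    using comm ij by simp
  also have "\<dots> = (\<Sum>l<dm D \<nu>. \<Sum>w\<in>W. N $$ (i, l) * (h w * rep \<nu> w l j))"
    by (subst sum.swap) (simp add: sum_distrib_left mult.left_commute)
  also have "\<dots> = (N * irrH D \<nu> h) $$ (i, j)"
    unfolding mult_mat_index[OF N c(2) ij] using ij
    by (simp add: irrH_lincomb[OF \<nu> _ _ h] sum_distrib_left)
  finally show "(irrH D \<mu> h * N) $$ (i, j) = (N * irrH D \<nu> h) $$ (i, j)" .
qed (use N irrH_carrier(1)[OF \<mu> h] irrH_carrier(1)[OF \<nu> h] in auto)

text \<open>For fixed j and k these are the entries, in i and l, of an elementary matrix averaged
  over the dual bases T_w and T_{w^{-1}}.\<close>

definition schur_sum :: "'i \<Rightarrow> 'i \<Rightarrow> nat \<Rightarrow> nat \<Rightarrow> nat \<Rightarrow> nat \<Rightarrow> 'g cgrf" where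
  "schur_sum \<mu> \<nu> i j k l = (\<Sum>w\<in>W. rep \<mu> w i j * rep \<nu> (iv w) k l)"

lemma schur_sum_swap: "schur_sum \<mu> \<nu> i j k l = schur_sum \<nu> \<mu> k l i j"
proof -
  have "schur_sum \<mu> \<nu> i j k l = (\<Sum>w\<in>W. rep \<mu> (iv w) i j * rep \<nu> (iv (iv w)) k l)"
    unfolding schur_sum_def by (rule sum_iv[symmetric])
  also have "\<dots> = schur_sum \<nu> \<mu> k l i j"
    unfolding schur_sum_def by (rule sum.cong) (auto simp: mult.commute)
  finally show ?thesis .
qed

text \<open>Multiplying one of two dual bases by T_x on the left amounts to multiplying the other by
  T_x on the right. In coordinates this is the cyclic symmetry \<open>m_rotate\<close>.\<close>

lemma schur_intertwine:
  assumes \<mu>: "\<mu> \<in> idx D" and \<nu>: "\<nu> \<in> idx D" and x: "x \<in> W"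
    and i: "i < dm D \<mu>" "j < dm D \<mu>" "k < dm D \<nu>" "l < dm D \<nu>"
  shows "(\<Sum>p<dm D \<mu>. rep \<mu> x i p * schur_sum \<mu> \<nu> p j k l) =
    (\<Sum>p<dm D \<nu>. schur_sum \<mu> \<nu> i j k p * rep \<nu> x p l)"
proof -
  have "(\<Sum>p<dm D \<mu>. rep \<mu> x i p * schur_sum \<mu> \<nu> p j k l) =
      (\<Sum>p<dm D \<mu>. \<Sum>w\<in>W. (rep \<mu> x i p * rep \<mu> w p j) * rep \<nu> (iv w) k l)"
    by (simp add: schur_sum_def sum_distrib_left mult.assoc)
  also have "\<dots> = (\<Sum>w\<in>W. (\<Sum>p<dm D \<mu>. rep \<mu> x i p * rep \<mu> w p j) * rep \<nu> (iv w) k l)"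
    by (subst sum.swap) (simp add: sum_distrib_right)
  also have "\<dots> = (\<Sum>w\<in>W. \<Sum>z\<in>W. to_fract (m x w z) * rep \<mu> z i j * rep \<nu> (iv w) k l)"
    using assms by (simp add: rep_mult sum_distrib_right)
  also have "\<dots> = (\<Sum>z\<in>W. \<Sum>w\<in>W. to_fract (m x w z) * rep \<mu> z i j * rep \<nu> (iv w) k l)"
    by (rule sum.swap)
  also have "\<dots> = (\<Sum>z\<in>W. rep \<mu> z i j * (\<Sum>w\<in>W. to_fract (m (iv z) x (iv w)) * rep \<nu> (iv w) k l))"
    using x by (simp add: m_rotate[of x] sum_distrib_left mult_ac)
  also have "\<dots> = (\<Sum>z\<in>W. rep \<mu> z i j * (\<Sum>w\<in>W. to_fract (m (iv z) x w) * rep \<nu> w k l))"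
    by (simp add: sum_iv[of "\<lambda>w. to_fract (m (iv _) x w) * rep \<nu> w k l"])
  also have "\<dots> = (\<Sum>z\<in>W. rep \<mu> z i j * (\<Sum>p<dm D \<nu>. rep \<nu> (iv z) k p * rep \<nu> x p l))"
    using assms by (simp add: rep_mult)
  also have "\<dots> = (\<Sum>p<dm D \<nu>. \<Sum>z\<in>W. rep \<mu> z i j * rep \<nu> (iv z) k p * rep \<nu> x p l)"
    by (subst sum.swap) (simp add: sum_distrib_left mult.assoc)
  finally show ?thesis by (simp add: schur_sum_def sum_distrib_right)
qed

lemma schur_mat:
  assumes \<mu>: "\<mu> \<in> idx D" and \<nu>: "\<nu> \<in> idx D" and jk: "j < dm D \<mu>" "k < dm D \<nu>"
  defines "N \<equiv> mat (dm D \<mu>) (dm D \<nu>) (\<lambda>(i, l). schur_sum \<mu> \<nu> i j k l)"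
  shows "N \<in> carrier_mat (dm D \<mu>) (dm D \<nu>)" "\<forall>i<dm D \<mu>. \<forall>l<dm D \<nu>. N $$ (i, l) \<in> K"
    "h \<in> carrier HK \<Longrightarrow> irrH D \<mu> h * N = N * irrH D \<nu> h"
proof -
  show N: "N \<in> carrier_mat (dm D \<mu>) (dm D \<nu>)" by (simp add: N_def)
  show "\<forall>i<dm D \<mu>. \<forall>l<dm D \<nu>. N $$ (i, l) \<in> K"
    using assms by (auto simp: N_def schur_sum_def intro!: K.sum_closed K.mult_closed rep_K)
  show "irrH D \<mu> h * N = N * irrH D \<nu> h" if "h \<in> carrier HK"
    using schur_intertwine[OF \<mu> \<nu>] jk that by (intro intertwine_generators[OF \<mu> \<nu> N]) (auto simp: N_def)
qed

text \<open>A nonzero entry would give a nonzero intertwiner, hence equivalent representations,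
  although each isomorphism class is listed only once.\<close>

lemma schur_sum_distinct:
  assumes "\<mu> \<in> idx D" "\<nu> \<in> idx D" "\<mu> \<noteq> \<nu>"
    and "i < dm D \<mu>" "j < dm D \<mu>" "k < dm D \<nu>" "l < dm D \<nu>"
  shows "schur_sum \<mu> \<nu> i j k l = 0"
proof (rule ccontr)
  assume nz: "schur_sum \<mu> \<nu> i j k l \<noteq> 0"
  define N where "N = mat (dm D \<mu>) (dm D \<nu>) (\<lambda>(i, l). schur_sum \<mu> \<nu> i j k l)"
  have "N $$ (i, l) \<noteq> 0" using nz assms by (simp add: N_def)
  then have "N \<noteq> 0\<^sub>m (dm D \<mu>) (dm D \<nu>)" using assms by auto
  then have "equivalent_reps K HK (dm D \<nu>) (irrH D \<nu>) (dm D \<mu>) (irrH D \<mu>)"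
    using schur_mat[OF assms(1,2,5,6)] irrH_irr assms K.closed_field_axioms of_nat_K_nonzero
    unfolding N_def[symmetric] by (intro intertwiner_equivalent[where N = N]) auto
  then show False using setting assms unfolding hecke_setting_def complete_irreps_def by metis
qed

text \<open>As the algebra is split, the matrix in i and l is scalar for fixed j and k. The
  substitution of w^{-1} for w exchanges the index pairs, so the same holds in j and k, and a single
  constant remains.\<close>

lemma schur_sum_same:
  assumes \<mu>: "\<mu> \<in> idx D" and ijkl: "i < dm D \<mu>" "j < dm D \<mu>" "k < dm D \<mu>" "l < dm D \<mu>"
  shows "schur_sum \<mu> \<mu> i j k l = (if i = l \<and> j = k then schur_sum \<mu> \<mu> 0 0 0 0 else 0)"
proof -
  have scalar: "\<exists>a. \<forall>i<dm D \<mu>. \<forall>l<dm D \<mu>. schur_sum \<mu> \<mu> i j k l = (if i = l then a else 0)"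
    if jk: "j < dm D \<mu>" "k < dm D \<mu>" for j k
  proof -
    define N where "N = mat (dm D \<mu>) (dm D \<mu>) (\<lambda>(i, l). schur_sum \<mu> \<mu> i j k l)"
    note N = schur_mat[OF \<mu> \<mu> jk, folded N_def]
    have "N \<in> mats_over K (dm D \<mu>)" using N(1,2) by (simp add: mats_over_iff)
    moreover have "split_algebra K HK" using setting by (simp add: hecke_setting_def)
    ultimately obtain a where "N = a \<cdot>\<^sub>m 1\<^sub>m (dm D \<mu>)"
      using irrH_irr[OF \<mu>] N(3) unfolding split_algebra_def by metis
    then have "N $$ (i, l) = (if i = l then a else 0)" if "i < dm D \<mu>" "l < dm D \<mu>" for i l
      using that by simp
    then show ?thesis by (auto simp: N_def)
  qed
  have d: "0 < dm D \<mu>" using dm_pos[OF \<mu>] .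
  have off: "schur_sum \<mu> \<mu> i j k l = 0"
    if "i < dm D \<mu>" "j < dm D \<mu>" "k < dm D \<mu>" "l < dm D \<mu>" "i \<noteq> l" for i j k l
    using scalar[of j k] that by auto
  have diag: "schur_sum \<mu> \<mu> i j k i = schur_sum \<mu> \<mu> 0 j k 0"
    if "i < dm D \<mu>" "j < dm D \<mu>" "k < dm D \<mu>" for i j k
    using scalar[of j k] that d by auto
  show ?thesis
  proof (cases "i = l")
    case False
    then show ?thesis using off ijkl by simp
  next
    case True
    show ?thesis
    proof (cases "j = k")
      case False
      have "schur_sum \<mu> \<mu> i j k l = schur_sum \<mu> \<mu> k l i j" by (rule schur_sum_swap)
      also have "\<dots> = 0" using off[of k l i j] ijkl False by simp
      finally show ?thesis using False by simp
    next
      case True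
      have "schur_sum \<mu> \<mu> i j k l = schur_sum \<mu> \<mu> 0 j j 0" using diag[of i j j] ijkl \<open>i = l\<close> True by simp
      also have "\<dots> = schur_sum \<mu> \<mu> j 0 0 j" by (rule schur_sum_swap)
      also have "\<dots> = schur_sum \<mu> \<mu> 0 0 0 0" using diag[of j 0 0] ijkl d by simp
      finally show ?thesis using True \<open>i = l\<close> by simp
    qed
  qed
qed

text \<open>The trace identity defining c_lambda becomes, by the relations above, d_lambda times the
  common constant; the dimension cancels in characteristic zero. Multiplication by epsilon^(2a)
  moves the lowest term f_lambda to exponent 0.\<close>

lemma schur_element:
  assumes \<mu>: "\<mu> \<in> idx D"
  obtains c where "c \<in> ringA D" "schur_sum \<mu> \<mu> 0 0 0 0 = to_fract c" "c \<noteq> 0"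
    "has_const (to_fract (eps (aval D \<mu>)) * to_fract (eps (aval D \<mu>)) * to_fract c) (complex_of_real (fval D \<mu>))"
proof -
  have "has_invariants D \<mu>" using setting \<mu> by (simp add: hecke_setting_def)
  then obtain c p where c: "c \<in> ringA D" and f: "fval D \<mu> > 0"
    and tr: "(\<Sum>w\<in>W. mat_trace (irrH D \<mu> (bas w)) * mat_trace (irrH D \<mu> (bas (iv w)))) = of_nat (dm D \<mu>) * to_fract c"
    and cp: "c = const_gr (complex_of_real (fval D \<mu>)) * eps (- (aval D \<mu> + aval D \<mu>)) + p"
    and p: "\<forall>g\<in>supp p. g > - (aval D \<mu> + aval D \<mu>)"
    unfolding has_invariants_def by blast
  let ?d = "dm D \<mu>" and ?s = "schur_sum \<mu> \<mu> 0 0 0 0"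
  have trace: "mat_trace (irrH D \<mu> (bas w)) = (\<Sum>i<?d. rep \<mu> w i i)" if "w \<in> W" for w
    using irrH_carrier(1)[OF \<mu> bas_HK[OF that]] by (simp add: mat_trace_def rep_def)
  have "of_nat ?d * to_fract c = (\<Sum>w\<in>W. (\<Sum>i<?d. rep \<mu> w i i) * (\<Sum>k<?d. rep \<mu> (iv w) k k))"
    using tr by (simp add: trace)
  also have "\<dots> = (\<Sum>w\<in>W. \<Sum>i<?d. \<Sum>k<?d. rep \<mu> w i i * rep \<mu> (iv w) k k)"
    by (simp add: sum_product)
  also have "\<dots> = (\<Sum>i<?d. \<Sum>w\<in>W. \<Sum>k<?d. rep \<mu> w i i * rep \<mu> (iv w) k k)" by (rule sum.swap)
  also have "\<dots> = (\<Sum>i<?d. \<Sum>k<?d. schur_sum \<mu> \<mu> i i k k)"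
    unfolding schur_sum_def by (intro sum.cong HOL.refl sum.swap)
  also have "\<dots> = (\<Sum>i<?d. \<Sum>k<?d. if i = k then ?s else 0)"
    using \<mu> by (intro sum.cong HOL.refl) (simp add: schur_sum_same)
  also have "\<dots> = of_nat ?d * ?s" by simp
  finally have s: "?s = to_fract c" using of_nat_K_nonzero[OF dm_pos[OF \<mu>]] by simp
  let ?a = "aval D \<mu>"
  have cc: "eps ?a * eps ?a * c = const_gr (complex_of_real (fval D \<mu>)) + eps (?a + ?a) * p"
  proof -
    have "eps ?a * eps ?a * c = const_gr (complex_of_real (fval D \<mu>)) * (eps (?a + ?a) * eps (- (?a + ?a))) + eps (?a + ?a) * p"
      unfolding cp eps_add[of ?a ?a] by (simp add: algebra_simps)
    then show ?thesis by (simp flip: eps_add)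
  qed
  have pc: "coeff_at (eps (?a + ?a) * p) g = coeff_at p (g - (?a + ?a))" for g
    using coeff_at_const_eps(2)[of "?a + ?a" 1 p g] by (simp add: eps_def)
  have pos: "\<forall>g\<in>supp (eps (?a + ?a) * p). g > 0"
  proof
    fix g assume "g \<in> supp (eps (?a + ?a) * p)"
    then have "g - (?a + ?a) \<in> supp p" by (simp add: in_keys_iff pc)
    then have "- (?a + ?a) < g - (?a + ?a)" using p by blast
    then show "g > 0" by (simp add: algebra_simps)
  qed
  have "has_const (to_fract (eps ?a * eps ?a * c)) (coeff_at (eps ?a * eps ?a * c) 0)"
  proof (rule has_const_to_fract)
    have "\<forall>g\<in>supp (const_gr (complex_of_real (fval D \<mu>))). g \<ge> (0 :: 'g)" by (simp add: const_gr_def)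
    then show "\<forall>g\<in>supp (eps ?a * eps ?a * c). g \<ge> 0"
      unfolding cc using pos by (auto dest!: supp_addD simp: less_imp_le)
  qed
  moreover have "coeff_at (eps ?a * eps ?a * c) 0 = complex_of_real (fval D \<mu>)"
    unfolding cc using coeff_at_0_pos[OF pos] by (simp add: lookup_add const_gr_def)
  ultimately have hc: "has_const (to_fract (eps ?a) * to_fract (eps ?a) * to_fract c) (complex_of_real (fval D \<mu>))"
    by simp
  have "c \<noteq> 0"
    using \<open>coeff_at (eps ?a * eps ?a * c) 0 = complex_of_real (fval D \<mu>)\<close> f by auto
  then show ?thesis using that c s hc by blast
qed

section \<open>Faithfulness and the column relations\<close>

lemma rep_faithful:
  assumes h: "h \<in> carrier HK"
    and zero: "\<And>\<mu> i j. \<mu> \<in> idx D \<Longrightarrow> i < dm D \<mu> \<Longrightarrow> j < dm D \<mu> \<Longrightarrow> (\<Sum>w\<in>W. h w * rep \<mu> w i j) = 0"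
  shows "h = (\<lambda>_. 0)"
proof -
  have irr0: "irrH D \<mu> h = 0\<^sub>m (dm D \<mu>) (dm D \<mu>)" if "\<mu> \<in> idx D" for \<mu>
    using irrH_carrier(1)[OF that h] by (intro eq_matI) (auto simp: irrH_lincomb[OF that _ _ h] zero[OF that])
  have "\<tau> h = 0\<^sub>m n n" if irr: "irreducible_rep K HK n \<tau>" for n \<tau>
  proof -
    obtain \<mu> where \<mu>: "\<mu> \<in> idx D" "equivalent_reps K HK (dm D \<mu>) (irrH D \<mu>) n \<tau>"
      using setting irr unfolding hecke_setting_def complete_irreps_def by blast
    then obtain P Q where PQ: "P \<in> mats_over K n" "Q \<in> mats_over K n" "\<tau> h = P * irrH D \<mu> h * Q" "dm D \<mu> = n"
      using h unfolding equivalent_reps_def by metis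
    then show ?thesis using irr0[OF \<mu>(1)] by (auto simp: mats_over_iff)
  qed
  moreover have "semisimple_algebra K HK" using setting by (simp add: hecke_setting_def)
  ultimately have "h = \<zero>\<^bsub>HK\<^esub>" using h unfolding semisimple_algebra_def by blast
  then show ?thesis by (simp add: hecke_K_def basis_algebra_def)
qed

text \<open>Fourier inversion: an element of H_K is recovered from its images in the irreducible
  representations. The row relations show that both sides have the same images, and semisimplicity
  makes them equal.\<close>

lemma rep_column_orthogonality:
  assumes wy: "w \<in> W" "y \<in> W"
  shows "(\<Sum>\<mu>\<in>idx D. \<Sum>i<dm D \<mu>. \<Sum>j<dm D \<mu>.
      inverse (schur_sum \<mu> \<mu> 0 0 0 0) * rep \<mu> y i j * rep \<mu> (iv w) j i) = (if w = y then 1 else 0)"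
proof -
  let ?s = "\<lambda>\<mu>. schur_sum \<mu> \<mu> 0 0 0 0"
  have snz: "?s \<mu> \<noteq> 0" "?s \<mu> \<in> K" if "\<mu> \<in> idx D" for \<mu>
    using schur_element[OF that] to_fract_K by (metis to_fract_eq_0_iff)+
  have finI: "finite (idx D)" using setting by (simp add: hecke_setting_def)
  \<comment> \<open>The candidate coefficients of T_y in the basis T_z: summing g z times the image
    of T_z gives the image of T_y in every irreducible representation.\<close>
  define g where "g z = (\<Sum>\<mu>\<in>idx D. \<Sum>i<dm D \<mu>. \<Sum>j<dm D \<mu>. inverse (?s \<mu>) * rep \<mu> y i j * rep \<mu> (iv z) j i)" for z
  define h where "h = (\<lambda>z. if z \<in> W then bas y z - g z else 0)"
  have gK: "g z \<in> K" if "z \<in> W" for z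
    unfolding g_def using that wy snz by (intro K.sum_closed K.mult_closed K.inverse_closed rep_K) auto
  have hHK: "h \<in> carrier HK" using gK by (auto simp: h_def HK_iff bas_def)
  have "h = (\<lambda>_. 0)"
  proof (rule rep_faithful[OF hHK])
    fix \<nu> k l assume \<nu>: "\<nu> \<in> idx D" and kl: "k < dm D \<nu>" "l < dm D \<nu>"
    have "(\<Sum>z\<in>W. g z * rep \<nu> z k l) =
        (\<Sum>z\<in>W. \<Sum>\<mu>\<in>idx D. \<Sum>i<dm D \<mu>. \<Sum>j<dm D \<mu>. inverse (?s \<mu>) * rep \<mu> y i j * (rep \<nu> z k l * rep \<mu> (iv z) j i))"
      unfolding g_def sum_distrib_right by (intro sum.cong HOL.refl) (simp add: mult_ac)
    also have "\<dots> = (\<Sum>\<mu>\<in>idx D. \<Sum>z\<in>W. \<Sum>i<dm D \<mu>. \<Sum>j<dm D \<mu>. inverse (?s \<mu>) * rep \<mu> y i j * (rep \<nu> z k l * rep \<mu> (iv z) j i))"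
      by (rule sum.swap)
    also have "\<dots> = (\<Sum>\<mu>\<in>idx D. \<Sum>i<dm D \<mu>. \<Sum>z\<in>W. \<Sum>j<dm D \<mu>. inverse (?s \<mu>) * rep \<mu> y i j * (rep \<nu> z k l * rep \<mu> (iv z) j i))"
      by (intro sum.cong HOL.refl sum.swap)
    also have "\<dots> = (\<Sum>\<mu>\<in>idx D. \<Sum>i<dm D \<mu>. \<Sum>j<dm D \<mu>. \<Sum>z\<in>W. inverse (?s \<mu>) * rep \<mu> y i j * (rep \<nu> z k l * rep \<mu> (iv z) j i))"
      by (intro sum.cong HOL.refl sum.swap)
    also have "\<dots> = (\<Sum>\<mu>\<in>idx D. \<Sum>i<dm D \<mu>. \<Sum>j<dm D \<mu>. inverse (?s \<mu>) * rep \<mu> y i j * schur_sum \<nu> \<mu> k l j i)"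
      by (simp add: schur_sum_def[of \<nu> _ k l] sum_distrib_left)
    also have "\<dots> = (\<Sum>\<mu>\<in>idx D. if \<mu> = \<nu> then rep \<nu> y k l else 0)"
    proof (rule sum.cong[OF HOL.refl])
      fix \<mu> assume \<mu>: "\<mu> \<in> idx D"
      show "(\<Sum>i<dm D \<mu>. \<Sum>j<dm D \<mu>. inverse (?s \<mu>) * rep \<mu> y i j * schur_sum \<nu> \<mu> k l j i) =
          (if \<mu> = \<nu> then rep \<nu> y k l else 0)"
      proof (cases "\<mu> = \<nu>")
        case True
        have "inverse (?s \<nu>) * rep \<nu> y i j * schur_sum \<nu> \<nu> k l j i =
            (if k = i then if l = j then rep \<nu> y k l else 0 else 0)" if "i < dm D \<nu>" "j < dm D \<nu>" for i j
          unfolding schur_sum_same[OF \<nu> kl that(2,1)] using snz(1)[OF \<nu>] by simp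
        then have "(\<Sum>i<dm D \<mu>. \<Sum>j<dm D \<mu>. inverse (?s \<mu>) * rep \<mu> y i j * schur_sum \<nu> \<mu> k l j i) =
            (\<Sum>i<dm D \<mu>. \<Sum>j<dm D \<mu>. if k = i then if l = j then rep \<nu> y k l else 0 else 0)"
          unfolding True by (intro sum.cong HOL.refl) simp
        also have "\<dots> = (\<Sum>i<dm D \<mu>. if k = i then rep \<nu> y k l else 0)"
          using kl True by (intro sum.cong HOL.refl) (simp add: sum.delta')
        also have "\<dots> = rep \<nu> y k l" using kl True by (simp add: sum.delta')
        finally show ?thesis using True by simp
      next
        case False
        then show ?thesis using schur_sum_distinct[OF \<nu> \<mu>] kl by simp
      qed
    qed
    also have "\<dots> = rep \<nu> y k l" using \<nu> finI by simp
    finally have "(\<Sum>z\<in>W. g z * rep \<nu> z k l) = rep \<nu> y k l" .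
    moreover have "(\<Sum>z\<in>W. bas y z * rep \<nu> z k l) = rep \<nu> y k l" using wy by (simp add: sum_mult_bas)
    ultimately show "(\<Sum>w\<in>W. h w * rep \<nu> w k l) = 0"
      by (simp add: h_def left_diff_distrib sum_subtractf)
  qed
  then have "h w = 0" by simp
  then show ?thesis using wy by (simp add: h_def g_def bas_def)
qed

end

section \<open>Leading matrix coefficients\<close>

context hecke_ctx
begin

section \<open>Orthogonality of the leading coefficients\<close>

abbreviation lc where "lc \<equiv> lead_coef D"
abbreviation E where "E \<mu> \<equiv> to_fract (eps (aval D \<mu>))"
abbreviation fv where "fv \<mu> \<equiv> complex_of_real (fval D \<mu>)"

lemma finI [simp, intro]: "finite (idx D)"
  using setting by (simp add: hecke_setting_def)

lemma fv_nonzero: "\<mu> \<in> idx D \<Longrightarrow> fv \<mu> \<noteq> 0"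
  using setting by (auto simp: hecke_setting_def has_invariants_def)

lemma eps_A [simp, intro]: "eps g \<in> ringA D"
  unfolding ringA_def by (rule eps_in_group_ring[OF R.closed_ring_axioms])

text \<open>\<open>lead_coef\<close> takes the constant term with the sign included; since the sign
  squares to 1 it can be moved to the other side.\<close>

lemma rep_has_const:
  assumes "\<mu> \<in> idx D" "w \<in> W" "i < dm D \<mu>" "j < dm D \<mu>"
  shows "has_const (E \<mu> * rep \<mu> w i j) ((- 1) ^ len D w * lc \<mu> w i j)"
proof -
  have "E \<mu> * rep \<mu> w i j \<in> val_ring D"
    using setting assms by (auto simp: hecke_setting_def balanced_def rep_def)
  note c = val_ring_has_const[OF R.closed_ring_axioms this]
  let ?x = "(- 1) ^ len D w * (E \<mu> * rep \<mu> w i j)"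
  have "has_const ?x ((- 1) ^ len D w * const_term D (E \<mu> * rep \<mu> w i j))"
    by (rule has_const_mult[OF has_const_neg_one_power c])
  moreover have "?x \<in> K"
    using rep_K[OF assms] to_fract_K[of "eps (aval D \<mu>)"]
    by (intro K.mult_closed K.power_closed K.uminus_closed) auto
  ultimately have "const_term D ?x = (- 1) ^ len D w * const_term D (E \<mu> * rep \<mu> w i j)"
    using const_term_eqI[OF R.closed_ring_axioms] by blast
  then have "lc \<mu> w i j = (- 1) ^ len D w * const_term D (E \<mu> * rep \<mu> w i j)"
    by (simp add: lead_coef_def rep_def mult.assoc)
  then have "(- 1) ^ len D w * lc \<mu> w i j = const_term D (E \<mu> * rep \<mu> w i j)"
    by (simp flip: mult.assoc power_mult_distrib)
  then show ?thesis using c by simp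
qed

text \<open>Constant terms of the Schur relations, rescaled by one factor epsilon^a for each
  representation. The signs cancel because w and w^{-1} have equal length, and epsilon^(2a) c_lambda
  has constant term f_lambda.\<close>

lemma row_orthogonality:
  assumes \<mu>: "\<mu> \<in> idx D" and \<nu>: "\<nu> \<in> idx D"
    and "i < dm D \<mu>" "j < dm D \<mu>" "k < dm D \<nu>" "l < dm D \<nu>"
  shows "(\<Sum>w\<in>W. lc \<mu> w i j * lc \<nu> (iv w) k l) = (if \<mu> = \<nu> \<and> i = l \<and> j = k then fv \<mu> else 0)"
proof -
  have "has_const (\<Sum>w\<in>W. (E \<mu> * rep \<mu> w i j) * (E \<nu> * rep \<nu> (iv w) k l))
      (\<Sum>w\<in>W. ((- 1) ^ len D w * lc \<mu> w i j) * ((- 1) ^ len D (iv w) * lc \<nu> (iv w) k l))"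
    using assms by (intro has_const_sum has_const_mult rep_has_const) auto
  moreover have "(\<Sum>w\<in>W. ((- 1) ^ len D w * lc \<mu> w i j) * ((- 1) ^ len D (iv w) * lc \<nu> (iv w) k l)) =
      (\<Sum>w\<in>W. lc \<mu> w i j * lc \<nu> (iv w) k l)"
  proof (rule sum.cong[OF HOL.refl])
    fix w assume "w \<in> W"
    then show "((- 1) ^ len D w * lc \<mu> w i j) * ((- 1) ^ len D (iv w) * lc \<nu> (iv w) k l) =
        lc \<mu> w i j * lc \<nu> (iv w) k l"
      by (cases "even (len D w)") auto
  qed
  moreover have "(\<Sum>w\<in>W. (E \<mu> * rep \<mu> w i j) * (E \<nu> * rep \<nu> (iv w) k l)) = E \<mu> * E \<nu> * schur_sum \<mu> \<nu> i j k l"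
    unfolding schur_sum_def sum_distrib_left by (intro sum.cong HOL.refl) (simp only: mult_ac)
  ultimately have h: "has_const (E \<mu> * E \<nu> * schur_sum \<mu> \<nu> i j k l) (\<Sum>w\<in>W. lc \<mu> w i j * lc \<nu> (iv w) k l)"
    by (simp only:)
  show ?thesis
  proof (cases "\<mu> = \<nu> \<and> i = l \<and> j = k")
    case True
    obtain c where c: "schur_sum \<mu> \<mu> 0 0 0 0 = to_fract c" "has_const (E \<mu> * E \<mu> * to_fract c) (fv \<mu>)"
      using schur_element[OF \<mu>] by blast
    have "schur_sum \<mu> \<nu> i j k l = to_fract c"
      using schur_sum_same[OF \<mu>, of i j k l] assms True c(1) by auto
    then show ?thesis using True h c(2) has_const_unique by auto
  next
    case False
    have "schur_sum \<mu> \<nu> i j k l = 0"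
    proof (cases "\<mu> = \<nu>")
      case True
      then show ?thesis using schur_sum_same[OF \<mu>, of i j k l] assms False by auto
    next
      case False
      then show ?thesis using schur_sum_distinct assms by blast
    qed
    then have "has_const (0 :: 'g cgrf) (\<Sum>w\<in>W. lc \<mu> w i j * lc \<nu> (iv w) k l)" using h by simp
    then show ?thesis using has_const_unique[OF _ has_const_0] False by auto
  qed
qed

text \<open>The inverse of c_lambda carries a factor epsilon^(2a), which is exactly what balances
  the two matrix coefficients beside it. No separate rescaling is required before taking constant
  terms.\<close>

lemma column_orthogonality:
  assumes wy: "w \<in> W" "y \<in> W"
  shows "(\<Sum>\<mu>\<in>idx D. \<Sum>i<dm D \<mu>. \<Sum>j<dm D \<mu>. inverse (fv \<mu>) * lc \<mu> y i j * lc \<mu> (iv w) j i) =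
    (if w = y then 1 else 0)"
proof -
  let ?s = "\<lambda>\<mu>. schur_sum \<mu> \<mu> 0 0 0 0"
  let ?\<sigma> = "(- 1) ^ len D y * (- 1) ^ len D w :: complex"
  have inv: "has_const (inverse (E \<mu> * E \<mu> * ?s \<mu>)) (inverse (fv \<mu>))" if "\<mu> \<in> idx D" for \<mu>
    using schur_element[OF that] has_const_inverse fv_nonzero[OF that] by metis
  have summand: "has_const (inverse (?s \<mu>) * rep \<mu> y i j * rep \<mu> (iv w) j i)
      (?\<sigma> * (inverse (fv \<mu>) * lc \<mu> y i j * lc \<mu> (iv w) j i))"
    if "\<mu> \<in> idx D" "i < dm D \<mu>" "j < dm D \<mu>" for \<mu> i j
  proof -
    have "has_const (inverse (E \<mu> * E \<mu> * ?s \<mu>) * ((E \<mu> * rep \<mu> y i j) * (E \<mu> * rep \<mu> (iv w) j i)))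
        (inverse (fv \<mu>) * (((- 1) ^ len D y * lc \<mu> y i j) * ((- 1) ^ len D (iv w) * lc \<mu> (iv w) j i)))"
      using that wy by (intro has_const_mult inv rep_has_const) auto
    moreover have "E \<mu> \<noteq> 0" by simp
    then have "inverse (E \<mu> * E \<mu> * ?s \<mu>) * ((E \<mu> * rep \<mu> y i j) * (E \<mu> * rep \<mu> (iv w) j i)) =
        inverse (?s \<mu>) * rep \<mu> y i j * rep \<mu> (iv w) j i"
      by (simp add: field_simps)
    moreover have "inverse (fv \<mu>) * (((- 1) ^ len D y * lc \<mu> y i j) * ((- 1) ^ len D (iv w) * lc \<mu> (iv w) j i)) =
        ?\<sigma> * (inverse (fv \<mu>) * lc \<mu> y i j * lc \<mu> (iv w) j i)"
      using wy by (simp add: mult_ac)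
    ultimately show ?thesis by (simp only:)
  qed
  have "has_const (\<Sum>\<mu>\<in>idx D. \<Sum>i<dm D \<mu>. \<Sum>j<dm D \<mu>. inverse (?s \<mu>) * rep \<mu> y i j * rep \<mu> (iv w) j i)
      (\<Sum>\<mu>\<in>idx D. \<Sum>i<dm D \<mu>. \<Sum>j<dm D \<mu>. ?\<sigma> * (inverse (fv \<mu>) * lc \<mu> y i j * lc \<mu> (iv w) j i))"
    using summand by (intro has_const_sum) auto
  then have "has_const (if w = y then 1 else 0 :: 'g cgrf)
      (?\<sigma> * (\<Sum>\<mu>\<in>idx D. \<Sum>i<dm D \<mu>. \<Sum>j<dm D \<mu>. inverse (fv \<mu>) * lc \<mu> y i j * lc \<mu> (iv w) j i))"
    unfolding rep_column_orthogonality[OF wy] by (simp only: sum_distrib_left)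
  moreover have "has_const (if w = y then 1 else 0 :: 'g cgrf) (if w = y then 1 else 0)" by simp
  ultimately have "?\<sigma> * (\<Sum>\<mu>\<in>idx D. \<Sum>i<dm D \<mu>. \<Sum>j<dm D \<mu>. inverse (fv \<mu>) * lc \<mu> y i j * lc \<mu> (iv w) j i) =
      (if w = y then 1 else 0)"
    by (rule has_const_unique)
  \<comment> \<open>The remaining sign is 1 if w = y, and nonzero in any case, so it drops out of
    the vanishing relations.\<close>
  then show ?thesis by (cases "w = y") (auto simp flip: power_mult_distrib)
qed

text \<open>In the matrices of leading coefficients the element with coordinates \<open>n_t\<close>
  becomes the identity matrix: pairing with the trace in its definition leaves only the diagonal row
  relations.\<close>

lemma n_t_lead_coef:
  assumes \<mu>: "\<mu> \<in> idx D" and ij: "i < dm D \<mu>" "j < dm D \<mu>"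
  shows "(\<Sum>x\<in>W. n_t D x * lc \<mu> x i j) = (if i = j then 1 else 0)"
proof -
  have "(\<Sum>x\<in>W. n_t D x * lc \<mu> x i j) =
      (\<Sum>x\<in>W. \<Sum>\<nu>\<in>idx D. \<Sum>k<dm D \<nu>. inverse (fv \<nu>) * (lc \<mu> x i j * lc \<nu> (iv x) k k))"
    unfolding n_t_def sum_distrib_right by (simp only: mult_ac)
  also have "\<dots> = (\<Sum>\<nu>\<in>idx D. \<Sum>x\<in>W. \<Sum>k<dm D \<nu>. inverse (fv \<nu>) * (lc \<mu> x i j * lc \<nu> (iv x) k k))"
    by (rule sum.swap)
  also have "\<dots> = (\<Sum>\<nu>\<in>idx D. \<Sum>k<dm D \<nu>. \<Sum>x\<in>W. inverse (fv \<nu>) * (lc \<mu> x i j * lc \<nu> (iv x) k k))"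
    by (intro sum.cong HOL.refl sum.swap)
  also have "\<dots> = (\<Sum>\<nu>\<in>idx D. \<Sum>k<dm D \<nu>. inverse (fv \<nu>) * (if \<mu> = \<nu> \<and> i = k \<and> j = k then fv \<mu> else 0))"
    using \<mu> ij by (intro sum.cong HOL.refl) (simp add: row_orthogonality flip: sum_distrib_left)
  also have "\<dots> = (\<Sum>\<nu>\<in>idx D. if \<mu> = \<nu> then \<Sum>k<dm D \<mu>. if k = i then if i = j then 1 else 0 else 0 else 0)"
  proof (rule sum.cong[OF HOL.refl])
    fix \<nu> assume "\<nu> \<in> idx D"
    show "(\<Sum>k<dm D \<nu>. inverse (fv \<nu>) * (if \<mu> = \<nu> \<and> i = k \<and> j = k then fv \<mu> else 0)) =
        (if \<mu> = \<nu> then \<Sum>k<dm D \<mu>. if k = i then if i = j then 1 else 0 else 0 else 0)"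
    proof (cases "\<mu> = \<nu>")
      case True
      have "(\<Sum>k<dm D \<mu>. inverse (fv \<mu>) * (if i = k \<and> j = k then fv \<mu> else 0)) =
          (\<Sum>k<dm D \<mu>. if k = i then if i = j then 1 else 0 else 0)"
        using fv_nonzero[OF \<mu>] by (intro sum.cong HOL.refl) auto
      then show ?thesis using True by simp
    qed simp
  qed
  also have "\<dots> = (if i = j then 1 else 0)" using \<mu> ij by simp
  finally show ?thesis .
qed

text \<open>Contraction with \<open>n_t\<close> replaces the first factor of gamma by an identity
  matrix, and what remains is a column relation.\<close>

lemma sum_n_t_gamma_left:
  assumes "y \<in> W" "z \<in> W"
  shows "(\<Sum>x\<in>W. n_t D x * gamma_t D x y (iv z)) = (if y = z then 1 else 0)"
proof -
  have "(\<Sum>x\<in>W. n_t D x * gamma_t D x y (iv z)) =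
      (\<Sum>x\<in>W. \<Sum>\<mu>\<in>idx D. \<Sum>i<dm D \<mu>. \<Sum>j<dm D \<mu>. \<Sum>k<dm D \<mu>.
        (n_t D x * lc \<mu> x i j) * (inverse (fv \<mu>) * lc \<mu> y j k * lc \<mu> (iv z) k i))"
    by (simp only: gamma_t_def sum_distrib_left mult_ac)
  also have "\<dots> = (\<Sum>\<mu>\<in>idx D. \<Sum>x\<in>W. \<Sum>i<dm D \<mu>. \<Sum>j<dm D \<mu>. \<Sum>k<dm D \<mu>.
        (n_t D x * lc \<mu> x i j) * (inverse (fv \<mu>) * lc \<mu> y j k * lc \<mu> (iv z) k i))"
    by (rule sum.swap)
  also have "\<dots> = (\<Sum>\<mu>\<in>idx D. \<Sum>i<dm D \<mu>. \<Sum>x\<in>W. \<Sum>j<dm D \<mu>. \<Sum>k<dm D \<mu>.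
        (n_t D x * lc \<mu> x i j) * (inverse (fv \<mu>) * lc \<mu> y j k * lc \<mu> (iv z) k i))"
    by (intro sum.cong HOL.refl sum.swap)
  also have "\<dots> = (\<Sum>\<mu>\<in>idx D. \<Sum>i<dm D \<mu>. \<Sum>j<dm D \<mu>. \<Sum>x\<in>W. \<Sum>k<dm D \<mu>.
        (n_t D x * lc \<mu> x i j) * (inverse (fv \<mu>) * lc \<mu> y j k * lc \<mu> (iv z) k i))"
    by (intro sum.cong HOL.refl sum.swap)
  also have "\<dots> = (\<Sum>\<mu>\<in>idx D. \<Sum>i<dm D \<mu>. \<Sum>j<dm D \<mu>.
        (\<Sum>x\<in>W. n_t D x * lc \<mu> x i j) * (\<Sum>k<dm D \<mu>. inverse (fv \<mu>) * lc \<mu> y j k * lc \<mu> (iv z) k i))"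
    by (simp only: sum_product)
  also have "\<dots> = (\<Sum>\<mu>\<in>idx D. \<Sum>i<dm D \<mu>. \<Sum>j<dm D \<mu>.
        if i = j then \<Sum>k<dm D \<mu>. inverse (fv \<mu>) * lc \<mu> y i k * lc \<mu> (iv z) k i else 0)"
    by (intro sum.cong HOL.refl) (simp add: n_t_lead_coef)
  also have "\<dots> = (\<Sum>\<mu>\<in>idx D. \<Sum>i<dm D \<mu>. \<Sum>k<dm D \<mu>. inverse (fv \<mu>) * lc \<mu> y i k * lc \<mu> (iv z) k i)"
    by (rule sum.cong[OF HOL.refl], rule sum.cong[OF HOL.refl]) simp
  also have "\<dots> = (if y = z then 1 else 0)" unfolding column_orthogonality[OF assms(2,1)] by auto
  finally show ?thesis .
qed

text \<open>gamma is a weighted sum of traces of triple matrix products, hence cyclic; this turns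
  the left identity law into the right one.\<close>

lemma gamma_t_cyclic: "gamma_t D x y z = gamma_t D y z x"
proof -
  have "gamma_t D x y z = (\<Sum>\<mu>\<in>idx D. \<Sum>j<dm D \<mu>. \<Sum>i<dm D \<mu>. \<Sum>k<dm D \<mu>.
      inverse (fv \<mu>) * lc \<mu> x i j * lc \<mu> y j k * lc \<mu> z k i)"
    unfolding gamma_t_def by (intro sum.cong HOL.refl sum.swap)
  also have "\<dots> = (\<Sum>\<mu>\<in>idx D. \<Sum>j<dm D \<mu>. \<Sum>k<dm D \<mu>. \<Sum>i<dm D \<mu>.
      inverse (fv \<mu>) * lc \<mu> x i j * lc \<mu> y j k * lc \<mu> z k i)"
    by (intro sum.cong HOL.refl sum.swap)
  finally show ?thesis unfolding gamma_t_def by (simp only: mult_ac)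
qed

lemma sum_n_t_gamma_right:
  assumes "x \<in> W" "z \<in> W"
  shows "(\<Sum>y\<in>W. n_t D y * gamma_t D x y (iv z)) = (if x = z then 1 else 0)"
proof -
  have "(\<Sum>y\<in>W. n_t D y * gamma_t D x y (iv z)) = (\<Sum>y\<in>W. n_t D y * gamma_t D y (iv z) (iv (iv x)))"
    using assms by (simp add: gamma_t_cyclic[of x])
  also have "\<dots> = (if iv z = iv x then 1 else 0)" using assms by (intro sum_n_t_gamma_left) auto
  finally show ?thesis using iv_eq_iff[OF assms] iv_eq_iff[OF assms(2,1)] by auto
qed

section \<open>Leading coefficients and two-sided cells\<close>

definition repf :: "'i \<Rightarrow> ('w \<Rightarrow> 'g cgr) \<Rightarrow> nat \<Rightarrow> nat \<Rightarrow> 'g cgrf" where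
  "repf \<mu> f i j = (\<Sum>w\<in>W. to_fract (f w) * rep \<mu> w i j)"

lemma repf_mult:
  assumes \<mu>: "\<mu> \<in> idx D" and ij: "i < dm D \<mu>" "j < dm D \<mu>"
  shows "(\<Sum>l<dm D \<mu>. repf \<mu> f i l * repf \<mu> g l j) = repf \<mu> (f \<bullet> g) i j"
proof -
  have "(\<Sum>l<dm D \<mu>. repf \<mu> f i l * repf \<mu> g l j) =
      (\<Sum>l<dm D \<mu>. \<Sum>x\<in>W. \<Sum>y\<in>W. to_fract (f x * g y) * (rep \<mu> x i l * rep \<mu> y l j))"
    unfolding repf_def sum_product to_fract_mult by (simp only: mult_ac)
  also have "\<dots> = (\<Sum>x\<in>W. \<Sum>l<dm D \<mu>. \<Sum>y\<in>W. to_fract (f x * g y) * (rep \<mu> x i l * rep \<mu> y l j))"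
    by (rule sum.swap)
  also have "\<dots> = (\<Sum>x\<in>W. \<Sum>y\<in>W. \<Sum>l<dm D \<mu>. to_fract (f x * g y) * (rep \<mu> x i l * rep \<mu> y l j))"
    by (intro sum.cong HOL.refl sum.swap)
  also have "\<dots> = (\<Sum>x\<in>W. \<Sum>y\<in>W. \<Sum>z\<in>W. to_fract (f x * g y * m x y z) * rep \<mu> z i j)"
    using rep_mult[OF \<mu> ij] by (intro sum.cong HOL.refl) (simp add: sum_distrib_left[symmetric], simp add: sum_distrib_left mult.assoc)
  also have "\<dots> = (\<Sum>x\<in>W. \<Sum>z\<in>W. \<Sum>y\<in>W. to_fract (f x * g y * m x y z) * rep \<mu> z i j)"
    by (intro sum.cong HOL.refl sum.swap)
  also have "\<dots> = (\<Sum>z\<in>W. \<Sum>x\<in>W. \<Sum>y\<in>W. to_fract (f x * g y * m x y z) * rep \<mu> z i j)"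
    by (rule sum.swap)
  also have "\<dots> = repf \<mu> (f \<bullet> g) i j"
    unfolding repf_def hm_eq by (intro sum.cong HOL.refl) (simp only: if_True to_fract_sum sum_distrib_right)
  finally show ?thesis .
qed

text \<open>Terms of positive exponent disappear from the constant term, so any element congruent to
  (-1)^{l(x)} T_x modulo such terms has the leading coefficients of T_x. It is applied both to C_x
  and to the dual basis.\<close>

lemma repf_has_const:
  assumes \<mu>: "\<mu> \<in> idx D" and ij: "i < dm D \<mu>" "j < dm D \<mu>" and x: "x \<in> W"
    and f: "\<And>w. w \<in> W \<Longrightarrow> f w - sg x * T x w \<in> pos_gr"
  shows "has_const (E \<mu> * repf \<mu> f i j) (lc \<mu> x i j)"
proof -
  let ?c = "\<lambda>w. if w = x then (- 1) ^ len D x else 0 :: complex"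
  have c: "has_const (to_fract (f w)) (?c w)" if "w \<in> W" for w
  proof -
    have p: "\<forall>g\<in>supp (f w - sg x * T x w). g > 0" using f[OF that] by (simp add: pos_gr_iff)
    have "has_const (to_fract (f w - sg x * T x w)) 0"
      using has_const_to_fract[of "f w - sg x * T x w"] coeff_at_0_pos[OF p] p
      by (simp add: less_imp_le del: to_fract_diff)
    moreover have "has_const (to_fract (sg x * T x w)) (?c w)"
    proof -
      have "to_fract ((- 1) ^ n) = ((- 1) ^ n :: 'g cgrf)" for n by (induction n) auto
      then show ?thesis by (simp add: bas_def has_const_neg_one_power)
    qed
    ultimately have "has_const (to_fract (f w - sg x * T x w) + to_fract (sg x * T x w)) (0 + ?c w)"
      by (rule has_const_add)
    then show ?thesis by simp
  qed
  have "has_const (\<Sum>w\<in>W. to_fract (f w) * (E \<mu> * rep \<mu> w i j)) (\<Sum>w\<in>W. ?c w * ((- 1) ^ len D w * lc \<mu> w i j))"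
    using assms c by (intro has_const_sum has_const_mult rep_has_const) auto
  moreover have "(\<Sum>w\<in>W. to_fract (f w) * (E \<mu> * rep \<mu> w i j)) = E \<mu> * repf \<mu> f i j"
    unfolding repf_def sum_distrib_left by (simp only: mult_ac)
  moreover have "(\<Sum>w\<in>W. ?c w * ((- 1) ^ len D w * lc \<mu> w i j)) = (\<Sum>w\<in>W. if w = x then lc \<mu> x i j else 0)"
    by (intro sum.cong HOL.refl) (simp flip: mult.assoc power_mult_distrib)
  ultimately show ?thesis using x by simp
qed

lemma KL_lead: "x \<in> W \<Longrightarrow> w \<in> W \<Longrightarrow> C x w - sg x * T x w \<in> pos_gr"
  using KL_diag[of x] KL_pos[of x w] by (auto simp: bas_def)

text \<open>If \<open>y^{-1} \<le> x\<close> fails, then \<open>C_x h\<close> annihilates the dual element of \<open>C_{y^{-1}}\<close> for all \<open>h\<close>.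
  As the image of a representation is a full matrix algebra, one of the two elements acts as zero.\<close>

lemma lead_coef_le:
  assumes \<mu>: "\<mu> \<in> idx D" and xy: "x \<in> W" "y \<in> W"
    and ij: "i < dm D \<mu>" "j < dm D \<mu>" "lc \<mu> x i j \<noteq> 0"
    and kl: "k < dm D \<mu>" "l < dm D \<mu>" "lc \<mu> y k l \<noteq> 0"
  shows "le (iv y) x"
proof (rule ccontr)
  assume not: "\<not> le (iv y) x"
  let ?d = "dm D \<mu>" and ?X = "repf \<mu> (C x)" and ?Y = "repf \<mu> (KL_dual y)"
  have nz: "?X i j \<noteq> 0" "?Y k l \<noteq> 0"
    using repf_has_const[OF \<mu> ij(1,2) xy(1) KL_lead[OF xy(1)]]
      repf_has_const[OF \<mu> kl(1,2) xy(2) KL_dual_pos[OF xy(2)]] ij(3) kl(3)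
    by (auto dest: has_const_unique[OF _ has_const_0])
  have repT: "repf \<mu> (T u) p q = rep \<mu> u p q" if "u \<in> W" for u p q
  proof -
    have "to_fract (T u w) = bas u w" for w by (simp add: bas_def)
    then show ?thesis using that by (simp add: repf_def sum_mult_bas)
  qed
  have zero: "(\<Sum>q<?d. \<Sum>p<?d. ?X i p * rep \<mu> u p q * ?Y q l) = 0" if u: "u \<in> W" for u
  proof -
    have "(C x \<bullet> T u) \<bullet> KL_dual y = (\<lambda>_. 0)"
      using xy u not below_mult(1)[OF below_KL[OF xy(1)], of "T u"] by (intro mult_KL_dual) auto
    then have "repf \<mu> ((C x \<bullet> T u) \<bullet> KL_dual y) i l = 0" by (simp add: repf_def)
    then have "(\<Sum>q<?d. repf \<mu> (C x \<bullet> T u) i q * ?Y q l) = 0"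
      by (simp add: repf_mult[OF \<mu> ij(1) kl(2), symmetric])
    moreover have "repf \<mu> (C x \<bullet> T u) i q = (\<Sum>p<?d. ?X i p * rep \<mu> u p q)" if "q < ?d" for q
      using repf_mult[OF \<mu> ij(1) that, of "C x" "T u"] repT[OF u] by simp
    ultimately show ?thesis by (simp add: sum_distrib_right)
  qed
  obtain s where s: "s \<noteq> 0" "schur_sum \<mu> \<mu> 0 0 0 0 = s"
    using schur_element[OF \<mu>] by (metis to_fract_eq_0_iff)
  \<comment> \<open>Weighting the vanishing products by the matrix coefficient (k, j) of T_{u^{-1}}
    and summing over u selects, by the Schur relations, the single product X_ij Y_kl.\<close>
  have "0 = (\<Sum>u\<in>W. (\<Sum>q<?d. \<Sum>p<?d. ?X i p * rep \<mu> u p q * ?Y q l) * rep \<mu> (iv u) k j)"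
    using zero by simp
  also have "\<dots> = (\<Sum>u\<in>W. \<Sum>q<?d. \<Sum>p<?d. ?X i p * ?Y q l * (rep \<mu> u p q * rep \<mu> (iv u) k j))"
    unfolding sum_distrib_right by (simp only: mult_ac)
  also have "\<dots> = (\<Sum>q<?d. \<Sum>u\<in>W. \<Sum>p<?d. ?X i p * ?Y q l * (rep \<mu> u p q * rep \<mu> (iv u) k j))"
    by (rule sum.swap)
  also have "\<dots> = (\<Sum>q<?d. \<Sum>p<?d. \<Sum>u\<in>W. ?X i p * ?Y q l * (rep \<mu> u p q * rep \<mu> (iv u) k j))"
    by (intro sum.cong HOL.refl sum.swap)
  also have "\<dots> = (\<Sum>q<?d. \<Sum>p<?d. ?X i p * ?Y q l * schur_sum \<mu> \<mu> p q k j)"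
    by (simp only: schur_sum_def sum_distrib_left)
  also have "\<dots> = (\<Sum>q<?d. \<Sum>p<?d. if p = j then if q = k then ?X i j * ?Y k l * s else 0 else 0)"
  proof (intro sum.cong HOL.refl)
    fix q p assume "q \<in> {..<?d}" "p \<in> {..<?d}"
    then have pq: "p < ?d" "q < ?d" by auto
    show "?X i p * ?Y q l * schur_sum \<mu> \<mu> p q k j = (if p = j then if q = k then ?X i j * ?Y k l * s else 0 else 0)"
      unfolding schur_sum_same[OF \<mu> pq kl(1) ij(2)] s(2) by simp
  qed
  also have "\<dots> = ?X i j * ?Y k l * s" using ij kl by simp
  finally show False using nz s by simp
qed

lemma ex_lead_coef:
  assumes "w \<in> W"
  obtains \<mu> i j where "\<mu> \<in> idx D" "i < dm D \<mu>" "j < dm D \<mu>" "lc \<mu> w i j \<noteq> 0"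
proof -
  have "(\<Sum>\<mu>\<in>idx D. \<Sum>i<dm D \<mu>. \<Sum>j<dm D \<mu>. inverse (fv \<mu>) * lc \<mu> w i j * lc \<mu> (iv w) j i) \<noteq> 0"
    using column_orthogonality[OF assms assms] by simp
  then obtain \<mu> i j where "\<mu> \<in> idx D" "i \<in> {..<dm D \<mu>}" "j \<in> {..<dm D \<mu>}"
    "inverse (fv \<mu>) * lc \<mu> w i j * lc \<mu> (iv w) j i \<noteq> 0"
    by (elim sum_nonzeroE)
  then show ?thesis using that by auto
qed

text \<open>One nonzero leading coefficient of v may be used for both arguments of
  \<open>lead_coef_le\<close>, which gives v^{-1} below v; the same for v^{-1} gives the
  converse.\<close>

lemma sim_iv: assumes "w \<in> W" shows "sim w (iv w)"
proof -
  have le: "le (iv v) v" if v: "v \<in> W" for v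
    by (rule ex_lead_coef[OF v]) (blast intro: lead_coef_le v)
  show ?thesis using le[of w] le[of "iv w"] assms by (simp add: sim_LR_def)
qed

lemma lead_coef_sim:
  assumes \<mu>: "\<mu> \<in> idx D" and xy: "x \<in> W" "y \<in> W"
    and ij: "i < dm D \<mu>" "j < dm D \<mu>" "lc \<mu> x i j \<noteq> 0"
    and kl: "k < dm D \<mu>" "l < dm D \<mu>" "lc \<mu> y k l \<noteq> 0"
  shows "sim x y"
proof -
  have "le (iv y) x" "le (iv x) y" using lead_coef_le assms by blast+
  then have "le y x" "le x y"
    using sim_iv[OF xy(1)] sim_iv[OF xy(2)] le_trans unfolding sim_LR_def by blast+
  then show ?thesis by (simp add: sim_LR_def)
qed

text \<open>A nonzero structure constant has a nonzero summand, in which all three leading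
  coefficients belong to one representation. The inverse in the third place is harmless by
  \<open>sim_iv\<close>.\<close>

lemma gamma_sim:
  assumes "x \<in> W" "y \<in> W" "z \<in> W" "gamma_t D x y (iv z) \<noteq> 0"
  shows "sim x y" "sim x z"
proof -
  from assms(4) obtain \<mu> i j k where \<mu>: "\<mu> \<in> idx D"
    and ijk: "i \<in> {..<dm D \<mu>}" "j \<in> {..<dm D \<mu>}" "k \<in> {..<dm D \<mu>}"
    and nz: "inverse (fv \<mu>) * lc \<mu> x i j * lc \<mu> y j k * lc \<mu> (iv z) k i \<noteq> 0"
    unfolding gamma_t_def by (elim sum_nonzeroE)
  show "sim x y" using lead_coef_sim[OF \<mu> assms(1,2)] ijk nz by auto
  have "sim x (iv z)" using lead_coef_sim[OF \<mu> assms(1), of "iv z"] assms(3) ijk nz by auto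
  then show "sim x z" using sim_iv[OF assms(3)] sim_sym sim_trans by blast
qed

section \<open>Integrality of the identity of J\<close>

lemma const_in_base:
  assumes "has_const (E \<mu> ^ n * to_fract p) ((- 1) ^ l * c)" "p \<in> ringA D" shows "c \<in> base D"
proof -
  have e: "eps (aval D \<mu>) ^ n * p \<in> ringA D"
    using assms(2) by auto
  have "E \<mu> ^ n = to_fract (eps (aval D \<mu>) ^ n)" by (induction n) auto
  then have "has_const (to_fract (eps (aval D \<mu>) ^ n * p)) ((- 1) ^ l * c)" using assms(1) by simp
  from has_const_to_fractD[OF this] have "(- 1) ^ l * c \<in> base D"
    using e by (simp add: ringA_def group_ring_def)
  then show ?thesis using R.uminus_closed[of "- c"] by (cases "even l") auto
qed

lemma rep_trace:
  assumes "\<mu> \<in> idx D"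
  obtains \<chi> where "\<And>w. w \<in> W \<Longrightarrow> \<chi> w \<in> ringA D" "\<And>w. w \<in> W \<Longrightarrow> (\<Sum>i<dm D \<mu>. rep \<mu> w i i) = to_fract (\<chi> w)"
proof -
  have "\<forall>w\<in>W. \<exists>\<chi>. \<chi> \<in> ringA D \<and> (\<Sum>i<dm D \<mu>. rep \<mu> w i i) = to_fract \<chi>"
  proof
    fix w assume w: "w \<in> W"
    have "specialises D \<mu>" using setting assms by (simp add: hecke_setting_def)
    then obtain \<chi> where "\<chi> \<in> ringA D" "mat_trace (irrH D \<mu> (bas w)) = to_fract \<chi>"
      using w unfolding specialises_def by blast
    moreover have "mat_trace (irrH D \<mu> (bas w)) = (\<Sum>i<dm D \<mu>. rep \<mu> w i i)"
      using irrH_carrier(1)[OF assms bas_HK[OF w]] by (simp add: mat_trace_def rep_def)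
    ultimately show "\<exists>\<chi>. \<chi> \<in> ringA D \<and> (\<Sum>i<dm D \<mu>. rep \<mu> w i i) = to_fract \<chi>" by auto
  qed
  from bchoice[OF this] show ?thesis using that by blast
qed

text \<open>A single matrix coefficient lies in K, but the trace of T_w lies in A. The constant term
  of an element of A is one of its coefficients, hence lies in R.\<close>

lemma lead_trace_base:
  assumes \<mu>: "\<mu> \<in> idx D" and w: "w \<in> W" shows "(\<Sum>i<dm D \<mu>. lc \<mu> w i i) \<in> base D"
proof -
  obtain \<chi> where \<chi>: "\<And>w. w \<in> W \<Longrightarrow> \<chi> w \<in> ringA D"
    "\<And>w. w \<in> W \<Longrightarrow> (\<Sum>i<dm D \<mu>. rep \<mu> w i i) = to_fract (\<chi> w)"
    using rep_trace[OF \<mu>] by blast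
  have "has_const (\<Sum>i<dm D \<mu>. E \<mu> * rep \<mu> w i i) (\<Sum>i<dm D \<mu>. (- 1) ^ len D w * lc \<mu> w i i)"
    using \<mu> w by (intro has_const_sum rep_has_const) auto
  then have "has_const (E \<mu> ^ 1 * to_fract (\<chi> w)) ((- 1) ^ len D w * (\<Sum>i<dm D \<mu>. lc \<mu> w i i))"
    using \<chi>(2)[OF w] by (simp flip: sum_distrib_left)
  then show ?thesis using const_in_base \<chi>(1)[OF w] by blast
qed

lemma n_t_base:
  assumes "L_good D" "w \<in> W" shows "n_t D w \<in> base D"
proof -
  have "n_t D w = (\<Sum>\<mu>\<in>idx D. inverse (fv \<mu>) * (\<Sum>i<dm D \<mu>. lc \<mu> (iv w) i i))"
    by (simp only: n_t_def sum_distrib_left)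
  also have "\<dots> \<in> base D"
    using assms lead_trace_base by (rule_tac R.sum_closed, rule_tac R.mult_closed) (auto simp: L_good_def)
  finally show ?thesis .
qed

end

section \<open>The homomorphism\<close>

context hecke_ctx
begin

section \<open>The graded action and right multiplication in J\<close>

abbreviation \<gamma> :: "'w \<Rightarrow> 'w \<Rightarrow> 'w \<Rightarrow> 'g cgr" where
  "\<gamma> x y z \<equiv> const_gr (gamma_t D x y (iv z))"

abbreviation jm (infixl "\<diamond>" 70) where "j \<diamond> k \<equiv> j \<otimes>\<^bsub>J_A D\<^esub> k"

definition hs :: "'w \<Rightarrow> 'w \<Rightarrow> 'w \<Rightarrow> 'g cgr" where
  "hs x y z = (if sim z y then hc x y z else 0)"

text \<open>Left multiplication by \<open>f\<close> on the graded module of the filtration by two-sided cells.\<close>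

definition gr_mat :: "('w \<Rightarrow> 'g cgr) \<Rightarrow> 'w \<Rightarrow> 'w \<Rightarrow> 'g cgr" where
  "gr_mat f z y = (\<Sum>x\<in>W. kc f x * hs x y z)"

definition gr_act :: "('w \<Rightarrow> 'g cgr) \<Rightarrow> ('w \<Rightarrow> 'g cgr) \<Rightarrow> 'w \<Rightarrow> 'g cgr" where
  "gr_act f j = (\<lambda>z. if z \<in> W then \<Sum>y\<in>W. gr_mat f z y * j y else 0)"

text \<open>The matrix of right multiplication by k in J. With the action also given by a matrix,
  their compatibility becomes the commuting of two matrices.\<close>

definition rmul_mat :: "('w \<Rightarrow> 'g cgr) \<Rightarrow> 'w \<Rightarrow> 'w \<Rightarrow> 'g cgr" where
  "rmul_mat k z a = (\<Sum>b\<in>W. k b * \<gamma> a b z)"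

abbreviation J1 where "J1 \<equiv> \<one>\<^bsub>J_A D\<^esub>"

lemma carrier_J: "carrier (J_A D) = cH"
  by (simp add: J_A_def hecke_def basis_algebra_def)

lemma J_add: "j \<oplus>\<^bsub>J_A D\<^esub> k = (\<lambda>z. j z + k z)"
  and J_smult: "a \<odot>\<^bsub>J_A D\<^esub> j = (\<lambda>z. a * j z)"
  by (simp_all add: J_A_def basis_algebra_def)

lemma jm_eq: "j \<diamond> k = (\<lambda>z. if z \<in> W then \<Sum>a\<in>W. rmul_mat k z a * j a else 0)"
proof
  fix z
  have "(\<Sum>a\<in>W. \<Sum>b\<in>W. j a * k b * \<gamma> a b z) = (\<Sum>a\<in>W. rmul_mat k z a * j a)"
    unfolding rmul_mat_def sum_distrib_right by (simp only: mult_ac)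
  then show "(j \<diamond> k) z = (if z \<in> W then \<Sum>a\<in>W. rmul_mat k z a * j a else 0)"
    by (simp add: J_A_def basis_algebra_def)
qed

lemma J1_eq: "J1 = (\<lambda>u. if u \<in> W then const_gr (n_t D u) else 0)"
proof
  fix u
  have "J1 u = (\<Sum>w\<in>D_t D. const_gr (n_t D w) * bas w u)" by (simp add: J_A_def basis_algebra_def)
  also have "\<dots> = (if u \<in> D_t D then const_gr (n_t D u) else 0)"
    by (rule sum_mult_bas(1)) (simp add: D_t_def)
  finally show "J1 u = (if u \<in> W then const_gr (n_t D u) else 0)" by (auto simp: D_t_def)
qed

lemma hs_A: "x \<in> W \<Longrightarrow> y \<in> W \<Longrightarrow> z \<in> W \<Longrightarrow> hs x y z \<in> ringA D"
  by (simp add: hs_def hc_A)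

lemma kc_A: "f \<in> cH \<Longrightarrow> x \<in> W \<Longrightarrow> kc f x \<in> ringA D"
  using kc_cH[of f] cH_iff[of "kc f"] by blast

lemma gr_act_cH: "f \<in> cH \<Longrightarrow> j \<in> cH \<Longrightarrow> gr_act f j \<in> cH"
  using cH_iff[of j] unfolding gr_act_def gr_mat_def
  by (subst cH_iff) (auto intro!: A.sum_closed A.mult_closed kc_A hs_A)

lemma J1_cH: "L_good D \<Longrightarrow> J1 \<in> cH"
  unfolding cH_iff J1_eq using n_t_base
  by (auto simp: ringA_def intro!: const_gr_in_group_ring R.closed_ring_axioms)

text \<open>If z and w share a cell, any u lying between them in the preorder belongs to it as well,
  so truncation loses nothing from the associativity of H. Otherwise both sides are zero.\<close>

lemma hs_assoc:
  assumes "x \<in> W" "y \<in> W" "w \<in> W" "z \<in> W"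
  shows "(\<Sum>u\<in>W. hs x u z * hs y w u) = (\<Sum>u\<in>W. hc x y u * hs u w z)"
proof (cases "sim z w")
  case True
  have "hs x u z * hs y w u = hc y w u * hc x u z" if u: "u \<in> W" for u
  proof (cases "hc y w u = 0 \<or> hc x u z = 0")
    case False
    then have "le u w" "le z u" using hc_le(1) assms u by blast+
    moreover have "le w z" using True by (simp add: sim_LR_def)
    ultimately have "sim z u" "sim u w" unfolding sim_LR_def by (blast intro: le_trans)+
    then show ?thesis by (simp add: hs_def)
  qed (auto simp: hs_def)
  then have "(\<Sum>u\<in>W. hs x u z * hs y w u) = (\<Sum>u\<in>W. hc y w u * hc x u z)"
    by (intro sum.cong HOL.refl)
  then show ?thesis using hc_assoc[OF assms] True by (simp add: hs_def[of _ w z])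
next
  case False
  have "hs x u z * hs y w u = 0" for u using False sim_trans unfolding hs_def by auto
  then have "(\<Sum>u\<in>W. hs x u z * hs y w u) = 0" by (intro sum.neutral ballI)
  then show ?thesis using False by (simp add: hs_def[of _ w z])
qed

lemma gr_mat_mult:
  assumes f: "f \<in> cH" and g: "g \<in> cH" and zy: "z \<in> W" "y \<in> W"
  shows "gr_mat (f \<bullet> g) z y = (\<Sum>u\<in>W. gr_mat f z u * gr_mat g u y)"
proof -
  have "gr_mat (f \<bullet> g) z y = (\<Sum>w\<in>W. \<Sum>a\<in>W. \<Sum>b\<in>W. kc f a * kc g b * (hc a b w * hs w y z))"
    unfolding gr_mat_def kc_mult[OF f g] sum_distrib_right by (simp only: mult.assoc)
  also have "\<dots> = (\<Sum>a\<in>W. \<Sum>w\<in>W. \<Sum>b\<in>W. kc f a * kc g b * (hc a b w * hs w y z))"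
    by (rule sum.swap)
  also have "\<dots> = (\<Sum>a\<in>W. \<Sum>b\<in>W. \<Sum>w\<in>W. kc f a * kc g b * (hc a b w * hs w y z))"
    by (intro sum.cong HOL.refl sum.swap)
  also have "\<dots> = (\<Sum>a\<in>W. \<Sum>b\<in>W. kc f a * kc g b * (\<Sum>u\<in>W. hs a u z * hs b y u))"
    using zy by (intro sum.cong HOL.refl) (simp only: hs_assoc sum_distrib_left)
  also have "\<dots> = (\<Sum>a\<in>W. \<Sum>b\<in>W. \<Sum>u\<in>W. (kc f a * hs a u z) * (kc g b * hs b y u))"
    unfolding sum_distrib_left by (simp only: mult_ac)
  also have "\<dots> = (\<Sum>a\<in>W. \<Sum>u\<in>W. \<Sum>b\<in>W. (kc f a * hs a u z) * (kc g b * hs b y u))"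
    by (intro sum.cong HOL.refl sum.swap)
  also have "\<dots> = (\<Sum>u\<in>W. \<Sum>a\<in>W. \<Sum>b\<in>W. (kc f a * hs a u z) * (kc g b * hs b y u))"
    by (rule sum.swap)
  finally show ?thesis by (simp only: gr_mat_def sum_product)
qed

lemma gr_act_mult:
  assumes "f \<in> cH" "g \<in> cH" shows "gr_act (f \<bullet> g) j = gr_act f (gr_act g j)"
proof
  fix z
  have "(\<Sum>y\<in>W. gr_mat (f \<bullet> g) z y * j y) = (\<Sum>u\<in>W. gr_mat f z u * (\<Sum>y\<in>W. gr_mat g u y * j y))"
    if z: "z \<in> W"
  proof -
    have "(\<Sum>y\<in>W. gr_mat (f \<bullet> g) z y * j y) = (\<Sum>y\<in>W. \<Sum>u\<in>W. gr_mat f z u * (gr_mat g u y * j y))"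
      using assms z by (simp add: gr_mat_mult sum_distrib_right mult.assoc)
    also have "\<dots> = (\<Sum>u\<in>W. \<Sum>y\<in>W. gr_mat f z u * (gr_mat g u y * j y))" by (rule sum.swap)
    finally show ?thesis by (simp only: sum_distrib_left)
  qed
  then show "gr_act (f \<bullet> g) j z = gr_act f (gr_act g j) z" by (simp add: gr_act_def)
qed

text \<open>For a and z in one cell, homogeneity of gamma makes the truncation of h automatic and
  the claim is an instance of P15. For different cells every summand on either side
  vanishes.\<close>

lemma hs_gamma_commute:
  assumes P: "P15_tilde D" and W: "x \<in> W" "a \<in> W" "b \<in> W" "z \<in> W"
  shows "(\<Sum>u\<in>W. hs x u z * \<gamma> a b u) = (\<Sum>u\<in>W. \<gamma> u b z * hs x a u)"
proof (cases "sim a z")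
  case True
  have l: "hs x u z * \<gamma> a b u = \<gamma> a b u * hc x u z" if u: "u \<in> W" for u
  proof (cases "gamma_t D a b (iv u) = 0")
    case False
    then have "sim a u" using gamma_sim(2) W u by blast
    then have "sim z u" using True sim_sym sim_trans by blast
    then show ?thesis by (simp add: hs_def)
  qed simp
  have r: "\<gamma> u b z * hs x a u = hc x a u * \<gamma> u b z" if u: "u \<in> W" for u
  proof (cases "gamma_t D u b (iv z) = 0")
    case False
    then have "sim u z" using gamma_sim(2) W u by blast
    then have "sim u a" using True sim_sym sim_trans by blast
    then show ?thesis by (simp add: hs_def)
  qed simp
  have "(\<Sum>u\<in>W. hs x u z * \<gamma> a b u) = (\<Sum>u\<in>W. \<gamma> a b u * hc x u z)"
    by (intro sum.cong HOL.refl l)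
  also have "\<dots> = (\<Sum>u\<in>W. hc x a u * \<gamma> u b z)"
    using P W True unfolding P15_tilde_def by blast
  also have "\<dots> = (\<Sum>u\<in>W. \<gamma> u b z * hs x a u)"
    by (intro sum.cong HOL.refl r[symmetric])
  finally show ?thesis .
next
  case False
  have l: "hs x u z * \<gamma> a b u = 0" if u: "u \<in> W" for u
  proof (cases "gamma_t D a b (iv u) = 0")
    case nz: False
    then have "sim a u" using gamma_sim(2) W u by blast
    then have "\<not> sim z u" using False sim_sym sim_trans by blast
    then show ?thesis by (simp add: hs_def)
  qed simp
  have r: "\<gamma> u b z * hs x a u = 0" if u: "u \<in> W" for u
  proof (cases "gamma_t D u b (iv z) = 0")
    case nz: False
    then have "sim u z" using gamma_sim(2) W u by blast
    then have "\<not> sim u a" using False sim_sym sim_trans by blast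
    then show ?thesis by (simp add: hs_def)
  qed simp
  have "(\<Sum>u\<in>W. hs x u z * \<gamma> a b u) = 0" by (intro sum.neutral ballI l)
  also have "0 = (\<Sum>u\<in>W. \<gamma> u b z * hs x a u)"
    by (intro sum.neutral[symmetric] ballI r)
  finally show ?thesis .
qed

text \<open>Bilinear extension of \<open>hs_gamma_commute\<close>, which states that the two
  matrices commute when f and k are basis elements.\<close>

lemma gr_act_jm:
  assumes P: "P15_tilde D" shows "gr_act f (j \<diamond> k) = gr_act f j \<diamond> k"
proof
  have comm: "(\<Sum>u\<in>W. gr_mat f z u * rmul_mat k u a) = (\<Sum>u\<in>W. rmul_mat k z u * gr_mat f u a)"
    if za: "z \<in> W" "a \<in> W" for z a
  proof -
    have "(\<Sum>u\<in>W. gr_mat f z u * rmul_mat k u a) =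
        (\<Sum>u\<in>W. \<Sum>x\<in>W. \<Sum>b\<in>W. kc f x * k b * (hs x u z * \<gamma> a b u))"
      unfolding gr_mat_def rmul_mat_def sum_product by (simp only: mult_ac)
    also have "\<dots> = (\<Sum>x\<in>W. \<Sum>u\<in>W. \<Sum>b\<in>W. kc f x * k b * (hs x u z * \<gamma> a b u))"
      by (rule sum.swap)
    also have "\<dots> = (\<Sum>x\<in>W. \<Sum>b\<in>W. \<Sum>u\<in>W. kc f x * k b * (hs x u z * \<gamma> a b u))"
      by (intro sum.cong HOL.refl sum.swap)
    also have "\<dots> = (\<Sum>x\<in>W. \<Sum>b\<in>W. kc f x * k b * (\<Sum>u\<in>W. \<gamma> u b z * hs x a u))"
      using za by (intro sum.cong HOL.refl) (simp only: hs_gamma_commute[OF P, symmetric] sum_distrib_left)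
    also have "\<dots> = (\<Sum>x\<in>W. \<Sum>b\<in>W. \<Sum>u\<in>W. (k b * \<gamma> u b z) * (kc f x * hs x a u))"
      unfolding sum_distrib_left by (simp only: mult_ac)
    also have "\<dots> = (\<Sum>b\<in>W. \<Sum>x\<in>W. \<Sum>u\<in>W. (k b * \<gamma> u b z) * (kc f x * hs x a u))"
      by (rule sum.swap)
    also have "\<dots> = (\<Sum>b\<in>W. \<Sum>u\<in>W. \<Sum>x\<in>W. (k b * \<gamma> u b z) * (kc f x * hs x a u))"
      by (intro sum.cong HOL.refl sum.swap)
    also have "\<dots> = (\<Sum>u\<in>W. \<Sum>b\<in>W. \<Sum>x\<in>W. (k b * \<gamma> u b z) * (kc f x * hs x a u))"
      by (rule sum.swap)
    finally show ?thesis by (simp only: gr_mat_def rmul_mat_def sum_product)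
  qed
  fix z
  have "(\<Sum>u\<in>W. gr_mat f z u * (\<Sum>a\<in>W. rmul_mat k u a * j a)) =
      (\<Sum>u\<in>W. rmul_mat k z u * (\<Sum>a\<in>W. gr_mat f u a * j a))" if z: "z \<in> W"
  proof -
    have "(\<Sum>u\<in>W. gr_mat f z u * (\<Sum>a\<in>W. rmul_mat k u a * j a)) =
        (\<Sum>u\<in>W. \<Sum>a\<in>W. gr_mat f z u * rmul_mat k u a * j a)"
      by (simp only: sum_distrib_left mult.assoc)
    also have "\<dots> = (\<Sum>a\<in>W. (\<Sum>u\<in>W. gr_mat f z u * rmul_mat k u a) * j a)"
      by (subst sum.swap) (simp only: sum_distrib_right)
    also have "\<dots> = (\<Sum>a\<in>W. (\<Sum>u\<in>W. rmul_mat k z u * gr_mat f u a) * j a)"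
      using comm z by simp
    also have "\<dots> = (\<Sum>u\<in>W. \<Sum>a\<in>W. rmul_mat k z u * gr_mat f u a * j a)"
      by (subst sum.swap) (simp only: sum_distrib_right)
    finally show ?thesis by (simp only: sum_distrib_left mult.assoc)
  qed
  then show "gr_act f (j \<diamond> k) z = (gr_act f j \<diamond> k) z" by (simp add: gr_act_def jm_eq)
qed

lemma J1_jm: assumes "k \<in> cH" shows "J1 \<diamond> k = k"
proof
  fix z
  show "(J1 \<diamond> k) z = k z"
  proof (cases "z \<in> W")
    case True
    have "(J1 \<diamond> k) z = (\<Sum>a\<in>W. rmul_mat k z a * const_gr (n_t D a))"
      using True by (simp add: jm_eq J1_eq)
    also have "\<dots> = (\<Sum>a\<in>W. \<Sum>b\<in>W. k b * const_gr (n_t D a * gamma_t D a b (iv z)))"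
      unfolding rmul_mat_def sum_distrib_right const_gr_simps by (simp only: mult_ac)
    also have "\<dots> = (\<Sum>b\<in>W. k b * const_gr (\<Sum>a\<in>W. n_t D a * gamma_t D a b (iv z)))"
      by (subst sum.swap) (simp only: const_gr_sum sum_distrib_left)
    also have "\<dots> = (\<Sum>b\<in>W. if b = z then k b else 0)"
      using True by (intro sum.cong HOL.refl) (simp add: sum_n_t_gamma_left)
    finally show ?thesis using True by simp
  next
    case False
    then show ?thesis using assms by (simp add: jm_eq cH_iff)
  qed
qed

lemma jm_J1: assumes "j \<in> cH" shows "j \<diamond> J1 = j"
proof
  fix z
  show "(j \<diamond> J1) z = j z"
  proof (cases "z \<in> W")
    case True
    have "rmul_mat J1 z a = (if a = z then 1 else 0)" if "a \<in> W" for a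
    proof -
      have "rmul_mat J1 z a = const_gr (\<Sum>b\<in>W. n_t D b * gamma_t D a b (iv z))"
        by (simp add: rmul_mat_def J1_eq const_gr_sum)
      then show ?thesis using that True by (simp add: sum_n_t_gamma_right)
    qed
    then show ?thesis using True by (simp add: jm_eq if_distrib[of "\<lambda>c. c * _"] cong: if_cong)
  next
    case False
    then show ?thesis using assms by (simp add: jm_eq cH_iff)
  qed
qed

section \<open>The candidate homomorphism\<close>

lemma KL_one: "C e = T e"
proof
  fix z show "C e z = T e z"
  proof (cases "z \<in> W")
    case True
    then show ?thesis using KL_diag[of e] KL_top[of e z] by (auto simp: bas_def)
  next
    case False
    then show ?thesis using KL_cH[of e] T_cH[of e] unfolding cH_iff by auto
  qed
qed

lemma gr_act_one: assumes "j \<in> cH" shows "gr_act (T e) j = j"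
proof
  fix z
  show "gr_act (T e) j z = j z"
  proof (cases "z \<in> W")
    case True
    have "gr_mat (T e) z y = (if y = z then 1 else 0)" if y: "y \<in> W" for y
    proof -
      have "kc (T e) = T e" using kc_KL[of e] by (simp add: KL_one)
      then have "gr_mat (T e) z y = hs e y z" by (simp add: gr_mat_def sum_mult_bas)
      moreover have "hc e y z = T y z" using y by (simp add: hcoef_def KL_one kc_KL)
      ultimately show ?thesis by (auto simp: hs_def bas_def)
    qed
    then show ?thesis using True by (simp add: gr_act_def if_distrib[of "\<lambda>c. c * _"] cong: if_cong)
  next
    case False
    then show ?thesis using assms by (simp add: gr_act_def cH_iff)
  qed
qed

lemma gr_act_bas: "w \<in> W \<Longrightarrow> gr_act h (bas w) = (\<lambda>z. if z \<in> W then gr_mat h z w else 0)"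
  by (auto simp: gr_act_def sum_mult_bas fun_eq_iff)

lemma act_bas: "w \<in> W \<Longrightarrow> act D h (bas w) z = (\<Sum>x\<in>W. kc h x * hc x w z)"
  by (simp add: act_def bas_def if_distrib[of "\<lambda>c. _ * c"] if_distrib[of "\<lambda>c. c * _"] cong: if_cong)

text \<open>The map h to h * 1, restricted so that it is the extensional representative demanded by
  the uniqueness statement.\<close>

definition \<Phi> :: "('w \<Rightarrow> 'g cgr) \<Rightarrow> 'w \<Rightarrow> 'g cgr" where
  "\<Phi> = restrict (\<lambda>h. gr_act h J1) cH"

lemma gr_act_lin:
  assumes "\<And>i. i \<in> I \<Longrightarrow> a i \<in> ringA D \<and> f i \<in> cH"
  shows "gr_act (\<lambda>u. \<Sum>i\<in>I. a i * f i u) j = (\<lambda>z. \<Sum>i\<in>I. a i * gr_act (f i) j z)"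
proof
  fix z
  have mat: "gr_mat (\<lambda>u. \<Sum>i\<in>I. a i * f i u) z y = (\<Sum>i\<in>I. a i * gr_mat (f i) z y)" for y
  proof -
    have kc: "kc (\<lambda>u. \<Sum>i\<in>I. a i * f i u) = (\<lambda>z. \<Sum>i\<in>I. a i * kc (f i) z)"
      by (rule kc_sum) (rule assms)
    have "gr_mat (\<lambda>u. \<Sum>i\<in>I. a i * f i u) z y = (\<Sum>x\<in>W. \<Sum>i\<in>I. a i * (kc (f i) x * hs x y z))"
      unfolding gr_mat_def kc sum_distrib_right by (simp only: mult.assoc)
    also have "\<dots> = (\<Sum>i\<in>I. \<Sum>x\<in>W. a i * (kc (f i) x * hs x y z))" by (rule sum.swap)
    finally show ?thesis by (simp only: gr_mat_def sum_distrib_left)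
  qed
  have "(\<Sum>y\<in>W. gr_mat (\<lambda>u. \<Sum>i\<in>I. a i * f i u) z y * j y) = (\<Sum>i\<in>I. a i * (\<Sum>y\<in>W. gr_mat (f i) z y * j y))"
  proof -
    have "(\<Sum>y\<in>W. gr_mat (\<lambda>u. \<Sum>i\<in>I. a i * f i u) z y * j y) = (\<Sum>y\<in>W. \<Sum>i\<in>I. a i * (gr_mat (f i) z y * j y))"
      unfolding mat sum_distrib_right by (simp only: mult.assoc)
    also have "\<dots> = (\<Sum>i\<in>I. \<Sum>y\<in>W. a i * (gr_mat (f i) z y * j y))" by (rule sum.swap)
    finally show ?thesis by (simp only: sum_distrib_left)
  qed
  then show "gr_act (\<lambda>u. \<Sum>i\<in>I. a i * f i u) j z = (\<Sum>i\<in>I. a i * gr_act (f i) j z)"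
    by (simp add: gr_act_def)
qed

lemma \<Phi>_hom:
  assumes P: "P15_tilde D" and good: "L_good D" shows "unital_A_alg_hom D \<Phi>"
  unfolding unital_A_alg_hom_def
proof (intro conjI ballI)
  note J1 = J1_cH[OF good]
  show "\<Phi> \<in> Ring.ring_hom (hecke D) (J_A D)"
  proof (rule ring_hom_memI)
    fix f assume f: "f \<in> cH"
    show "\<Phi> f \<in> carrier (J_A D)" using f J1 by (simp add: \<Phi>_def carrier_J gr_act_cH)
    fix g assume g: "g \<in> cH"
    \<comment> \<open>Inserting the identity of J in front of g * 1 allows f to act on that identity
      alone, because the action commutes with right multiplication.\<close>
    have "gr_act (f \<bullet> g) J1 = gr_act f (J1 \<diamond> gr_act g J1)"
      using f g J1 by (simp add: gr_act_mult J1_jm gr_act_cH)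
    also have "\<dots> = gr_act f J1 \<diamond> gr_act g J1" by (rule gr_act_jm[OF P])
    finally show "\<Phi> (f \<bullet> g) = \<Phi> f \<diamond> \<Phi> g" using f g by (simp add: \<Phi>_def)
    have "gr_act (\<lambda>u. f u + g u) J1 = (\<lambda>z. gr_act f J1 z + gr_act g J1 z)"
      using gr_act_lin[of "{True, False}" "\<lambda>_. 1" "\<lambda>b. if b then f else g" J1] f g by simp
    then show "\<Phi> (f \<oplus>\<^bsub>hecke D\<^esub> g) = \<Phi> f \<oplus>\<^bsub>J_A D\<^esub> \<Phi> g"
      using f g cH_add[OF f g] by (simp add: \<Phi>_def hecke_add J_add)
  next
    show "\<Phi> \<one>\<^bsub>hecke D\<^esub> = J1" using J1 by (simp add: \<Phi>_def hecke_one gr_act_one)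
  qed
  fix a h assume a: "a \<in> ringA D" and h: "h \<in> cH"
  have "gr_act (\<lambda>u. a * h u) J1 = (\<lambda>z. a * gr_act h J1 z)"
    using gr_act_lin[of "{()}" "\<lambda>_. a" "\<lambda>_. h" J1] a h by simp
  then show "\<Phi> (a \<odot>\<^bsub>hecke D\<^esub> h) = a \<odot>\<^bsub>J_A D\<^esub> \<Phi> h"
    using a h cH_smult[OF a h] by (simp add: \<Phi>_def hecke_smult J_smult)
qed

lemma \<Phi>_agrees:
  assumes P: "P15_tilde D" and good: "L_good D" shows "agrees_with_action_mod_lower D \<Phi>"
  unfolding agrees_with_action_mod_lower_def
proof (intro ballI)
  fix h w assume h: "h \<in> cH" and w: "w \<in> W"
  let ?L = "{y \<in> W. le y w \<and> \<not> sim y w}"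
  \<comment> \<open>The part of h.t_w in strictly lower cells, negated: \<open>\<Phi> h\<close>
    retains only the part in the cell of w.\<close>
  define c where "c y = (if y \<in> ?L then - (\<Sum>x\<in>W. kc h x * hc x w y) else 0)" for y
  have "\<Phi> h \<diamond> bas w = gr_act h (J1 \<diamond> bas w)"
    using h by (simp add: \<Phi>_def gr_act_jm[OF P])
  then have \<Phi>w: "\<Phi> h \<diamond> bas w = (\<lambda>z. if z \<in> W then gr_mat h z w else 0)"
    using w by (simp add: J1_jm gr_act_bas)
  show "\<exists>c. (\<forall>y. c y \<in> ringA D) \<and> (\<forall>u. (\<Phi> h \<diamond> bas w) u - act D h (bas w) u = (\<Sum>y\<in>?L. c y * bas y u))"
  proof (intro exI[of _ c] conjI allI)
    fix y show "c y \<in> ringA D"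
      using h w by (auto simp: c_def intro!: A.uminus_closed A.sum_closed A.mult_closed kc_A hc_A)
  next
    fix u
    have "(\<Sum>y\<in>?L. c y * bas y u) = c u"
      by (subst sum_mult_bas) (auto simp: c_def)
    moreover have "(\<Phi> h \<diamond> bas w) u - act D h (bas w) u = c u"
    proof (cases "u \<in> W")
      case True
      show ?thesis
      proof (cases "sim u w")
        case True
        then show ?thesis using \<open>u \<in> W\<close> w by (simp add: \<Phi>w act_bas c_def gr_mat_def hs_def)
      next
        case nsim: False
        have m0: "gr_mat h u w = 0" using nsim by (simp add: gr_mat_def hs_def)
        show ?thesis
        proof (cases "le u w")
          case True
          then show ?thesis using \<open>u \<in> W\<close> w nsim m0 by (simp add: \<Phi>w act_bas c_def)
        next
          \<comment> \<open>If u is not below w, then C_u occurs in no product C_x C_w, so h.t_w has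
            no coefficient at u.\<close>
          case False
          then have "hc x w u = 0" if "x \<in> W" for x using hc_le(1) that w \<open>u \<in> W\<close> by blast
          then show ?thesis using \<open>u \<in> W\<close> w False m0 by (simp add: \<Phi>w act_bas c_def)
        qed
      qed
    next
      case False
      have "hc x w u = 0" if "x \<in> W" for x
        using kc_cH[of "C x \<bullet> C w"] cH_iff[of "kc (C x \<bullet> C w)"] that w False by (simp add: hcoef_def)
      then show ?thesis using False w by (simp add: \<Phi>w act_bas c_def)
    qed
    ultimately show "(\<Phi> h \<diamond> bas w) u - act D h (bas w) u = (\<Sum>y\<in>?L. c y * bas y u)" by simp
  qed
qed

text \<open>Products in \<open>J\<close> respect the two-sided cells, so only the part of \<open>h.t_w\<close> inside the cell of
  \<open>w\<close> can contribute to \<open>\<phi>(h) t_w\<close>.\<close>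

lemma hom_unique:
  assumes good: "L_good D" and hom: "unital_A_alg_hom D \<phi>"
    and agr: "agrees_with_action_mod_lower D \<phi>" and h: "h \<in> cH"
  shows "\<phi> h = gr_act h J1"
proof -
  have \<phi>h: "\<phi> h \<in> cH"
    using hom h ring_hom_closed[of \<phi> "hecke D" "J_A D" h] by (simp add: unital_A_alg_hom_def carrier_J)
  have bas_eq: "rmul_mat (bas w) u a = \<gamma> a w u" if "w \<in> W" for w u a
    using that by (simp add: rmul_mat_def sum_mult_bas)
  \<comment> \<open>The action on t_w read at u. Multiplied by the coordinates of the identity and
    summed over w, it turns phi(h) 1 into h * 1.\<close>
  have key: "(\<Sum>a\<in>W. \<gamma> a w u * \<phi> h a) = gr_mat h u w" if w: "w \<in> W" and u: "u \<in> W" for w u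
  proof -
    have l: "(\<phi> h \<diamond> bas w) u = (\<Sum>a\<in>W. \<gamma> a w u * \<phi> h a)"
      using u w by (simp add: jm_eq bas_eq)
    show ?thesis
    proof (cases "sim u w")
      case True
      obtain c where "\<forall>u. (\<phi> h \<diamond> bas w) u - act D h (bas w) u =
          (\<Sum>y\<in>{y \<in> W. le y w \<and> \<not> sim y w}. c y * bas y u)"
        using agr h w unfolding agrees_with_action_mod_lower_def by blast
      then have "(\<phi> h \<diamond> bas w) u - act D h (bas w) u =
          (\<Sum>y\<in>{y \<in> W. le y w \<and> \<not> sim y w}. c y * bas y u)" by blast
      \<comment> \<open>The error terms lie outside the cell of w, so they do not reach a coordinate
        u inside it.\<close>
      also have "\<dots> = 0" using True by (subst sum_mult_bas) auto
      finally have "(\<phi> h \<diamond> bas w) u = act D h (bas w) u" by simp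
      then show ?thesis using True w by (simp add: l act_bas gr_mat_def hs_def)
    next
      case False
      have "\<gamma> a w u = 0" if "a \<in> W" for a
        using False gamma_sim[OF that w u] sim_sym sim_trans by (metis const_gr_simps(1))
      then show ?thesis using False by (simp add: gr_mat_def hs_def)
    qed
  qed
  have "\<phi> h = \<phi> h \<diamond> J1" using jm_J1[OF \<phi>h] by simp
  also have "\<dots> = gr_act h J1"
  proof
    fix z
    have "(\<Sum>a\<in>W. rmul_mat J1 z a * \<phi> h a) = (\<Sum>y\<in>W. gr_mat h z y * J1 y)" if z: "z \<in> W"
    proof -
      have "(\<Sum>a\<in>W. rmul_mat J1 z a * \<phi> h a) = (\<Sum>a\<in>W. \<Sum>y\<in>W. J1 y * (\<gamma> a y z * \<phi> h a))"
        unfolding rmul_mat_def sum_distrib_right by (simp only: mult.assoc)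
      also have "\<dots> = (\<Sum>y\<in>W. J1 y * (\<Sum>a\<in>W. \<gamma> a y z * \<phi> h a))"
        by (subst sum.swap) (simp only: sum_distrib_left)
      also have "\<dots> = (\<Sum>y\<in>W. gr_mat h z y * J1 y)"
        using key z by (intro sum.cong HOL.refl) (simp add: mult.commute)
      finally show ?thesis .
    qed
    then show "(\<phi> h \<diamond> J1) z = gr_act h J1 z" by (simp add: jm_eq gr_act_def)
  qed
  finally show ?thesis .
qed

text \<open>The element C_w has a single Kazhdan-Lusztig coordinate, so its action on the identity
  is given directly by the truncated structure constants.\<close>

lemma gr_act_KL:
  assumes w: "w \<in> W"
  shows "gr_act (C w) J1 = (\<lambda>u. \<Sum>(z, d)\<in>{(z, d). z \<in> W \<and> d \<in> D_t D \<and> sim z d}.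
    hc w d z * const_gr (n_t D d) * bas z u)"
proof
  fix u
  let ?P = "{(z, d). z \<in> W \<and> d \<in> D_t D \<and> sim z d}"
  have sub: "?P \<subseteq> W \<times> W" by (auto simp: D_t_def)
  \<comment> \<open>The pair sum extends to all of W x W: \<open>n_t\<close> vanishes off
    \<open>D_t D\<close>, and \<open>hs\<close> vanishes between different cells.\<close>
  have "(\<Sum>(z, d)\<in>?P. hc w d z * const_gr (n_t D d) * bas z u) =
      (\<Sum>(z, d)\<in>W \<times> W. bas z u * (hs w d z * const_gr (n_t D d)))"
    by (rule sum.mono_neutral_cong_left) (use sub in \<open>auto simp: hs_def D_t_def mult_ac split: if_splits\<close>)
  also have "\<dots> = (\<Sum>z\<in>W. bas z u * (\<Sum>d\<in>W. hs w d z * const_gr (n_t D d)))"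
    by (simp add: sum.cartesian_product sum_distrib_left)
  also have "\<dots> = (if u \<in> W then \<Sum>d\<in>W. hs w d u * const_gr (n_t D d) else 0)"
    by (rule sum_mult_bas(3)) simp
  also have "\<dots> = gr_act (C w) J1 u"
  proof -
    have "gr_mat (C w) u y = hs w y u" for y
      using w by (simp add: gr_mat_def kc_KL sum_mult_bas)
    then show ?thesis by (simp add: gr_act_def J1_eq)
  qed
  finally show "gr_act (C w) J1 u = (\<Sum>(z, d)\<in>?P. hc w d z * const_gr (n_t D d) * bas z u)" by simp
qed

end

theorem theorem5p2:
  fixes D :: "('w, 'g::linordered_ab_group_add, 'i) hecke_datum"
  assumes "hecke_setting D" and "L_good D" and "P15_tilde D"
  shows "(\<exists>!\<phi>. \<phi> \<in> extensional (carrier (hecke D)) \<and>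
            unital_A_alg_hom D \<phi> \<and> agrees_with_action_mod_lower D \<phi>) \<and>
         (\<forall>\<phi>. unital_A_alg_hom D \<phi> \<and> agrees_with_action_mod_lower D \<phi> \<longrightarrow>
            (\<forall>w\<in>elts D. \<phi> (KL D w) =
               (\<lambda>u. \<Sum>(z, d)\<in>{(z, d). z \<in> elts D \<and> d \<in> D_t D \<and> sim_LR D z d}.
                      hcoef D w d z * const_gr (n_t D d) * bas z u)))"
proof -
  interpret hecke_ctx D by unfold_locales fact
  show ?thesis
  proof (intro conjI allI impI ballI)
    show "\<exists>!\<phi>. \<phi> \<in> extensional cH \<and> unital_A_alg_hom D \<phi> \<and> agrees_with_action_mod_lower D \<phi>"
    proof (rule ex1I[of _ \<Phi>])
      show "\<Phi> \<in> extensional cH \<and> unital_A_alg_hom D \<Phi> \<and> agrees_with_action_mod_lower D \<Phi>"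
        using \<Phi>_hom \<Phi>_agrees assms(2,3) by (simp add: \<Phi>_def)
      fix \<phi> assume \<phi>: "\<phi> \<in> extensional cH \<and> unital_A_alg_hom D \<phi> \<and> agrees_with_action_mod_lower D \<phi>"
      show "\<phi> = \<Phi>"
        \<comment> \<open>\<open>hom_unique\<close> gives equality on the carrier, and extensional
          maps are determined there.\<close>
        by (rule extensionalityI[of _ cH])
          (use \<phi> hom_unique[OF assms(2)] in \<open>auto simp: \<Phi>_def\<close>)
    qed
  next
    fix \<phi> w assume "unital_A_alg_hom D \<phi> \<and> agrees_with_action_mod_lower D \<phi>" "w \<in> elts D"
    then show "\<phi> (KL D w) = (\<lambda>u. \<Sum>(z, d)\<in>{(z, d). z \<in> elts D \<and> d \<in> D_t D \<and> sim_LR D z d}.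
        hcoef D w d z * const_gr (n_t D d) * bas z u)"
      using hom_unique[OF assms(2)] gr_act_KL by simp
  qed
qed

end
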